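(* $\mathrm{JB}_4$ has support $[1/6,26/27]$. The critical values of $\mathrm{JB}_4$, viewed as the function $(s,k)\mapsto\frac23s^2+\frac16(k-3)^2$, restricted to the boundary of the support of $(S_4,K_4)$ are: $1/6$ (at $(0,2)$); $x_*=(145\sqrt{145}-1729)/36\approx0.47309$ (tangency with the lower edges, where $k=\frac32(\sqrt{145}-11)$); $2/3$ (at the node $(0,1)$); and $26/27$ (at the cusps $(\pm2/\sqrt3,7/3)$). For $x\ge 0$, the distribution function of $\mathrm{JB}_4$ is $$F_{\mathrm{JB}_4}(x)=\frac1\pi\int\frac{\boldsymbol{K}(m)-\boldsymbol{F}(\phi_x\mid m)}{(k_3-k_1)^{1/2}}\,ds,\qquad \sin^2\phi_x=\frac{(k_3-k_1)(y-k_2)}{(k_3-k_2)(y-k_1)},\quad \phi_x\in[0,\pi/2],$$ where $y=\max\{k_2,\,3-(6x-4s^2)^{1/2}\}$, and the integral runs over those $s$ with $0<|s|<2/\sqrt3$, $4s^2<6x$ and $y<k_3$.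
   Context: $X_1,\dots,X_4$ are independent $N(\mu,\sigma^2)$ with $\sigma>0$; $m_r=\frac14\sum_i(X_i-\bar X)^r$, $S_4=m_3/m_2^{3/2}$, $K_4=m_4/m_2^2$, and $\mathrm{JB}_4=\frac23S_4^2+\frac16(K_4-3)^2$. Put $$Q_4(s,k)=18-45k+36k^2-9k^3-34s^2+18s^2k-3s^4 .$$ The support of $(S_4,K_4)$ is the closure of $\{Q_4>0,\ k>1\}$, a curvilinear triangle whose boundary lies on the curve $Q_4=0$; its vertices are the singular points of that curve, the node $(0,1)$ and the cusps $(\pm2/\sqrt3,7/3)$, and the lower edges are the two edges joining the node to the cusps. A point of the boundary is called critical if there the gradients of $\frac23s^2+\frac16(k-3)^2$ and of $Q_4$ are linearly dependent (so the singular points of the curve count as critical); critical values are the values of the function at such points. For $0<|s|<2/\sqrt3$, $Q_4(s,\cdot)$ has three real zeros $k_1<1<k_2<k_3$ (depending on $s$), and $m=(k_3-k_2)/(k_3-k_1)$. $\boldsymbol{F}(\phi\mid m)=\int_0^{\phi}(1-m\sin^2\psi)^{-1/2}\,d\psi$ is the incomplete, and $\boldsymbol{K}(m)=\boldsymbol{F}(\pi/2\mid m)$ the complete, elliptic integral of the first kind with parameter $m$. *)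

theory Defs
  imports "HOL-Probability.Probability"
begin

section \<open>Sample skewness, kurtosis and the Jarque--Bera statistic of four observations\<close>

definition sample_mean4 :: "(nat \<Rightarrow> 'a \<Rightarrow> real) \<Rightarrow> 'a \<Rightarrow> real" where
  "sample_mean4 X \<omega> = (\<Sum>i=1..4. X i \<omega>) / 4"

definition central_moment4 :: "(nat \<Rightarrow> 'a \<Rightarrow> real) \<Rightarrow> nat \<Rightarrow> 'a \<Rightarrow> real" where
  "central_moment4 X r \<omega> = (\<Sum>i=1..4. (X i \<omega> - sample_mean4 X \<omega>) ^ r) / 4"

text \<open>On the null event where the second central moment vanishes, the two quotients below
  are 0 by the convention for division.\<close>

definition skew4 :: "(nat \<Rightarrow> 'a \<Rightarrow> real) \<Rightarrow> 'a \<Rightarrow> real" where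
  "skew4 X \<omega> = central_moment4 X 3 \<omega> / (central_moment4 X 2 \<omega>) powr (3/2)"

definition kurt4 :: "(nat \<Rightarrow> 'a \<Rightarrow> real) \<Rightarrow> 'a \<Rightarrow> real" where
  "kurt4 X \<omega> = central_moment4 X 4 \<omega> / (central_moment4 X 2 \<omega>)\<^sup>2"

definition jb_fun :: "real \<times> real \<Rightarrow> real" where
  "jb_fun = (\<lambda>(s, k). 2/3 * s\<^sup>2 + 1/6 * (k - 3)\<^sup>2)"

definition JB4 :: "(nat \<Rightarrow> 'a \<Rightarrow> real) \<Rightarrow> 'a \<Rightarrow> real" where
  "JB4 X \<omega> = jb_fun (skew4 X \<omega>, kurt4 X \<omega>)"

definition topological_support :: "'b::topological_space measure \<Rightarrow> 'b set" where
  "topological_support N = {x. \<forall>U. open U \<longrightarrow> x \<in> U \<longrightarrow> emeasure N U > 0}"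


section \<open>The boundary curve, its edges, and critical points\<close>

definition Q4 :: "real \<Rightarrow> real \<Rightarrow> real" where
  "Q4 s k = 18 - 45 * k + 36 * k^2 - 9 * k^3 - 34 * s^2 + 18 * s^2 * k - 3 * s^4"

definition Q4_singular :: "(real \<times> real) set" where
  "Q4_singular = {p. case_prod Q4 p = 0 \<and> (GDERIV (case_prod Q4) p :> 0)}"

text \<open>\<open>linearly_dependent2 u v\<close> includes the case \<open>u = v\<close>, which dependence of the
  set \<open>{u, v}\<close> would miss.\<close>

definition linearly_dependent2 :: "'b::real_vector \<Rightarrow> 'b \<Rightarrow> bool" where
  "linearly_dependent2 u v \<longleftrightarrow> (\<exists>a b. (a, b) \<noteq> (0::real, 0::real) \<and> a *\<^sub>R u + b *\<^sub>R v = 0)"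

definition critical_points :: "(real \<times> real) set \<Rightarrow> (real \<times> real) set" where
  "critical_points B = {p \<in> B. \<exists>g h. (GDERIV jb_fun p :> g) \<and> (GDERIV (case_prod Q4) p :> h) \<and>
     linearly_dependent2 g h}"

text \<open>The level curve of \<open>jb_fun\<close> through \<open>p\<close> and the curve \<open>Q4 = 0\<close> are both regular
  at \<open>p\<close> and have the same tangent line there.\<close>

definition tangency_at :: "real \<times> real \<Rightarrow> bool" where
  "tangency_at p \<longleftrightarrow> case_prod Q4 p = 0 \<and> (\<exists>g h. (GDERIV jb_fun p :> g) \<and>
     (GDERIV (case_prod Q4) p :> h) \<and> g \<noteq> 0 \<and> h \<noteq> 0 \<and> linearly_dependent2 g h)"

text \<open>The edges of a curvilinear polygon with boundary \<open>B\<close> are the open arcs into which its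
  vertices, the singular points of the curve, divide \<open>B\<close>. The lower edges are those joining the
  node to a cusp.\<close>

definition edges :: "(real \<times> real) set \<Rightarrow> (real \<times> real) set set" where
  "edges B = components (B - Q4_singular)"

definition lower_edges :: "(real \<times> real) set \<Rightarrow> (real \<times> real) set set" where
  "lower_edges B = {E \<in> edges B. \<exists>c \<in> {(2 / sqrt 3, 7/3), (- 2 / sqrt 3, 7/3)}.
     closure E - E = {(0, 1), c}}"

definition SK_boundary :: "'a measure \<Rightarrow> (nat \<Rightarrow> 'a \<Rightarrow> real) \<Rightarrow> (real \<times> real) set" where
  "SK_boundary M X = frontier (topological_support (distr M borel (\<lambda>\<omega>. (skew4 X \<omega>, kurt4 X \<omega>))))"

definition x_star :: real where
  "x_star = (145 * sqrt 145 - 1729) / 36"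

definition k_star :: real where
  "k_star = 3/2 * (sqrt 145 - 11)"


section \<open>Elliptic integrals of the first kind and the distribution function\<close>

definition ellF :: "real \<Rightarrow> real \<Rightarrow> real" where
  "ellF \<phi> m = (LBINT \<psi>=0..\<phi>. (1 - m * (sin \<psi>)\<^sup>2) powr (-1/2))"

definition ellK :: "real \<Rightarrow> real" where
  "ellK m = ellF (pi/2) m"

text \<open>For \<open>0 < \<bar>s\<bar> < 2 / sqrt 3\<close> the list has length 3 and consists of the zeros
  \<open>k1 s < 1 < k2 s < k3 s\<close>; the functions are used only for such \<open>s\<close>.\<close>

definition Q4_zeros :: "real \<Rightarrow> real list" where
  "Q4_zeros s = sorted_list_of_set {k. Q4 s k = 0}"

definition k1 :: "real \<Rightarrow> real" where "k1 s = Q4_zeros s ! 0"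
definition k2 :: "real \<Rightarrow> real" where "k2 s = Q4_zeros s ! 1"
definition k3 :: "real \<Rightarrow> real" where "k3 s = Q4_zeros s ! 2"

definition modulus :: "real \<Rightarrow> real" where
  "modulus s = (k3 s - k2 s) / (k3 s - k1 s)"

definition ylow :: "real \<Rightarrow> real \<Rightarrow> real" where
  "ylow x s = max (k2 s) (3 - sqrt (6 * x - 4 * s\<^sup>2))"

definition phi :: "real \<Rightarrow> real \<Rightarrow> real" where
  "phi x s = (THE \<phi>. \<phi> \<in> {0..pi/2} \<and>
     (sin \<phi>)\<^sup>2 = (k3 s - k1 s) * (ylow x s - k2 s) / ((k3 s - k2 s) * (ylow x s - k1 s)))"

definition s_domain :: "real \<Rightarrow> real set" where
  "s_domain x = {s. 0 < \<bar>s\<bar> \<and> \<bar>s\<bar> < 2 / sqrt 3 \<and> 4 * s\<^sup>2 < 6 * x \<and> ylow x s < k3 s}"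

definition cdf_integrand :: "real \<Rightarrow> real \<Rightarrow> real" where
  "cdf_integrand x s = (ellK (modulus s) - ellF (phi x s) (modulus s)) / sqrt (k3 s - k1 s)"

end

theory Submission
  imports Defs
begin

text \<open>
  Skewness and kurtosis are invariant under affine changes of the data, so the observations may be
  taken standard normal. The orthogonal matrix with columns $\frac12(1,1,1,1)$,
  $\frac12(1,1,-1,-1)$, $\frac12(1,-1,1,-1)$, $\frac12(1,-1,-1,1)$ expresses them by four
  independent standard normal variables $d,a,b,c$, of which $d$ carries the mean and $a,b,c$ the
  deviations (\<open>gauss_hadamard\<close>). With $R=a^2+b^2+c^2$ one finds $S_4=6abc/R^{3/2}$
  and $K_4=1+4(a^2b^2+b^2c^2+c^2a^2)/R^2$ (\<open>SK4_hadamard\<close>). Hence $a^2/R,b^2/R,c^2/R$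
  are the roots of $t^3-t^2+\frac{k-1}4t-\frac{s^2}{36}$ at $(s,k)=(S_4,K_4)$, and $Q_4$ is 144
  times the discriminant of this cubic (\<open>Q4_discriminant\<close>).

  \<^bold>\<open>Support and critical points.\<close> A cubic of this shape has three real
  nonnegative roots exactly if $Q_4(s,k)\ge0$ and $k\ge1$. This gives the support of the pair, as
  Gaussian measure charges every open set, and its boundary is the part $k\ge1$ of the curve
  $Q_4=0$. Completing the square, $3Q_4=(7-3k)^3-(3s^2-9k+17)^2$; so on the curve there is a $t$
  with $7-3k=t^2$ and $3s^2-9k+17=t^3$, whence $3s^2=(t+1)(t-2)^2$, and $r^2=t+1$ makes both
  coordinates polynomials in $r$ (\<open>boundary_curve\<close>). On this curve the gradients are
  dependent exactly if $s\,t^3(16-9t-t^2)=0$ (\<open>gradients_dependent_iff\<close>), which lists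
  the critical points.

  \<^bold>\<open>Distribution function.\<close> The event $\mathrm{JB}_4\le x$ depends only on
  $p=a^2/R$, $q=b^2/R$ and $1-p-q$, whose law is the Dirichlet law with density
  $\frac1{2\pi}(pq(1-p-q))^{-1/2}$ (\<open>chi_square_dirichlet\<close>). By exchangeability one
  may assume $p<q<1-p-q$ at the price of a factor 6 (\<open>exchangeable_ordering\<close>). Then,
  one variable at a time, $q$ is replaced by $s$ for fixed $p$
  (\<open>dirichlet_skewness_substitution\<close>) and $p$ by $k$ for fixed $s$
  (\<open>branch_integral\<close>); on the ordered simplex both substitutions are monotone. The
  outcome is that the event has probability $\frac3{2\pi}\iint Q_4^{-1/2}\,dk\,ds$, taken over the
  points of the region where the statistic is at most $x$. For fixed $s$ the inner integral runs
  from $y$ to $k_3$, and the substitution that sends $k_2,k_3,k_1$ to $\sin^2\phi=0,1,\infty$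
  brings it to Legendre form (\<open>elliptic_integral_cubic\<close>).
\<close>


section \<open>The attainable pairs of skewness and kurtosis\<close>

text \<open>This set equals the closure of the region $Q_4>0$, $k>1$; the non-strict inequalities
  make closedness and membership of the vertices immediate.\<close>

definition SK_region :: "(real \<times> real) set" where
  "SK_region = {(s, k). 0 \<le> Q4 s k \<and> 1 \<le> k}"

text \<open>As a polynomial in $s^2$, $Q_4$ is quadratic, and its discriminant happens to be a
  perfect cube in $k$. All inequalities and the parametrization of the boundary come from this
  identity.\<close>

lemma Q4_complete_square:
  "3 * Q4 s k = (7 - 3 * k) ^ 3 - (3 * s^2 - (9 * k - 17))^2"
  unfolding Q4_def by algebra

lemma Q4_minus [simp]: "Q4 (- s) k = Q4 s k"
  by (simp add: Q4_def)

text \<open>The hypotheses say that $p,q,w$ are the roots of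
  $t^3-t^2+\frac{k-1}4t-\frac{s^2}{36}$.\<close>

lemma Q4_discriminant:
  assumes "p + q + w = 1" "s^2 = 36 * (p * q * w)" "k = 1 + 4 * (p * q + q * w + w * p)"
  shows "Q4 s k = 144 * ((p - q) * (q - w) * (w - p))^2"
proof -
  have w: "w = 1 - p - q" using assms(1) by simp
  have s4: "s ^ 4 = (s^2)^2" by simp
  show ?thesis unfolding Q4_def s4 assms(2,3) w by algebra
qed

text \<open>With $u=7-3k$ the completed square bounds $3s^2-(9k-17)$ by $u^{3/2}$ in absolute
  value. As $0\le u\le4$, this is at most $2u$, and at most $u$ if $u\le1$; these linear bounds
  replace the power $3/2$ and are sharp at the extremal points of the statistic.\<close>

lemma SK_region_bounds:
  assumes "0 \<le> Q4 s k" "1 \<le> k"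
  shows "k \<le> 7/3" "3 * s^2 \<le> 3 * k - 3" "k \<ge> 2 \<Longrightarrow> 3 * s^2 \<ge> 12 * k - 24"
proof -
  define u where "u = 7 - 3 * k"
  have u4: "u \<le> 4" using assms u_def by simp
  have sq: "(3 * s^2 - (9 * k - 17))^2 \<le> u ^ 3"
    using Q4_complete_square[of s k] assms(1) u_def by simp
  hence "0 \<le> u ^ 3" by (smt (verit) zero_le_power2)
  hence u0: "0 \<le> u" by (simp add: zero_le_power_eq)
  thus "k \<le> 7/3" using u_def by simp
  have "u ^ 3 \<le> (2 * u)^2"
    using u0 u4 mult_right_mono[of u 4 "u^2"] by (simp add: power2_eq_square power3_eq_cube)
  hence "(3 * s^2 - (9 * k - 17))^2 \<le> (2 * u)^2" using sq by simp
  hence "3 * s^2 - (9 * k - 17) \<le> 2 * u" using u0 power2_le_imp_le[of _ "2*u"] by auto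
  thus "3 * s^2 \<le> 3 * k - 3" using u_def by simp
  show "3 * s^2 \<ge> 12 * k - 24" if "k \<ge> 2"
  proof -
    have "u \<le> 1" using that u_def by simp
    hence "u ^ 3 \<le> u^2" using u0 by (simp add: power_decreasing)
    hence "(3 * s^2 - (9 * k - 17))^2 \<le> u^2" using sq by simp
    hence "\<bar>3 * s^2 - (9 * k - 17)\<bar> \<le> u" using u0 abs_le_square_iff[of "3 * s^2 - (9 * k - 17)" u] by simp
    thus ?thesis using u_def by simp
  qed
qed

text \<open>The upper bound is attained at the cusps, the lower one at $(0,2)$. Near $(0,2)$ the
  term in $k$ alone falls below $1/6$ as soon as $k>2$, and the bound on $s^2$ from below makes up
  for it.\<close>

lemma jb_fun_region_bounds:
  assumes "(s, k) \<in> SK_region"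
  shows "jb_fun (s, k) \<in> {1/6..26/27}"
proof -
  have *: "0 \<le> Q4 s k" "1 \<le> k" using assms by (auto simp: SK_region_def)
  note b = SK_region_bounds[OF *]
  have "2/3 * s^2 + 1/6 * (k - 3)^2 \<ge> 1/6"
  proof (cases "k \<ge> 2")
    case True
    have "(k - 3)^2 \<ge> 1 - 2 * (k - 2)"
      using zero_le_power2[of "k - 2"] by (simp add: power2_eq_square algebra_simps)
    moreover have "s^2 \<ge> 4 * k - 8" using b(3)[OF True] by simp
    ultimately show ?thesis using True by argo
  next
    case False
    have "1\<^sup>2 \<le> (3 - k)^2" by (rule power_mono) (use False in auto)
    hence "1 \<le> (k - 3)^2" by (simp add: power2_commute)
    thus ?thesis using zero_le_power2[of s] by linarith
  qed
  moreover have "2/3 * s^2 + 1/6 * (k - 3)^2 \<le> 26/27"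
  proof -
    have "(7 - 3*k) * (8 - (7 - 3*k)) \<ge> 0" by (rule mult_nonneg_nonneg) (use * b in auto)
    hence "(k - 3)^2 \<le> 4/9 + 4/3 * (7 - 3*k)" by (simp add: field_simps power2_eq_square)
    moreover have "s^2 \<le> k - 1" using b(2) by simp
    ultimately show ?thesis by argo
  qed
  ultimately show ?thesis by (simp add: jb_fun_def)
qed

lemma closed_SK_region: "closed SK_region"
proof -
  have eq: "SK_region = {p. 0 \<le> case_prod Q4 p} \<inter> {p. 1 \<le> snd p}"
    by (auto simp: SK_region_def)
  moreover have "closed {p::real\<times>real. 0 \<le> case_prod Q4 p}"
    unfolding Q4_def case_prod_beta by (intro closed_Collect_le continuous_intros)
  moreover have "closed {p::real\<times>real. 1 \<le> snd p}"
    by (intro closed_Collect_le continuous_intros)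
  ultimately show ?thesis unfolding eq by (intro closed_Int)
qed

lemma sphere_point_SK_region:
  assumes "a^2 + b^2 + c^2 = 1"
  shows "(6 * (a * b * c), 1 + 4 * (a^2 * b^2 + b^2 * c^2 + c^2 * a^2)) \<in> SK_region"
  using Q4_discriminant[OF assms, of "6 * (a * b * c)" "1 + 4 * (a^2 * b^2 + b^2 * c^2 + c^2 * a^2)"]
  by (auto simp: SK_region_def power_mult_distrib)

text \<open>The squares of the coordinates have to be the roots of the cubic attached to $(s,k)$.
  Its coefficients alternate in sign, so real roots cannot be negative; and nonnegativity of the
  discriminant makes all three roots real.\<close>

lemma SK_region_sphere_point:
  assumes "(s, k) \<in> SK_region"
  obtains a b c where "a^2 + b^2 + c^2 = 1" "s = 6 * (a * b * c)"
    "k = 1 + 4 * (a^2 * b^2 + b^2 * c^2 + c^2 * a^2)"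
proof -
  have Q: "0 \<le> Q4 s k" and k: "1 \<le> k" using assms by (auto simp: SK_region_def)
  define e2 where "e2 = (k - 1) / 4"
  define e3 where "e3 = s^2 / 36"
  have e2: "e2 \<ge> 0" and e3: "e3 \<ge> 0" using k by (auto simp: e2_def e3_def)
  define f where "f = (\<lambda>x::real. x^3 - x^2 + e2 * x - e3)"
  have "\<exists>p. 0 \<le> p \<and> p \<le> 1 + e3 \<and> f p = 0"
  proof (rule IVT')
    show "f 0 \<le> 0" using e3 by (simp add: f_def)
    have "f (1 + e3) = e3 * ((1 + e3)^2 - 1) + e2 * (1 + e3)" by (simp add: f_def) algebra
    moreover have "1 \<le> (1 + e3)^2" using e3 by (simp add: one_le_power)
    ultimately show "0 \<le> f (1 + e3)" using e2 e3 by simp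
    show "continuous_on {0..1 + e3} f" unfolding f_def by (intro continuous_intros)
  qed (use e3 in auto)
  then obtain p where "f p = 0" by blast
  hence p: "e3 = p^3 - p^2 + e2 * p" by (simp add: f_def)
  \<comment> \<open>the other two roots solve a quadratic equation with this discriminant\<close>
  define E where "E = (1 - p)^2 - 4 * (p^2 - p + e2)"
  \<comment> \<open>the value of that quadratic at $p$\<close>
  define D where "D = 3 * p^2 - 2 * p + e2"
  have s2: "s^2 = 36 * e3" and k2: "k = 1 + 4 * e2" by (auto simp: e2_def e3_def field_simps)
  have "Q4 s k = 144 * (D^2 * E)"
  proof -
    have s4: "s ^ 4 = (s^2)^2" by simp
    show ?thesis unfolding Q4_def D_def E_def k2 s4 s2 p by algebra
  qed
  hence DE: "0 \<le> D^2 * E" using Q by linarith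
  have "0 \<le> E"
  proof (cases "D = 0")
    case True
    hence "e2 = 2 * p - 3 * p^2" by (simp add: D_def)
    hence "E = (3 * p - 1)^2" unfolding E_def by algebra
    thus ?thesis by simp
  next
    case False
    thus ?thesis using DE by (simp add: zero_le_mult_iff)
  qed
  define q where "q = (1 - p + sqrt E) / 2"
  define w where "w = (1 - p - sqrt E) / 2"
  have sum: "p + q + w = 1" by (simp add: q_def w_def field_simps)
  have qw: "q * w = p^2 - p + e2"
  proof -
    have "q * w = ((1-p)^2 - (sqrt E)^2) / 4" by (simp add: q_def w_def field_simps power2_eq_square)
    also have "\<dots> = p^2 - p + e2" using \<open>0 \<le> E\<close> by (simp add: E_def)
    finally show ?thesis .
  qed
  have se2: "p * q + q * w + w * p = e2"
  proof -
    have "p * q + q * w + w * p = p * (1 - p) + q * w" using sum by algebra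
    thus ?thesis using qw by (simp add: algebra_simps power2_eq_square)
  qed
  have se3: "p * q * w = e3"
    unfolding mult.assoc qw p by algebra
  have nonneg: "x \<ge> 0" if "x^3 - x^2 + e2 * x - e3 = 0" for x
  proof (rule ccontr)
    assume "\<not> x \<ge> 0"
    hence "x^3 < 0" "e2 * x \<le> 0" using e2 by (auto simp: power_less_zero_eq mult_nonneg_nonpos)
    thus False using that e3 zero_le_power2[of x] by linarith
  qed
  have root: "x^3 - x^2 + e2 * x - e3 = (x - p) * (x - q) * (x - w)" for x
  proof -
    have "(x - p) * (x - q) * (x - w) = x^3 - (p + q + w) * x^2 + (p * q + q * w + w * p) * x - p * q * w"
      by algebra
    thus ?thesis by (simp add: sum se2 se3)
  qed
  have pqw: "p \<ge> 0" "q \<ge> 0" "w \<ge> 0"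
    by (rule nonneg, simp add: root)+
  define c where "c = (if s \<ge> 0 then sqrt w else - sqrt w)"
  have sq: "(sqrt p)^2 = p" "(sqrt q)^2 = q" "c^2 = w" using pqw by (auto simp: c_def)
  have abs: "sqrt p * sqrt q * sqrt w = \<bar>s\<bar> / 6"
    unfolding real_sqrt_mult[symmetric] se3 e3_def by (simp add: real_sqrt_divide)
  show ?thesis
  proof (rule that[of "sqrt p" "sqrt q" c])
    show "(sqrt p)^2 + (sqrt q)^2 + c^2 = 1" by (simp only: sq sum)
    show "s = 6 * (sqrt p * sqrt q * c)" using abs by (auto simp: c_def)
    show "k = 1 + 4 * ((sqrt p)^2 * (sqrt q)^2 + (sqrt q)^2 * c^2 + c^2 * (sqrt p)^2)"
      by (simp only: sq se2 k2)
  qed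
qed

lemma not_interior_if_leaves:
  fixes T :: "('a::metric_space) set"
  assumes "continuous_on (UNIV :: real set) g" "g 0 = p" "\<And>e. 0 < e \<Longrightarrow> e < 1 \<Longrightarrow> g e \<notin> T"
  shows "p \<notin> interior T"
proof
  assume "p \<in> interior T"
  then obtain U where U: "open U" "p \<in> U" and UT: "U \<subseteq> T" by (auto simp: interior_def)
  have "isCont g 0" using assms(1) by (simp add: continuous_on_eq_continuous_at)
  hence "(g \<longlongrightarrow> p) (at_right 0)"
    unfolding isCont_def assms(2) by (rule tendsto_within_subset) simp
  hence "\<forall>\<^sub>F e in at_right 0. g e \<in> U"
    using U by (rule topological_tendstoD)
  moreover have "\<forall>\<^sub>F e in at_right (0::real). e \<in> {0<..<1}"
    by (rule eventually_at_right_real) simp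
  ultimately have "\<forall>\<^sub>F e in at_right (0::real). g e \<in> U \<and> e \<in> {0<..<1}"
    by (rule eventually_conj)
  then obtain e :: real where "g e \<in> U" "e \<in> {0<..<1}"
    using eventually_happens'[OF trivial_limit_at_right_real] by blast
  thus False using assms(3) UT by auto
qed


section \<open>The boundary of the region\<close>

lemma Q4_quadratic: "Q4 s k = - 3 * (s^2)^2 + 2 * (9 * k - 17) * s^2 + 9 * (k - 1)^2 * (2 - k)"
  unfolding Q4_def by algebra

text \<open>A zero of $Q_4$ can be left in the direction of $s$ unless $s=0$: $Q_4$ is strictly
  concave in $s^2$, so it becomes negative when $s^2$ increases or when it decreases. At $s=0$ no
  decrease is possible; the zeros there are $(0,1)$ and $(0,2)$, and from them one moves along
  $k$.\<close>

lemma frontier_SK_region: "frontier SK_region = {(s, k). Q4 s k = 0 \<and> 1 \<le> k}"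
proof -
  have op: "open {p::real\<times>real. 0 < case_prod Q4 p \<and> 1 < snd p}"
    unfolding Q4_def case_prod_beta by (intro open_Collect_conj open_Collect_less continuous_intros)
  have int: "(s, k) \<in> interior SK_region \<longleftrightarrow> 0 < Q4 s k \<and> 1 < k" for s k
  proof
    assume "0 < Q4 s k \<and> 1 < k"
    thus "(s, k) \<in> interior SK_region"
      by (intro interiorI[OF op]) (auto simp: SK_region_def)
  next
    assume i: "(s, k) \<in> interior SK_region"
    hence sk: "0 \<le> Q4 s k" "1 \<le> k" using interior_subset by (auto simp: SK_region_def)
    show "0 < Q4 s k \<and> 1 < k"
    proof (rule ccontr)
      assume "\<not> ?thesis"
      hence cases: "k = 1 \<or> Q4 s k = 0" using sk by auto
      define d where "d = 2 * (9 * k - 17) - 6 * s^2"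
      have step: "Q4 (sqrt (s^2 + h)) k = Q4 s k + d * h - 3 * h^2" if "s^2 + h \<ge> 0" for h
      proof -
        have "(sqrt (s^2 + h))^2 = s^2 + h" using that by simp
        thus ?thesis unfolding Q4_quadratic d_def by algebra
      qed
      define sg where "sg = (if s \<ge> 0 then 1 else - 1 :: real)"
      have sg: "sg * sqrt (s^2) = s" "Q4 (sg * z) k' = Q4 z k'" for z k'
        by (auto simp: sg_def)
      have "(s, k) \<notin> interior SK_region"
      proof (cases "k = 1")
        case True
        show ?thesis
          by (rule not_interior_if_leaves[of "\<lambda>e. (s, k - e)"])
             (auto intro!: continuous_intros simp: SK_region_def True)
      next
        case False
        hence Q0: "Q4 s k = 0" using cases by auto
        consider "d \<le> 0" | "d > 0" "s \<noteq> 0" | "s = 0" by linarith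
        thus ?thesis
        proof cases
          case 1
          have neg: "Q4 (sg * sqrt (s^2 + e)) k < 0" if "0 < e" for e
          proof -
            have "d * e \<le> 0" "0 < e^2" using 1 that by (auto simp: mult_nonpos_nonneg)
            moreover have "Q4 (sg * sqrt (s^2 + e)) k = d * e - 3 * e^2"
              using step[of e] that Q0 by (simp add: sg)
            ultimately show ?thesis by linarith
          qed
          show ?thesis
          proof (rule not_interior_if_leaves)
            show "continuous_on UNIV (\<lambda>e. (sg * sqrt (s^2 + e), k))" by (intro continuous_intros)
            show "(sg * sqrt (s^2 + 0), k) = (s, k)" by (simp add: sg_def)
            show "(sg * sqrt (s^2 + e), k) \<notin> SK_region" if "0 < e" "e < 1" for e
              using neg[OF that(1)] by (auto simp: SK_region_def)
          qed
        next
          case 2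
          have neg: "Q4 (sg * sqrt (s^2 - s^2 * e)) k < 0" if "0 < e" "e < 1" for e
          proof -
            have "d * (s^2 * e) > 0" "0 < s^2" using 2 that by auto
            moreover have "s^2 * e \<le> s^2" using that by (simp add: mult_left_le)
            ultimately show ?thesis using step[of "- (s^2 * e)"] that Q0 sg
              by (smt (verit) zero_le_power2 mult_minus_right)
          qed
          show ?thesis
          proof (rule not_interior_if_leaves)
            show "continuous_on UNIV (\<lambda>e. (sg * sqrt (s^2 - s^2 * e), k))" by (intro continuous_intros)
            show "(sg * sqrt (s^2 - s^2 * 0), k) = (s, k)" by (simp add: sg_def)
            show "(sg * sqrt (s^2 - s^2 * e), k) \<notin> SK_region" if "0 < e" "e < 1" for e
              using neg[OF that] by (auto simp: SK_region_def)
          qed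
        next
          case 3
          hence k: "k = 2" using Q0 False by (auto simp: Q4_quadratic)
          have neg: "Q4 s (k + e) < 0" if "0 < e" for e
            using that by (simp add: Q4_quadratic 3 k mult_pos_neg)
          show ?thesis
          proof (rule not_interior_if_leaves)
            show "continuous_on UNIV (\<lambda>e. (s, k + e))" by (intro continuous_intros)
            show "(s, k + 0) = (s, k)" by (simp add: sg_def)
            show "(s, k + e) \<notin> SK_region" if "0 < e" "e < 1" for e
              using neg[OF that(1)] by (auto simp: SK_region_def)
          qed
        qed
      qed
      thus False using i by simp
    qed
  qed
  have one: "Q4 s 1 \<le> 0" for s
  proof -
    have "Q4 s 1 = - (3 * (s^2)^2 + 16 * s^2)" by (simp add: Q4_quadratic)
    moreover have "0 \<le> 3 * (s^2)^2 + 16 * s^2" by (intro add_nonneg_nonneg mult_nonneg_nonneg) auto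
    ultimately show ?thesis by linarith
  qed
  show ?thesis
  proof (rule set_eqI)
    fix p :: "real \<times> real"
    obtain s k where p: "p = (s, k)" by (cases p)
    have "p \<in> frontier SK_region \<longleftrightarrow> (0 \<le> Q4 s k \<and> 1 \<le> k) \<and> \<not> (0 < Q4 s k \<and> 1 < k)"
      unfolding frontier_def closure_closed[OF closed_SK_region] p using int by (simp add: SK_region_def)
    also have "\<dots> \<longleftrightarrow> Q4 s k = 0 \<and> 1 \<le> k"
      using one[of s] by (cases "k = 1") auto
    finally show "p \<in> frontier SK_region \<longleftrightarrow> p \<in> {(s, k). Q4 s k = 0 \<and> 1 \<le> k}" by (simp add: p)
  qed
qed

text \<open>The parameter is related to the number $t$ with $7-3k=t^2$ and $3s^2-(9k-17)=t^3$ by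
  $r^2=t+1$. The node is passed at $r=\pm\sqrt3$, the cusps at $r=\pm1$ and the point $(0,2)$ at
  $r=0$.\<close>

definition boundary_curve :: "real \<Rightarrow> real \<times> real" where
  "boundary_curve r = (r * (3 - r^2) / sqrt 3, (7 - (r^2 - 1)^2) / 3)"

lemma boundary_curve_square:
  "(fst (boundary_curve r))^2 = r^2 * (3 - r^2)^2 / 3"
  by (simp add: boundary_curve_def power_divide power_mult_distrib)

lemma image_boundary_curve: "boundary_curve ` {- sqrt 3..sqrt 3} = {(s, k). Q4 s k = 0 \<and> 1 \<le> k}"
proof (intro equalityI subsetI)
  fix p assume "p \<in> boundary_curve ` {- sqrt 3..sqrt 3}"
  then obtain r where r0: "r \<in> {- sqrt 3..sqrt 3}" "p = boundary_curve r" by blast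
  hence r: "\<bar>r\<bar> \<le> sqrt 3" "p = boundary_curve r" by (auto simp: abs_le_iff)
  have r3: "r^2 \<le> 3" using r(1) by (metis abs_le_square_iff abs_of_nonneg real_sqrt_ge_zero real_sqrt_pow2 zero_le_numeral)
  obtain s k where sk: "boundary_curve r = (s, k)" by (cases "boundary_curve r")
  have s: "s^2 = r^2 * (3 - r^2)^2 / 3" using boundary_curve_square[of r] sk by simp
  have k: "k = (7 - (r^2 - 1)^2) / 3" using sk by (simp add: boundary_curve_def)
  have "3 * Q4 s k = 0" unfolding Q4_complete_square s k by (simp add: field_simps) algebra
  moreover have "(r^2 - 1)^2 \<le> 2\<^sup>2"
    by (rule abs_le_square_iff[THEN iffD1]) (use r3 zero_le_power2[of r] in arith)
  ultimately show "p \<in> {(s, k). Q4 s k = 0 \<and> 1 \<le> k}" using r(2) sk k by simp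
next
  fix p assume "p \<in> {(s, k). Q4 s k = 0 \<and> 1 \<le> k}"
  then obtain s k where p: "p = (s, k)" "Q4 s k = 0" "1 \<le> k" by auto
  have k73: "k \<le> 7/3" using SK_region_bounds(1)[of s k] p by simp
  \<comment> \<open>$t$ is the square root of $7-3k$ with the sign of $v$\<close>
  define v where "v = 3 * s^2 - (9 * k - 17)"
  have v2: "v^2 = (7 - 3 * k) ^ 3" using Q4_complete_square[of s k] p v_def by simp
  define t where "t = (if v \<ge> 0 then sqrt (7 - 3 * k) else - sqrt (7 - 3 * k))"
  have t2: "t^2 = 7 - 3 * k" using k73 by (simp add: t_def)
  have t3: "t ^ 3 = v"
  proof -
    have "(t ^ 3)^2 = v^2" unfolding v2 t2[symmetric] by algebra
    hence "\<bar>t ^ 3\<bar> = \<bar>v\<bar>" unfolding power2_eq_iff abs_eq_iff .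
    thus ?thesis using k73 by (auto simp: t_def abs_if split: if_splits)
  qed
  have S: "3 * s^2 = (t + 1) * (t - 2)^2"
    using t2 t3 unfolding v_def by algebra
  have "t^2 \<le> 2\<^sup>2" using t2 p(3) by simp
  hence tb: "\<bar>t\<bar> \<le> 2" by (metis abs_le_square_iff abs_numeral)
  have t1: "t \<ge> -1"
  proof (rule ccontr)
    assume "\<not> ?thesis"
    hence "(t + 1) * (t - 2)^2 < 0" using tb by (intro mult_neg_pos) auto
    thus False using S zero_le_power2[of s] by simp
  qed
  define r where "r = (if s \<ge> 0 then sqrt (t + 1) else - sqrt (t + 1))"
  have r2: "r^2 = t + 1" using t1 by (simp add: r_def)
  have "s = r * (3 - r^2) / sqrt 3"
  proof -
    have "s^2 = (r * (3 - r^2) / sqrt 3)^2"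
      by (simp only: power_divide power_mult_distrib r2) (use S in \<open>simp add: field_simps power2_eq_square\<close>)
    hence "\<bar>s\<bar> = \<bar>r * (3 - r^2) / sqrt 3\<bar>" unfolding power2_eq_iff abs_eq_iff .
    also have "\<dots> = \<bar>r\<bar> * (3 - r^2) / sqrt 3" using tb r2 by (simp add: abs_mult)
    finally show ?thesis using t1 by (auto simp: r_def split: if_splits)
  qed
  moreover have "k = (7 - (r^2 - 1)^2) / 3" unfolding r2 using t2 by simp
  ultimately have "p = boundary_curve r" using p(1) by (simp add: boundary_curve_def)
  moreover have "\<bar>r\<bar> \<le> sqrt 3" using tb t1 by (auto simp: r_def)
  hence "r \<in> {- sqrt 3..sqrt 3}" by (simp add: abs_le_iff)
  ultimately show "p \<in> boundary_curve ` {- sqrt 3..sqrt 3}" by blast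
qed


section \<open>Gradients along the boundary curve\<close>

abbreviation jb_gradient :: "real \<Rightarrow> real \<Rightarrow> real \<times> real" where
  "jb_gradient s k \<equiv> (4/3 * s, (k - 3) / 3)"

abbreviation Q4_gradient :: "real \<Rightarrow> real \<Rightarrow> real \<times> real" where
  "Q4_gradient s k \<equiv> (4 * s * (9 * k - 17 - 3 * s^2), 18 * s^2 - 9 * (3 * k - 5) * (k - 1))"

lemma GDERIV_jb_fun: "GDERIV jb_fun (s, k) :> jb_gradient s k"
  unfolding gderiv_def jb_fun_def case_prod_beta
  by (auto intro!: derivative_eq_intros simp: field_simps fun_eq_iff inner_prod_def)

lemma GDERIV_Q4: "GDERIV (case_prod Q4) (s, k) :> Q4_gradient s k"
  unfolding gderiv_def Q4_def case_prod_beta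
  by (auto intro!: derivative_eq_intros simp: algebra_simps fun_eq_iff inner_prod_def power2_eq_square power3_eq_cube)

lemma GDERIV_unique:
  assumes "GDERIV f x :> a" "GDERIV f x :> b" shows "a = b"
proof -
  have "(\<lambda>h. inner h a) = (\<lambda>h. inner h b)"
    using assms has_derivative_unique unfolding gderiv_def by blast
  thus ?thesis by (metis inner_commute vector_eq_ldot)
qed

lemma linearly_dependent2_R2:
  "linearly_dependent2 (a, b) (c, d :: real) \<longleftrightarrow> a * d = b * (c::real)"
proof
  assume "linearly_dependent2 (a, b) (c, d)"
  then obtain x y where "(x, y) \<noteq> (0, 0)" "x * a + y * c = 0" "x * b + y * d = 0"
    by (auto simp: linearly_dependent2_def zero_prod_def)
  moreover from this(2,3) have "x * (a * d - b * c) = 0" by algebra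
  moreover from calculation(2,3) have "y * (a * d - b * c) = 0" by algebra
  ultimately show "a * d = b * c" by auto
next
  assume *: "a * d = b * c"
  show "linearly_dependent2 (a, b) (c, d)"
  proof (cases "(c, d) = (0, 0)")
    case True
    thus ?thesis unfolding linearly_dependent2_def by (intro exI[of _ 0] exI[of _ 1]) (auto simp: zero_prod_def)
  next
    case False
    show ?thesis
    proof (cases "c = 0")
      case True
      with False * show ?thesis unfolding linearly_dependent2_def
        by (intro exI[of _ d] exI[of _ "- b"]) (auto simp: zero_prod_def)
    next
      case False
      with * show ?thesis unfolding linearly_dependent2_def
        by (intro exI[of _ c] exI[of _ "- a"]) (auto simp: zero_prod_def algebra_simps)
    qed
  qed
qed

text \<open>If $s\ne0$, vanishing of the derivative in $s$ makes the square in the completed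
  square vanish, and then so does the cube.\<close>

lemma Q4_singular_iff: 
  "(s, k) \<in> Q4_singular \<longleftrightarrow> (s, k) \<in> {(0, 1), (2 / sqrt 3, 7/3), (- 2 / sqrt 3, 7/3)}"
proof -
  have iff: "(s, k) \<in> Q4_singular \<longleftrightarrow> Q4 s k = 0 \<and> s * (9 * k - 17 - 3 * s^2) = 0 \<and> 18 * s^2 = 9 * (3 * k - 5) * (k - 1)"
  proof -
    have "(s, k) \<in> Q4_singular \<longleftrightarrow> Q4 s k = 0 \<and>
        Q4_gradient s k = 0"
      unfolding Q4_singular_def using GDERIV_Q4[of s k] GDERIV_unique[OF GDERIV_Q4[of s k], of 0]
      by auto
    thus ?thesis by (auto simp: zero_prod_def)
  qed
  have "s^2 = 4/3 \<longleftrightarrow> s \<in> {2 / sqrt 3, - 2 / sqrt 3}"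
  proof -
    have "s^2 = 4/3 \<longleftrightarrow> s^2 = (2 / sqrt 3)^2" by (simp add: power_divide)
    thus ?thesis by (simp add: power2_eq_iff)
  qed
  moreover have "(s, k) \<in> Q4_singular \<longleftrightarrow> (s = 0 \<and> k = 1) \<or> (s^2 = 4/3 \<and> k = 7/3)"
  proof
    assume "(s, k) \<in> Q4_singular"
    hence *: "Q4 s k = 0" "s * (9 * k - 17 - 3 * s^2) = 0" "18 * s^2 = 9 * (3 * k - 5) * (k - 1)"
      using iff by auto
    show "(s = 0 \<and> k = 1) \<or> (s^2 = 4/3 \<and> k = 7/3)"
    proof (cases "s = 0")
      case True
      thus ?thesis using * by (auto simp: Q4_quadratic)
    next
      case False
      hence s2: "3 * s^2 = 9 * k - 17" using * by simp
      hence "(7 - 3 * k) ^ 3 = 0" using *(1) Q4_complete_square[of s k] by simp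
      hence "k = 7/3" by simp
      thus ?thesis using s2 by simp
    qed
  next
    assume "(s = 0 \<and> k = 1) \<or> (s^2 = 4/3 \<and> k = 7/3)"
    thus "(s, k) \<in> Q4_singular"
    proof
      assume "s = 0 \<and> k = 1"
      thus ?thesis unfolding iff by (simp add: Q4_quadratic)
    next
      assume "s^2 = 4/3 \<and> k = 7/3"
      hence s: "s^2 = 4/3" and k: "k = 7/3" by auto
      have "Q4 s k = 0 \<and> s * (9 * k - 17 - 3 * s^2) = 0 \<and> 18 * s^2 = 9 * (3 * k - 5) * (k - 1)"
        unfolding Q4_quadratic s k by (simp add: power2_eq_square)
      thus ?thesis using iff by blast
    qed
  qed
  ultimately show ?thesis by auto
qed

text \<open>Both partial derivatives are divisible by $t^3$, which reflects the cusps at $t=0$;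
  the second also vanishes at the node $t=2$.\<close>

lemma boundary_curve_Q4_gradient:
  assumes "boundary_curve r = (s, k)" and t: "t = r^2 - 1"
  shows "9 * k - 17 - 3 * s^2 = - (t ^ 3)" "18 * s^2 - 9 * (3 * k - 5) * (k - 1) = 3 * t ^ 3 * (2 - t)"
    "s^2 = (t + 1) * (2 - t)^2 / 3" "k = (7 - t^2) / 3"
proof -
  have r2: "r^2 = t + 1" using t by simp
  show s: "s^2 = (t + 1) * (2 - t)^2 / 3" using boundary_curve_square[of r] assms(1) by (simp add: r2)
  show k: "k = (7 - t^2) / 3" using assms(1) by (auto simp: boundary_curve_def r2)
  have s3: "3 * s^2 = (t + 1) * (2 - t)^2" and k3: "3 * k = 7 - t^2" using s k by simp_all
  show "9 * k - 17 - 3 * s^2 = - (t ^ 3)" using s3 k3 by algebra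
  have "18 * s^2 - 9 * (3 * k - 5) * (k - 1) = 6 * (3 * s^2) - 3 * (3 * k - 5) * (3 * k - 3)" by algebra
  also have "\<dots> = 3 * t ^ 3 * (2 - t)" unfolding s3 k3 by algebra
  finally show "18 * s^2 - 9 * (3 * k - 5) * (k - 1) = 3 * t ^ 3 * (2 - t)" .
qed

text \<open>The positive root of $t^2+9t-16$.\<close>

definition t_star :: real where "t_star = (sqrt 145 - 9) / 2"

lemma t_star: "1 < t_star" "t_star < 2" "t_star\<^sup>2 = 16 - 9 * t_star"
proof -
  have "sqrt 145 > sqrt (11\<^sup>2)" "sqrt 145 < sqrt (13\<^sup>2)" by (intro real_sqrt_less_mono; simp)+
  thus "1 < t_star" "t_star < 2" by (simp_all add: t_star_def)
  have "2 * t_star + 9 = sqrt 145" by (simp add: t_star_def field_simps)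
  hence "(2 * t_star + 9)^2 = 145" by simp
  thus "t_star\<^sup>2 = 16 - 9 * t_star" by (simp add: power2_eq_square algebra_simps)
qed

lemma t_star_unique:
  assumes "t^2 = 16 - 9 * t" "t \<ge> - 1" shows "t = t_star"
proof -
  have "(t - t_star) * (t + t_star + 9) = 0" using assms(1) t_star(3) by algebra
  thus ?thesis using assms(2) t_star(1) by auto
qed

lemma jb_fun_tangency:
  assumes "s^2 = (t_star + 1) * (2 - t_star)^2 / 3" "k = (7 - t_star\<^sup>2) / 3"
  shows "jb_fun (s, k) = x_star" "k = k_star"
proof -
  show "k = k_star" unfolding assms(2) t_star(3) by (simp add: t_star_def k_star_def field_simps)
  have t3: "t_star ^ 3 = 97 * t_star - 144"
    using t_star(3) by algebra
  have t4: "t_star ^ 4 = 1552 - 1017 * t_star"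
  proof -
    have "t_star ^ 4 = t_star * t_star ^ 3" by (simp add: power_Suc[symmetric])
    also have "\<dots> = 97 * t_star\<^sup>2 - 144 * t_star" unfolding t3 by (simp add: algebra_simps power2_eq_square)
    finally show ?thesis by (simp add: t_star(3))
  qed
  \<comment> \<open>the statistic along the curve as a polynomial in $t$, to be reduced modulo $t^2+9t-16$\<close>
  have poly: "54 * (2/3 * ((t + 1) * (2 - t)^2 / 3) + 1/6 * ((7 - t^2) / 3 - 3)^2) =
      52 - 32 * t^2 + 12 * t ^ 3 + t ^ 4" for t :: real
    by (simp add: power2_eq_square power3_eq_cube power4_eq_xxxx field_simps)
  have "54 * jb_fun (s, k) = 52 - 32 * t_star\<^sup>2 + 12 * t_star ^ 3 + t_star ^ 4"
    unfolding jb_fun_def prod.case assms poly ..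
  also have "\<dots> = 435 * t_star - 636" unfolding t3 t4 t_star(3) by simp
  finally have "54 * jb_fun (s, k) = 435 * t_star - 636" .
  thus "jb_fun (s, k) = x_star" by (simp add: x_star_def t_star_def field_simps)
qed

text \<open>The determinant of the two gradients is a multiple of $s\,t^3(16-9t-t^2)$.\<close>

lemma gradients_dependent_iff:
  assumes "boundary_curve r = (s, k)" "\<bar>r\<bar> \<le> sqrt 3"
  shows "linearly_dependent2 (jb_gradient s k) (Q4_gradient s k)
     \<longleftrightarrow> s = 0 \<or> r^2 = 1 \<or> r^2 = 1 + t_star"
proof -
  define t where "t = r^2 - 1"
  note g = boundary_curve_Q4_gradient[OF assms(1) t_def]
  have "(4/3 * s) * (3 * t ^ 3 * (2 - t)) = (k - 3) / 3 * (4 * s * (- (t ^ 3))) \<longleftrightarrow>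
      s * t ^ 3 * (16 - 9 * t - t^2) = 0"
    unfolding g(4) by (simp add: field_simps) algebra
  also have "\<dots> \<longleftrightarrow> s = 0 \<or> t = 0 \<or> t^2 = 16 - 9 * t" by auto
  also have "t^2 = 16 - 9 * t \<longleftrightarrow> t = t_star"
    using t_star_unique[of t] t_star(3) by (auto simp: t_def)
  also have "s = 0 \<or> t = 0 \<or> t = t_star \<longleftrightarrow> s = 0 \<or> r^2 = 1 \<or> r^2 = 1 + t_star" by (auto simp: t_def)
  finally show ?thesis unfolding linearly_dependent2_R2 g(1,2) .
qed


section \<open>Edges and critical points\<close>

lemma boundary_curve_special:
  "boundary_curve 0 = (0, 2)" "boundary_curve (sqrt 3) = (0, 1)" "boundary_curve (- sqrt 3) = (0, 1)"
  "boundary_curve 1 = (2 / sqrt 3, 7/3)" "boundary_curve (- 1) = (- 2 / sqrt 3, 7/3)"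
  by (auto simp: boundary_curve_def)

lemma square_eq_3: "r^2 = 3 \<longleftrightarrow> r = sqrt 3 \<or> r = - sqrt 3" for r :: real
  using power2_eq_iff[of r "sqrt 3"] by simp

lemma boundary_curve_singular_iff: "boundary_curve r \<in> Q4_singular \<longleftrightarrow> r^2 = 1 \<or> r^2 = 3"
proof
  assume "boundary_curve r \<in> Q4_singular"
  hence "boundary_curve r \<in> {(0, 1), (2 / sqrt 3, 7/3), (- 2 / sqrt 3, 7/3)}"
    using Q4_singular_iff by (metis surj_pair)
  hence "snd (boundary_curve r) = 1 \<or> snd (boundary_curve r) = 7/3" by auto
  hence "(r^2 - 1)^2 = 2\<^sup>2 \<or> r^2 = 1" by (auto simp: boundary_curve_def)
  thus "r^2 = 1 \<or> r^2 = 3"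
    using power2_eq_iff[of "r^2 - 1" 2] zero_le_power2[of r] by auto
next
  assume "r^2 = 1 \<or> r^2 = 3"
  hence "r = 1 \<or> r = - 1 \<or> r = sqrt 3 \<or> r = - sqrt 3" by (auto simp: square_eq_3 power2_eq_1_iff)
  thus "boundary_curve r \<in> Q4_singular"
    by (auto simp: boundary_curve_special Q4_singular_iff simp del: divide_minus_left)
qed

text \<open>A component meets only one member of the partition, as two would disconnect it, and
  contains it by maximality.\<close>

lemma components_eq_if_open_partition:
  assumes S: "\<Union>\<E> = S"
    and conn: "\<And>E. E \<in> \<E> \<Longrightarrow> connected E \<and> E \<noteq> {}"
    and op: "\<And>E. E \<in> \<E> \<Longrightarrow> \<exists>U. open U \<and> S \<inter> U = E"
    and disj: "pairwise disjnt \<E>"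
  shows "components S = \<E>"
proof -
  have main: "C = E" if C: "C \<in> components S" and E: "E \<in> \<E>" and x: "x \<in> C" "x \<in> E" for C E x
  proof
    obtain U where U: "open U" "S \<inter> U = E" using op E by blast
    obtain V where V: "\<And>F. F \<in> \<E> \<Longrightarrow> open (V F) \<and> S \<inter> V F = F" using op by metis
    define W where "W = (\<Union>F\<in>\<E> - {E}. V F)"
    have "open W" unfolding W_def using V by (intro open_UN) auto
    moreover have "S \<inter> W = (\<Union>F\<in>\<E> - {E}. S \<inter> V F)" unfolding W_def by blast
    moreover have "\<dots> = \<Union>(\<E> - {E})" using V by simp
    ultimately have W: "open W" "S \<inter> W = \<Union>(\<E> - {E})" by simp_all
    have EW: "E \<inter> \<Union>(\<E> - {E}) = {}"
      using disj E unfolding pairwise_def disjnt_def by blast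
    have CS: "C \<subseteq> S" "connected C" using C in_components_subset in_components_connected by auto
    show "C \<subseteq> E"
    proof (rule ccontr)
      assume "\<not> C \<subseteq> E"
      hence "W \<inter> C \<noteq> {}" using CS S W by blast
      moreover have "U \<inter> C \<noteq> {}" using x U by auto
      moreover have "C \<subseteq> U \<union> W" using CS S W U by blast
      moreover have "U \<inter> W \<inter> C = {}" using CS U W EW by blast
      ultimately show False using connectedD[OF CS(2) U(1) W(1)] by blast
    qed
    show "E \<subseteq> C"
      by (rule components_maximal[OF C]) (use conn E S x in auto)
  qed
  show ?thesis
  proof (intro equalityI subsetI)
    fix C assume C: "C \<in> components S"
    then obtain x where "x \<in> C" "x \<in> S" using in_components_nonempty in_components_subset by blast
    thus "C \<in> \<E>" using main[OF C] S by blast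
  next
    fix E assume E: "E \<in> \<E>"
    then obtain x where x: "x \<in> E" "x \<in> S" using conn S by blast
    then obtain C where C: "C \<in> components S" "x \<in> C" using Union_components by (metis UnionE)
    thus "E \<in> components S" using main[OF C(1) E C(2) x(1)] by simp
  qed
qed

lemma continuous_on_boundary_curve: "continuous_on A boundary_curve"
  unfolding boundary_curve_def by (intro continuous_intros) auto

lemma edge_parameter_squares:
  fixes r :: real
  shows "r \<in> {1<..<sqrt 3} \<Longrightarrow> 1 < r^2 \<and> r^2 < 3 \<and> 0 < r"
    "r \<in> {- sqrt 3<..< - 1} \<Longrightarrow> 1 < r^2 \<and> r^2 < 3 \<and> r < 0"
    "r \<in> {- 1<..<1} \<Longrightarrow> r^2 < 1"
proof -
  have *: "1 < x^2 \<and> x^2 < 3" if "1 < x" "x < sqrt 3" for x :: real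
    using that power_strict_mono[of x "sqrt 3" 2] one_less_power[of x 2] by simp
  show "r \<in> {1<..<sqrt 3} \<Longrightarrow> 1 < r^2 \<and> r^2 < 3 \<and> 0 < r" using *[of r] by auto
  show "r \<in> {- sqrt 3<..< - 1} \<Longrightarrow> 1 < r^2 \<and> r^2 < 3 \<and> r < 0" using *[of "- r"] by auto
  show "r \<in> {- 1<..<1} \<Longrightarrow> r^2 < 1" by (simp add: abs_square_less_1 abs_less_iff)
qed

lemma frontier_eq_curve: "frontier SK_region = boundary_curve ` {- sqrt 3..sqrt 3}"
  unfolding frontier_SK_region image_boundary_curve ..

abbreviation "right_lower_edge \<equiv> boundary_curve ` {1<..<sqrt 3}"
abbreviation "left_lower_edge \<equiv> boundary_curve ` {- sqrt 3<..< - 1}"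
abbreviation "upper_edge \<equiv> boundary_curve ` {- 1<..<1}"

text \<open>The open conditions that tell the edges apart: $9k-17-3s^2=-t^3$ is negative on the
  lower edges and positive on the upper one, and the sign of $s$ distinguishes the lower
  edges.\<close>

lemma edges_separated:
  "p \<in> right_lower_edge \<Longrightarrow> 9 * snd p - 17 - 3 * (fst p)^2 < 0 \<and> 0 < fst p"
  "p \<in> left_lower_edge \<Longrightarrow> 9 * snd p - 17 - 3 * (fst p)^2 < 0 \<and> fst p < 0"
  "p \<in> upper_edge \<Longrightarrow> 0 < 9 * snd p - 17 - 3 * (fst p)^2"
proof -
  have g: "9 * snd (boundary_curve r) - 17 - 3 * (fst (boundary_curve r))^2 = - ((r^2 - 1) ^ 3)" for r
    using boundary_curve_Q4_gradient(1)[of r _ _ "r^2 - 1"] by (metis prod.collapse)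
  have f: "fst (boundary_curve r) = r * (3 - r^2) / sqrt 3" for r by (simp add: boundary_curve_def)
  show "9 * snd p - 17 - 3 * (fst p)^2 < 0 \<and> 0 < fst p" if p: "p \<in> right_lower_edge"
  proof -
    obtain r where r: "r \<in> {1<..<sqrt 3}" "p = boundary_curve r" using p by blast
    note b = edge_parameter_squares(1)[OF r(1)]
    have "0 < (r^2 - 1) ^ 3" "0 < r * (3 - r^2)" using b by (intro zero_less_power mult_pos_pos; simp)+
    thus ?thesis using g[of r] f[of r] by (simp add: r(2))
  qed
  show "9 * snd p - 17 - 3 * (fst p)^2 < 0 \<and> fst p < 0" if p: "p \<in> left_lower_edge"
  proof -
    obtain r where r: "r \<in> {- sqrt 3<..< - 1}" "p = boundary_curve r" using p by blast
    note b = edge_parameter_squares(2)[OF r(1)]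
    have "0 < (r^2 - 1) ^ 3" "r * (3 - r^2) < 0" using b by (intro zero_less_power mult_neg_pos; simp)+
    thus ?thesis using g[of r] f[of r] by (simp add: r(2) divide_neg_pos)
  qed
  show "0 < 9 * snd p - 17 - 3 * (fst p)^2" if p: "p \<in> upper_edge"
  proof -
    obtain r where r: "r \<in> {- 1<..<1}" "p = boundary_curve r" using p by blast
    have "(r^2 - 1) ^ 3 < 0" using edge_parameter_squares(3)[OF r(1)] by (simp add: power_less_zero_eq)
    thus ?thesis using g[of r] by (simp add: r(2))
  qed
qed

lemma boundary_minus_singular:
  "frontier SK_region - Q4_singular = left_lower_edge \<union> upper_edge \<union> right_lower_edge"
proof -
  have "frontier SK_region - Q4_singular = boundary_curve ` {r \<in> {- sqrt 3..sqrt 3}. r^2 \<noteq> 1 \<and> r^2 \<noteq> 3}"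
    unfolding frontier_eq_curve using boundary_curve_singular_iff by blast
  also have "{r \<in> {- sqrt 3..sqrt 3}. r^2 \<noteq> 1 \<and> r^2 \<noteq> 3} = {- sqrt 3<..< - 1} \<union> {- 1<..<1} \<union> {1<..<sqrt 3}"
  proof -
    have "{r \<in> {- w..w}. \<not> (r = 1 \<or> r = - 1) \<and> \<not> (r = w \<or> r = - w)} = {- w<..< - 1} \<union> {- 1<..<1} \<union> {1<..<w}"
      if "1 < w" for w :: real
      using that by auto
    from this[of "sqrt 3"] show ?thesis unfolding square_eq_3 power2_eq_1_iff by simp
  qed
  finally show ?thesis by (simp only: image_Un)
qed

lemma edges_boundary: "edges (frontier SK_region) = {left_lower_edge, upper_edge, right_lower_edge}"
  unfolding edges_def boundary_minus_singular
proof (rule components_eq_if_open_partition)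
  let ?S = "left_lower_edge \<union> upper_edge \<union> right_lower_edge"
  show "\<Union>{left_lower_edge, upper_edge, right_lower_edge} = ?S" by blast
  have s3: "1 < sqrt 3" by simp
  show "connected E \<and> E \<noteq> {}" if "E \<in> {left_lower_edge, upper_edge, right_lower_edge}" for E
    using that s3 by (auto intro!: connected_continuous_image continuous_on_boundary_curve simp: dense)
  have op: "open {p :: real \<times> real. 9 * snd p - 17 - 3 * (fst p)^2 < 0 \<and> 0 < fst p}"
    "open {p :: real \<times> real. 9 * snd p - 17 - 3 * (fst p)^2 < 0 \<and> fst p < 0}"
    "open {p :: real \<times> real. 0 < 9 * snd p - 17 - 3 * (fst p)^2}" 
    by (intro open_Collect_conj open_Collect_less continuous_intros)+
  show "\<exists>U. open U \<and> ?S \<inter> U = E" if E: "E \<in> {left_lower_edge, upper_edge, right_lower_edge}" for E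
  proof -
    have "?S \<inter> {p. 9 * snd p - 17 - 3 * (fst p)^2 < 0 \<and> 0 < fst p} = right_lower_edge"
      "?S \<inter> {p. 9 * snd p - 17 - 3 * (fst p)^2 < 0 \<and> fst p < 0} = left_lower_edge"
      "?S \<inter> {p. 0 < 9 * snd p - 17 - 3 * (fst p)^2} = upper_edge"
      using edges_separated by (blast dest: order.asym)+
    thus ?thesis using E op by blast
  qed
  show "pairwise disjnt {left_lower_edge, upper_edge, right_lower_edge}"
  proof -
    have "left_lower_edge \<inter> upper_edge = {}" "left_lower_edge \<inter> right_lower_edge = {}"
      "upper_edge \<inter> right_lower_edge = {}"
      using edges_separated by (blast dest: order.asym)+
    thus ?thesis by (simp add: pairwise_insert disjnt_def Int_commute) blast
  qed
qed

lemma closure_edge: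
  assumes "a < b" "boundary_curve a \<notin> boundary_curve ` {a<..<b}" "boundary_curve b \<notin> boundary_curve ` {a<..<b}"
  shows "closure (boundary_curve ` {a<..<b}) - boundary_curve ` {a<..<b} = {boundary_curve a, boundary_curve b}"
proof -
  have "closure (boundary_curve ` {a<..<b}) = boundary_curve ` {a..b}"
  proof (rule closure_unique)
    show "boundary_curve ` {a<..<b} \<subseteq> boundary_curve ` {a..b}" by (intro image_mono) auto
    show "closed (boundary_curve ` {a..b})"
      by (intro compact_imp_closed compact_continuous_image continuous_on_boundary_curve) auto
    fix T assume T: "boundary_curve ` {a<..<b} \<subseteq> T" "closed T"
    show "boundary_curve ` {a..b} \<subseteq> T"
      using image_closure_subset[OF continuous_on_boundary_curve T(2,1)] assms(1) by simp
  qed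
  also have "{a..b} = insert a (insert b {a<..<b})" using assms(1) by auto
  finally have "closure (boundary_curve ` {a<..<b}) =
      insert (boundary_curve a) (insert (boundary_curve b) (boundary_curve ` {a<..<b}))"
    by (simp only: image_insert)
  moreover have "insert x (insert y E) - E = {x, y}" if "x \<notin> E" "y \<notin> E" for x y :: "real \<times> real" and E
    using that by blast
  ultimately show ?thesis using assms(2,3) by simp
qed

text \<open>Each open arc has its two vertices as the only further limit points, and those of the
  upper edge are the two cusps.\<close>

lemma lower_edges_boundary: "lower_edges (frontier SK_region) = {left_lower_edge, right_lower_edge}"
proof -
  have s3: "1 < sqrt 3" by simp
  have sing: "boundary_curve r \<notin> left_lower_edge \<union> upper_edge \<union> right_lower_edge" if "r^2 = 1 \<or> r^2 = 3" for r
    unfolding boundary_minus_singular[symmetric] using boundary_curve_singular_iff that by auto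
  have cl: "closure left_lower_edge - left_lower_edge = {boundary_curve (- sqrt 3), boundary_curve (- 1)}"
    "closure right_lower_edge - right_lower_edge = {boundary_curve 1, boundary_curve (sqrt 3)}"
    "closure upper_edge - upper_edge = {boundary_curve (- 1), boundary_curve 1}"
    by (rule closure_edge; use s3 sing[of 1] sing[of "-1"] sing[of "sqrt 3"] sing[of "- sqrt 3"] in simp)+
  define P where "P E \<longleftrightarrow> (\<exists>c \<in> {(2 / sqrt 3, 7/3), (- 2 / sqrt 3, 7/3)}. closure E - E = {(0, 1), c})"
    for E :: "(real \<times> real) set"
  note cl' = cl[unfolded boundary_curve_special]
  have "P left_lower_edge" unfolding P_def cl'(1) by (rule bexI[of _ "(- 2 / sqrt 3, 7/3)"]) simp_all
  moreover have "P right_lower_edge" unfolding P_def cl'(2)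
    by (rule bexI[of _ "(2 / sqrt 3, 7/3)"]) (simp_all add: insert_commute)
  moreover have "\<not> P upper_edge"
  proof
    assume "P upper_edge"
    then obtain c :: "real \<times> real" where "{(- 2 / sqrt 3, 7/3), (2 / sqrt 3, 7/3)} = {(0, 1), c}"
      unfolding P_def cl'(3) by blast
    hence "(0, 1) \<in> {(- 2 / sqrt 3, 7/3), (2 / sqrt 3, 7/3 :: real)}" by blast
    thus False by simp
  qed
  moreover have "{E \<in> {A, B, C}. P E} = {A, C}" if "P A" "\<not> P B" "P C" for A B C
    using that by blast
  ultimately have "{E \<in> {left_lower_edge, upper_edge, right_lower_edge}. P E} = {left_lower_edge, right_lower_edge}"
    by simp
  thus ?thesis unfolding lower_edges_def edges_boundary P_def .
qed

lemma critical_points_boundary_iff: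
  assumes "\<bar>r\<bar> \<le> sqrt 3"
  shows "boundary_curve r \<in> critical_points (frontier SK_region) \<longleftrightarrow>
    fst (boundary_curve r) = 0 \<or> r^2 = 1 \<or> r^2 = 1 + t_star"
proof -
  obtain s k where sk: "boundary_curve r = (s, k)" by fastforce
  have "(s, k) \<in> frontier SK_region"
    unfolding frontier_eq_curve sk[symmetric] using assms by (intro imageI) (simp add: abs_le_iff)
  hence "(s, k) \<in> critical_points (frontier SK_region) \<longleftrightarrow>
    linearly_dependent2 (jb_gradient s k) (Q4_gradient s k)"
    unfolding critical_points_def
    using GDERIV_jb_fun[of s k] GDERIV_Q4[of s k] GDERIV_unique by blast
  thus ?thesis using gradients_dependent_iff[OF sk assms] by (simp add: sk)
qed

lemma fst_boundary_curve_eq_0_iff: "fst (boundary_curve r) = 0 \<longleftrightarrow> r = 0 \<or> r^2 = 3"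
  by (auto simp: boundary_curve_def)

lemma critical_points_eq:
  "critical_points (frontier SK_region) =
    {(0, 2), (0, 1), (2 / sqrt 3, 7/3), (- 2 / sqrt 3, 7/3)} \<union> boundary_curve ` {r. r^2 = 1 + t_star}"
  (is "?C = ?R")
proof -
  have abs3: "\<bar>r\<bar> \<le> sqrt 3 \<longleftrightarrow> r^2 \<le> 3" for r
    using abs_le_square_iff[of r "sqrt 3"] by simp
  have "?C \<subseteq> frontier SK_region" by (auto simp: critical_points_def)
  hence "?C = boundary_curve ` {r. r^2 \<le> 3 \<and> boundary_curve r \<in> ?C}"
    unfolding frontier_eq_curve abs3[symmetric] abs_le_iff by (force simp: image_iff)
  also have "{r. r^2 \<le> 3 \<and> boundary_curve r \<in> ?C} = {r. r = 0 \<or> r^2 = 3 \<or> r^2 = 1 \<or> r^2 = 1 + t_star}"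
    using critical_points_boundary_iff[unfolded abs3 fst_boundary_curve_eq_0_iff] t_star by auto
  also have "\<dots> = {0, sqrt 3, - sqrt 3, 1, - 1} \<union> {r. r^2 = 1 + t_star}"
    by (auto simp: square_eq_3 power2_eq_1_iff)
  also have "boundary_curve ` \<dots> = ?R"
    by (simp only: image_Un image_insert image_empty boundary_curve_special) auto
  finally show ?thesis .
qed

lemma x_star_bounds: "\<bar>x_star - 0.47309\<bar> \<le> 0.000005"
proof -
  have "sqrt 145 > 12.041594" by (rule real_less_rsqrt) (simp add: power2_eq_square)
  moreover have "sqrt 145 < 12.041595" by (rule real_less_lsqrt) (simp_all add: power2_eq_square)
  ultimately show ?thesis by (simp add: x_star_def abs_le_iff field_simps)
qed

lemma tangency_value:
  assumes "r^2 = 1 + t_star"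
  shows "jb_fun (boundary_curve r) = x_star" "snd (boundary_curve r) = k_star"
proof -
  obtain s k where sk: "boundary_curve r = (s, k)" by fastforce
  have t: "t_star = r^2 - 1" using assms by simp
  have "s^2 = (t_star + 1) * (2 - t_star)^2 / 3" "k = (7 - t_star\<^sup>2) / 3"
    using boundary_curve_Q4_gradient(3,4)[OF sk t] .
  thus "jb_fun (boundary_curve r) = x_star" "snd (boundary_curve r) = k_star"
    using jb_fun_tangency[of s k] by (simp_all add: sk)
qed

lemma jb_fun_vertices:
  "jb_fun (0, 2) = 1/6" "jb_fun (0, 1) = 2/3"
  "jb_fun (2 / sqrt 3, 7/3) = 26/27" "jb_fun (- 2 / sqrt 3, 7/3) = 26/27"
  by (simp_all add: jb_fun_def power_divide) 

lemma critical_values: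
  defines "C \<equiv> critical_points (frontier SK_region)"
  shows "jb_fun ` C = {1/6, x_star, 2/3, 26/27}"
    and "{p \<in> C. jb_fun p = 1/6} = {(0, 2)}"
    and "{p \<in> C. jb_fun p = x_star} = boundary_curve ` {r. r^2 = 1 + t_star}"
    and "{p \<in> C. jb_fun p = 2/3} = {(0, 1)}"
    and "{p \<in> C. jb_fun p = 26/27} = {(2 / sqrt 3, 7/3), (- 2 / sqrt 3, 7/3)}"
proof -
  define T where "T = boundary_curve ` {r. r^2 = 1 + t_star}"
  have C: "C = {(0, 2), (0, 1), (2 / sqrt 3, 7/3), (- 2 / sqrt 3, 7/3)} \<union> T"
    unfolding C_def T_def by (rule critical_points_eq)
  have T: "jb_fun p = x_star" if "p \<in> T" for p
    using that tangency_value(1) unfolding T_def by auto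
  have "sqrt (1 + t_star) \<in> {r. r^2 = 1 + t_star}" using t_star by simp
  hence ne: "T \<noteq> {}" unfolding T_def by blast
  have x: "x_star \<noteq> 1/6" "x_star \<noteq> 2/3" "x_star \<noteq> 26/27"
    using x_star_bounds by (auto simp: abs_le_iff)
  note v = jb_fun_vertices
  show "jb_fun ` C = {1/6, x_star, 2/3, 26/27}"
  proof -
    have "jb_fun ` T = (\<lambda>_. x_star) ` T" using T by (rule image_cong[OF refl])
    hence "jb_fun ` T = {x_star}" using ne by (simp add: image_constant_conv)
    thus ?thesis unfolding C image_Un image_insert image_empty v by auto
  qed
  have split: "{p \<in> C. jb_fun p = z} = {p \<in> {(0, 2), (0, 1), (2 / sqrt 3, 7/3), (- 2 / sqrt 3, 7/3)}. jb_fun p = z}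
      \<union> (if z = x_star then T else {})" for z
    unfolding C using T by auto
  have ins: "{p \<in> insert x A. jb_fun p = z} = (if jb_fun x = z then insert x {p \<in> A. jb_fun p = z} else {p \<in> A. jb_fun p = z})" for x z A
    by auto
  show "{p \<in> C. jb_fun p = 1/6} = {(0, 2)}" "{p \<in> C. jb_fun p = x_star} = T"
    "{p \<in> C. jb_fun p = 2/3} = {(0, 1)}"
    "{p \<in> C. jb_fun p = 26/27} = {(2 / sqrt 3, 7/3), (- 2 / sqrt 3, 7/3)}"
    unfolding split ins v using x by simp_all
qed

lemma lower_edges_k_star:
  "{p \<in> \<Union>(lower_edges (frontier SK_region)). snd p = k_star} = boundary_curve ` {r. r^2 = 1 + t_star}"
proof -
  have "snd (boundary_curve r) = k_star \<longleftrightarrow> r^2 = 1 + t_star" if "1 < r^2" for r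
  proof
    assume *: "snd (boundary_curve r) = k_star"
    have "snd (boundary_curve (sqrt (1 + t_star))) = k_star"
      using t_star by (intro tangency_value) simp
    hence "(r^2 - 1)^2 = t_star\<^sup>2" using * t_star by (simp add: boundary_curve_def)
    thus "r^2 = 1 + t_star" using that t_star(1) by (auto simp: power2_eq_iff)
  qed (rule tangency_value)
  moreover have "1 < r^2" if "r \<in> {- sqrt 3<..< - 1} \<union> {1<..<sqrt 3}" for r
    using edge_parameter_squares[of r] that by blast
  moreover have "r \<in> {- sqrt 3<..< - 1} \<union> {1<..<sqrt 3}" if "r^2 = 1 + t_star" for r
  proof -
    have "1\<^sup>2 < \<bar>r\<bar>\<^sup>2" "\<bar>r\<bar>\<^sup>2 < (sqrt 3)^2" using that t_star by simp_all
    hence "1 < \<bar>r\<bar>" "\<bar>r\<bar> < sqrt 3" using power2_less_imp_less[of _ "\<bar>r\<bar>"] power2_less_imp_less[of "\<bar>r\<bar>" "sqrt 3"] by auto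
    thus ?thesis by (auto simp: abs_if split: if_splits)
  qed
  ultimately have "{r \<in> {- sqrt 3<..< - 1} \<union> {1<..<sqrt 3}. snd (boundary_curve r) = k_star} = {r. r^2 = 1 + t_star}"
    by blast
  moreover have "\<Union>(lower_edges (frontier SK_region)) = boundary_curve ` ({- sqrt 3<..< - 1} \<union> {1<..<sqrt 3})"
    unfolding lower_edges_boundary by (simp add: image_Un)
  moreover have "{p \<in> f ` A. snd p = z} = f ` {r \<in> A. snd (f r) = z}"
    for f :: "real \<Rightarrow> real \<times> real" and A z by blast
  ultimately show ?thesis by simp
qed

lemma tangency_on_lower_edges:
  assumes "E \<in> lower_edges (frontier SK_region)"
  shows "\<exists>p \<in> E. snd p = k_star \<and> tangency_at p"
proof -
  define r where "r = sqrt (1 + t_star)"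
  have r2: "r^2 = 1 + t_star" using t_star by (simp add: r_def)
  have "sqrt 1 < r" "r < sqrt 3" unfolding r_def using t_star by (intro real_sqrt_less_mono; simp)+
  hence r: "r \<in> {1<..<sqrt 3}" "- r \<in> {- sqrt 3<..< - 1}" by auto
  have tang: "snd (boundary_curve q) = k_star \<and> tangency_at (boundary_curve q)" if q: "q^2 = 1 + t_star" "\<bar>q\<bar> \<le> sqrt 3" for q
  proof -
    obtain s k where sk: "boundary_curve q = (s, k)" by fastforce
    have t: "t_star = q^2 - 1" using q by simp
    have "q \<in> {- sqrt 3..sqrt 3}" using q(2) by (simp add: abs_le_iff)
    hence "(s, k) \<in> boundary_curve ` {- sqrt 3..sqrt 3}" using sk by (metis imageI)
    hence Q: "Q4 s k = 0" "1 \<le> k" unfolding image_boundary_curve by auto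
    have "k \<noteq> 3" using SK_region_bounds(1)[of s k] Q by auto
    moreover have "18 * s^2 - 9 * (3 * k - 5) * (k - 1) \<noteq> 0"
      unfolding boundary_curve_Q4_gradient(2)[OF sk t] using t_star by simp
    ultimately have "tangency_at (s, k)"
      unfolding tangency_at_def using Q(1) GDERIV_jb_fun[of s k] GDERIV_Q4[of s k] gradients_dependent_iff[OF sk q(2)] q(1)
      by (intro conjI exI[of _ "jb_gradient s k"]
        exI[of _ "Q4_gradient s k"])
        (auto simp: zero_prod_def)
    thus ?thesis using tangency_value(2)[OF q(1)] sk by simp
  qed
  have "r \<le> sqrt 3" "0 \<le> r" using r by auto
  hence "tangency_at (boundary_curve r)" "tangency_at (boundary_curve (- r))"
    "snd (boundary_curve r) = k_star" "snd (boundary_curve (- r)) = k_star"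
    using tang[of r] tang[of "- r"] r2 by auto
  thus ?thesis using assms r unfolding lower_edges_boundary by auto
qed


section \<open>Integrals of inverse square roots of cubics in Legendre form\<close>

lemma nn_integral_substitution_indicator:
  fixes f g g' :: "real \<Rightarrow> real"
  assumes "f \<in> borel_measurable borel"
    and "\<And>x. x \<in> {a..b} \<Longrightarrow> (g has_real_derivative g' x) (at x)"
    and "continuous_on {a..b} g'" and "\<And>x. x \<in> {a..b} \<Longrightarrow> 0 \<le> g' x" and "a \<le> b"
  shows "(\<integral>\<^sup>+x. ennreal (f x) * indicator {g a..g b} x \<partial>lborel)
      = (\<integral>\<^sup>+x. ennreal (f (g x) * g' x) * indicator {a..b} x \<partial>lborel)"
proof -
  have ind: "ennreal z * indicator A x = ennreal (z * indicator A x)" for z A and x :: real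
    by (simp split: split_indicator)
  have "set_borel_measurable borel {g a..g b} f"
    using assms(1) by (simp add: set_borel_measurable_def)
  from nn_integral_substitution[OF this assms(2-5)] show ?thesis
    unfolding ind by simp
qed

context
  fixes m :: real
  assumes m: "0 < m" "m < 1"
begin

lemma elliptic_denominator_pos: "0 < 1 - m * (sin \<theta>)^2"
proof -
  have "(sin \<theta>)^2 \<le> 1" using sin_squared_eq[of \<theta>] zero_le_power2[of "cos \<theta>"] by linarith
  hence "m * (sin \<theta>)^2 \<le> m * 1" using m by (intro mult_left_mono) auto
  thus ?thesis using m by linarith
qed

lemma continuous_on_elliptic_integrand: "continuous_on A (\<lambda>\<theta>. (1 - m * (sin \<theta>)^2) powr (- 1/2))"
  using elliptic_denominator_pos by (intro continuous_intros) (auto simp: less_le)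

text \<open>The Legendre integrand is continuous as $m<1$, so differences of the interval
  integrals that define the elliptic integrals are nonnegative integrals over the interval in
  between.\<close>

lemma nn_integral_elliptic_integrand:
  assumes "0 \<le> \<phi>" "\<phi> \<le> pi/2" "0 \<le> C"
  shows "(\<integral>\<^sup>+\<theta>. ennreal (C * (1 - m * (sin \<theta>)^2) powr (- 1/2)) * indicator {\<phi>..pi/2} \<theta> \<partial>lborel)
      = ennreal (C * (ellK m - ellF \<phi> m))" (is "?I = _")
    and "ellF \<phi> m \<le> ellK m"
proof -
  define h where "h = (\<lambda>\<theta>. (1 - m * (sin \<theta>)^2) powr (- 1/2))"
  have cont: "continuous_on A h" for A unfolding h_def by (rule continuous_on_elliptic_integrand)
  have int: "interval_lebesgue_integrable lborel (ereal a) (ereal b) h" if "a \<le> b" for a b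
    using cont that by (intro interval_integrable_continuous_on) auto
  have "(LBINT \<theta>=ereal 0..ereal \<phi>. h \<theta>) + (LBINT \<theta>=ereal \<phi>..ereal (pi/2). h \<theta>)
      = (LBINT \<theta>=ereal 0..ereal (pi/2). h \<theta>)"
    using assms int[of 0 "pi/2"] by (intro interval_integral_sum) (simp add: min_def max_def zero_ereal_def)
  hence "ellK m - ellF \<phi> m = (LBINT \<theta>=ereal \<phi>..ereal (pi/2). h \<theta>)"
    by (simp add: ellK_def ellF_def h_def zero_ereal_def)
  also have "\<dots> = (LINT \<theta>:{\<phi>..pi/2}|lborel. h \<theta>)"
    using assms by (intro interval_integral_Icc) auto
  finally have diff: "ellK m - ellF \<phi> m = (LINT \<theta>:{\<phi>..pi/2}|lborel. h \<theta>)" .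
  have si: "set_integrable lborel {\<phi>..pi/2} h"
    by (intro borel_integrable_atLeastAtMost' cont)
  have h0: "0 \<le> h \<theta>" for \<theta> by (simp add: h_def)
  have "?I = (\<integral>\<^sup>+\<theta>. ennreal (indicator {\<phi>..pi/2} \<theta> *\<^sub>R (C * h \<theta>)) \<partial>lborel)"
    by (intro nn_integral_cong) (auto simp: h_def split: split_indicator)
  also have "\<dots> = ennreal (LINT \<theta>|lborel. indicator {\<phi>..pi/2} \<theta> *\<^sub>R (C * h \<theta>))"
  proof (rule nn_integral_eq_integral)
    show "integrable lborel (\<lambda>\<theta>. indicator {\<phi>..pi/2} \<theta> *\<^sub>R (C * h \<theta>))"
      using set_integrable_mult_right[of C, OF si] by (simp add: set_integrable_def)
  qed (use assms h0 in auto)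
  also have "(LINT \<theta>|lborel. indicator {\<phi>..pi/2} \<theta> *\<^sub>R (C * h \<theta>)) = C * (ellK m - ellF \<phi> m)"
    unfolding diff set_lebesgue_integral_def by (simp add: mult.left_commute)
  finally show "?I = ennreal (C * (ellK m - ellF \<phi> m))" .
  have "0 \<le> (LINT \<theta>:{\<phi>..pi/2}|lborel. h \<theta>)"
    unfolding set_lebesgue_integral_def by (intro integral_nonneg_AE) (auto simp: h0)
  thus "ellF \<phi> m \<le> ellK m" using diff by simp
qed

end

text \<open>The substitution $k=(b-a\,m\sin^2\theta)/(1-m\sin^2\theta)$ increases from $b$ at
  $\theta=0$ to $c$ at $\theta=\pi/2$. As $k-a$, $k-b$ and $c-k$ are constant multiples of $1$,
  $\sin^2\theta$ and $\cos^2\theta$ over $1-m\sin^2\theta$, the sine and cosine under the root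
  cancel against those of the derivative.\<close>

lemma elliptic_integral_cubic:
  fixes a b c y \<phi> m :: real
  assumes abc: "a < b" "b < c" and y: "b \<le> y" "y < c" and \<phi>: "\<phi> \<in> {0..pi/2}"
    and sin\<phi>: "(sin \<phi>)^2 = (c - a) * (y - b) / ((c - b) * (y - a))" and m: "m = (c - b) / (c - a)"
  shows "(\<integral>\<^sup>+k. ennreal (1 / sqrt ((k - a) * (k - b) * (c - k))) * indicator {y..c} k \<partial>lborel)
      = ennreal (2 / sqrt (c - a) * (ellK m - ellF \<phi> m))" and "ellF \<phi> m \<le> ellK m"
proof -
  have m01: "0 < m" "m < 1" using abc by (auto simp: m field_simps)
  have ca: "c - a > 0" using abc by simp
  define v where "v = (\<lambda>\<theta>. m * (sin \<theta>)^2)"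
  have v1: "1 - v \<theta> > 0" for \<theta> using elliptic_denominator_pos[OF m01] by (simp add: v_def)
  define g where "g = (\<lambda>\<theta>. (b - a * v \<theta>) / (1 - v \<theta>))"
  define g' where "g' = (\<lambda>\<theta>. (b - a) * (2 * m * sin \<theta> * cos \<theta>) / (1 - v \<theta>)^2)"
  have v\<phi>: "v \<phi> = (y - b) / (y - a)"
  proof -
    have "c - a \<noteq> 0" "c - b \<noteq> 0" using abc by auto
    thus ?thesis by (simp add: v_def m sin\<phi>)
  qed
  have "1 - v \<phi> = (b - a) / (y - a)" "b - a * v \<phi> = y * ((b - a) / (y - a))"
    using abc y by (simp_all add: v\<phi> field_simps)
  hence g\<phi>: "g \<phi> = y" using abc y by (simp add: g_def)
  have vm: "v (pi/2) = m" by (simp add: v_def)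
  have "1 - m = (b - a) / (c - a)" "b - a * m = c * ((b - a) / (c - a))"
    using abc by (simp_all add: m field_simps)
  hence gpi: "g (pi/2) = c" using abc by (simp add: g_def vm)
  have deriv: "(g has_real_derivative g' \<theta>) (at \<theta>)" for \<theta>
  proof -
    have "1 - v \<theta> \<noteq> 0" using v1[of \<theta>] by simp
    have dv: "(v has_real_derivative 2 * m * sin \<theta> * cos \<theta>) (at \<theta>)"
      unfolding v_def by (auto intro!: derivative_eq_intros)
    have "(g has_real_derivative
        ((0 - a * (2 * m * sin \<theta> * cos \<theta>)) * (1 - v \<theta>) - (b - a * v \<theta>) * (0 - 2 * m * sin \<theta> * cos \<theta>))
          / ((1 - v \<theta>) * (1 - v \<theta>))) (at \<theta>)"
      unfolding g_def using \<open>1 - v \<theta> \<noteq> 0\<close>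
      by (intro DERIV_divide DERIV_diff DERIV_const DERIV_cmult dv) 
    moreover have "(0 - a * (2 * m * sin \<theta> * cos \<theta>)) * (1 - v \<theta>) - (b - a * v \<theta>) * (0 - 2 * m * sin \<theta> * cos \<theta>)
        = (b - a) * (2 * m * sin \<theta> * cos \<theta>)" by (simp add: algebra_simps)
    ultimately show ?thesis by (simp add: g'_def power2_eq_square)
  qed
  have "continuous_on {\<phi>..pi/2} g'"
    unfolding g'_def v_def using v1 by (intro continuous_intros) (auto simp: v_def less_le)
  moreover have "g' \<theta> \<ge> 0" if "\<theta> \<in> {\<phi>..pi/2}" for \<theta>
    using that \<phi> abc m01 unfolding g'_def
    by (intro divide_nonneg_nonneg mult_nonneg_nonneg sin_ge_zero cos_ge_zero) auto
  ultimately have "(\<integral>\<^sup>+k. ennreal (1 / sqrt ((k - a) * (k - b) * (c - k))) * indicator {g \<phi>..g (pi/2)} k \<partial>lborel) =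
      (\<integral>\<^sup>+\<theta>. ennreal (1 / sqrt ((g \<theta> - a) * (g \<theta> - b) * (c - g \<theta>)) * g' \<theta>) * indicator {\<phi>..pi/2} \<theta> \<partial>lborel)"
    using \<phi> deriv by (intro nn_integral_substitution_indicator) auto
  also have "\<dots> = (\<integral>\<^sup>+\<theta>. ennreal (2 / sqrt (c - a) * (1 - m * (sin \<theta>)^2) powr (- 1/2)) * indicator {\<phi>..pi/2} \<theta> \<partial>lborel)"
  proof (rule nn_integral_cong_AE)
    \<comment> \<open>at the ends of the interval the cubic may vanish, and its inverse root is then 0 by convention\<close>
    have "AE \<theta> in lborel. \<theta> \<noteq> \<phi> \<and> \<theta> \<noteq> pi/2"
      using AE_lborel_singleton[of \<phi>] AE_lborel_singleton[of "pi/2"] by eventually_elim auto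
    thus "AE \<theta> in lborel. ennreal (1 / sqrt ((g \<theta> - a) * (g \<theta> - b) * (c - g \<theta>)) * g' \<theta>) * indicator {\<phi>..pi/2} \<theta>
        = ennreal (2 / sqrt (c - a) * (1 - m * (sin \<theta>)^2) powr (- 1/2)) * indicator {\<phi>..pi/2} \<theta>"
    proof eventually_elim
      case (elim \<theta>)
      show ?case
      proof (cases "\<theta> \<in> {\<phi>..pi/2}")
        case True
        hence \<theta>: "0 < \<theta>" "\<theta> < pi/2" using elim \<phi> by auto
        let ?P = "(g \<theta> - a) * (g \<theta> - b) * (c - g \<theta>)"
        define sn cs D where "sn = sin \<theta>" and "cs = cos \<theta>" and "D = 1 - v \<theta>"
        have pos: "sn > 0" "cs > 0" "D > 0"
          using \<theta> v1 by (auto simp: sn_def cs_def D_def intro!: sin_gt_zero cos_gt_zero)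
        have vsn: "v \<theta> = (c - b) / (c - a) * sn\<^sup>2" by (simp add: v_def m sn_def)
        have cs2: "cs\<^sup>2 = 1 - sn\<^sup>2" by (simp add: sn_def cs_def cos_squared_eq)
        have gab: "g \<theta> - a = (b - a) / D" "g \<theta> - b = (b - a) * v \<theta> / D"
          using pos by (simp_all add: g_def D_def field_simps)
        have "c - g \<theta> = ((c - b) - (c - a) * v \<theta>) / D"
          using pos by (simp add: g_def D_def field_simps)
        also have "(c - a) * v \<theta> = (c - b) * sn\<^sup>2" using ca by (simp add: vsn)
        also have "(c - b) - (c - b) * sn\<^sup>2 = (c - b) * cs\<^sup>2" by (simp add: cs2 algebra_simps)
        finally have gc: "c - g \<theta> = (c - b) * cs\<^sup>2 / D" .
        have "?P = ((b - a) * (c - b) * sn * cs / D)^2 / ((c - a) * D)"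
          unfolding gab gc vsn using ca pos by (simp add: field_simps power2_eq_square)
        hence "sqrt ?P = ((b - a) * (c - b) * sn * cs / D) / sqrt ((c - a) * D)"
          using abc pos by (simp add: real_sqrt_divide real_sqrt_mult abs_mult)
        moreover have "g' \<theta> = (b - a) * (c - b) * sn * cs / D * (2 / ((c - a) * D))"
        proof -
          have "g' \<theta> = (b - a) * (2 * ((c - b) / (c - a)) * sn * cs) / D^2"
            by (simp add: g'_def m D_def sn_def cs_def)
          thus ?thesis using ca pos by (simp add: field_simps power2_eq_square)
        qed
        moreover have "(b - a) * (c - b) * sn * cs / D > 0"
          using abc pos by auto
        moreover have "1 / (w / x) * (w * z) = x * z" if "w > 0" for w x z :: real
          using that by simp
        ultimately have "1 / sqrt ?P * g' \<theta> = sqrt ((c - a) * D) * (2 / ((c - a) * D))"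
          by (simp only:)
        also have "\<dots> = 2 / sqrt ((c - a) * D)"
          using ca pos by (simp add: real_div_sqrt field_simps)
        also have "\<dots> = 2 / sqrt (c - a) * D powr (- 1/2)"
        proof -
          have "D powr (- 1/2) = D powr (- (1/2))" by simp
          also have "\<dots> = inverse (sqrt D)" using pos by (simp only: powr_minus powr_half_sqrt less_imp_le)
          finally show ?thesis by (simp only: real_sqrt_mult divide_inverse inverse_mult_distrib mult.assoc)
        qed
        finally show ?thesis by (simp add: D_def v_def)
      qed simp
    qed
  qed
  also have "\<dots> = ennreal (2 / sqrt (c - a) * (ellK m - ellF \<phi> m))"
    using \<phi> ca by (intro nn_integral_elliptic_integrand m01) auto
  finally show "(\<integral>\<^sup>+k. ennreal (1 / sqrt ((k - a) * (k - b) * (c - k))) * indicator {y..c} k \<partial>lborel)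
      = ennreal (2 / sqrt (c - a) * (ellK m - ellF \<phi> m))"
    by (simp add: g\<phi> gpi)
  show "ellF \<phi> m \<le> ellK m"
    using \<phi> by (intro nn_integral_elliptic_integrand(2)[OF m01, of \<phi> 1]) auto
qed


section \<open>The kurtosis as a function of the smallest root\<close>

text \<open>The value of $k$ for which $p$ is a root of
  $t^3-t^2+\frac{k-1}4t-\frac{s^2}{36}$.\<close>

definition kurt_branch :: "real \<Rightarrow> real \<Rightarrow> real" where
  "kurt_branch s p = 1 + 4 * p * (1 - p) + s^2 / (9 * p)"

text \<open>If $q,w$ are the other two roots of the cubic, the last two factors are
  $((p-q)(p-w))^2$ and $(q-w)^2$.\<close>

lemma Q4_kurt_branch:
  assumes "p \<noteq> 0"
  shows "Q4 s (kurt_branch s p) = 144 * (2 * p^2 - p + s^2 / (36 * p))^2 * ((1 - p)^2 - s^2 / (9 * p))"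
proof -
  define S where "S = s^2 / (36 * p)"
  have s2: "s^2 = 36 * p * S" and s9: "s^2 / (9 * p) = 4 * S" using assms by (simp_all add: S_def)
  have s4: "s ^ 4 = (s^2)^2" by simp
  show ?thesis
    unfolding kurt_branch_def s9 S_def[symmetric] Q4_def s4 unfolding s2 by algebra
qed

text \<open>The derivative is $-\frac4p(p-q)(p-w)$ in terms of the other roots; it has a constant
  sign as long as $p$ stays the smallest root.\<close>

lemma kurt_branch_deriv:
  assumes "p \<noteq> 0"
  shows "(kurt_branch s has_real_derivative - (4 / p * (2 * p^2 - p + s^2 / (36 * p)))) (at p)"
  unfolding kurt_branch_def using assms
  by (auto intro!: derivative_eq_intros simp: field_simps power2_eq_square)

text \<open>These two functions of the smallest root bound $s^2$ from above and from below. Both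
  increase on $[0,1/3]$ from $0$ to $4/3$.\<close>

lemma range_bounds_strict_mono:
  assumes "0 \<le> x" "x < y" "y \<le> (1/3 :: real)"
  shows "9 * x * (1 - x)^2 < 9 * y * (1 - y)^2" "36 * x^2 * (1 - 2 * x) < 36 * y^2 * (1 - 2 * y)"
proof -
  have "(1/3)^2 < (1 - x - y)^2" using assms by (intro power_strict_mono) auto
  moreover have "x * y \<le> 1/3 * (1/3)" using assms by (intro mult_mono) auto
  ultimately have "0 < (y - x) * ((1 - x - y)^2 - x * y)"
    using assms by (intro mult_pos_pos) (auto simp: power2_eq_square)
  moreover have "9 * y * (1 - y)^2 - 9 * x * (1 - x)^2 = 9 * ((y - x) * ((1 - x - y)^2 - x * y))" by algebra
  ultimately show "9 * x * (1 - x)^2 < 9 * y * (1 - y)^2" by linarith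
  have "x * x \<le> x * (1/3)" "y * y \<le> y * (1/3)" "x * y \<le> x * (1/3)" by (intro mult_left_mono; use assms in linarith)+
  moreover have "y * x < y * (1/3)" using assms by (intro mult_strict_left_mono) auto
  ultimately have "2 * (x * x + x * y + y * y) < x + y" by (simp add: mult.commute)
  hence "0 < (y - x) * ((x + y) - 2 * (x * x + x * y + y * y))"
    using assms by (intro mult_pos_pos) auto
  moreover have "36 * y^2 * (1 - 2 * y) - 36 * x^2 * (1 - 2 * x) = 36 * ((y - x) * ((x + y) - 2 * (x * x + x * y + y * y)))" by algebra
  ultimately show "36 * x^2 * (1 - 2 * x) < 36 * y^2 * (1 - 2 * y)" by linarith
qed

lemma quadratic_three_roots_zero:
  fixes \<alpha> \<beta> \<gamma> :: real
  assumes "\<alpha> * x^2 + \<beta> * x + \<gamma> = 0" "\<alpha> * y^2 + \<beta> * y + \<gamma> = 0" "\<alpha> * z^2 + \<beta> * z + \<gamma> = 0"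
    and "x < y" "y < z"
  shows "\<alpha> = 0" "\<beta> = 0" "\<gamma> = 0"
proof -
  have "(x - y) * (\<alpha> * (x + y) + \<beta>) = 0" "(y - z) * (\<alpha> * (y + z) + \<beta>) = 0"
    using assms(1-3) by algebra+
  hence *: "\<alpha> * (x + y) + \<beta> = 0" "\<alpha> * (y + z) + \<beta> = 0" using assms by auto
  hence "\<alpha> * (z - x) = 0" by algebra
  thus "\<alpha> = 0" using assms by auto
  thus "\<beta> = 0" using * by simp
  thus "\<gamma> = 0" using assms(1) \<open>\<alpha> = 0\<close> by simp
qed

text \<open>The last inequality says that the other two roots are real and distinct, the one
  before it that $p$ lies to one side of both of them; $p<1/3$ makes it the left side, as the
  roots add up to $1$.\<close>

definition root_range :: "real \<Rightarrow> real set" where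
  "root_range s = {p. 0 < p \<and> p < 1/3 \<and> 36 * p^2 * (1 - 2 * p) < s^2 \<and> s^2 < 9 * p * (1 - p)^2}"

text \<open>Both bounds are monotone in $p$, so each inequality cuts out a half-line. They are
  compatible since $9p(1-p)^2-36p^2(1-2p)=9p(1-3p)^2>0$.\<close>

lemma root_range_interval:
  assumes s: "0 < s^2" "s^2 < 4/3"
  obtains pA pB where "0 < pA" "pA < pB" "pB < 1/3" "9 * pA * (1 - pA)^2 = s^2" "36 * pB\<^sup>2 * (1 - 2 * pB) = s^2"
    "root_range s = {pA<..<pB}"
proof -
  define A where "A = (\<lambda>p::real. 9 * p * (1 - p)^2)"
  define B where "B = (\<lambda>p::real. 36 * p^2 * (1 - 2 * p))"
  have mono: "A x < A y" "B x < B y" if "0 \<le> x" "x < y" "y \<le> 1/3" for x y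
    using range_bounds_strict_mono[OF that] by (simp_all add: A_def B_def)
  have ends: "A 0 = 0" "B 0 = 0" "A (1/3) = 4/3" "B (1/3) = 4/3"
    by (simp_all add: A_def B_def power2_eq_square)
  have "\<exists>p\<ge>0. p \<le> 1/3 \<and> A p = s^2"
    by (rule IVT') (use s ends in \<open>auto simp: A_def intro!: continuous_intros\<close>)
  then obtain pA where pA: "0 \<le> pA" "pA \<le> 1/3" "A pA = s^2" by blast
  have "\<exists>p\<ge>0. p \<le> 1/3 \<and> B p = s^2"
    by (rule IVT') (use s ends in \<open>auto simp: B_def intro!: continuous_intros\<close>)
  then obtain pB where pB: "0 \<le> pB" "pB \<le> 1/3" "B pB = s^2" by blast
  have pA': "0 < pA" "pA < 1/3" and pB': "0 < pB" "pB < 1/3"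
  proof -
    have "pA \<noteq> 0" "pA \<noteq> 1/3" "pB \<noteq> 0" "pB \<noteq> 1/3"
      using pA(3) pB(3) ends s by (metis less_irrefl)+
    thus "0 < pA" "pA < 1/3" "0 < pB" "pB < 1/3" using pA pB by linarith+
  qed
  have "A pB - B pB = 9 * pB * (1 - 3 * pB)^2" unfolding A_def B_def by algebra
  also have "\<dots> > 0" using pB' by auto
  finally have "A pA < A pB" using pA pB by simp
  hence AB: "pA < pB" using mono(1)[of pB pA] pA' pB' by (cases pA pB rule: linorder_cases) auto
  have "root_range s = {pA<..<pB}"
  proof (intro equalityI subsetI)
    fix p assume "p \<in> root_range s"
    hence p: "0 < p" "p < 1/3" "B p < B pB" "A pA < A p" by (auto simp: root_range_def A_def B_def pA[unfolded A_def] pB[unfolded B_def])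
    have "pA < p" using p mono(1)[of p pA] pA' by (cases p pA rule: linorder_cases) auto
    moreover have "p < pB" using p mono(2)[of pB p] pB' by (cases p pB rule: linorder_cases) auto
    ultimately show "p \<in> {pA<..<pB}" by simp
  next
    fix p assume "p \<in> {pA<..<pB}"
    hence p: "pA < p" "p < pB" by auto
    hence "A pA < A p" "B p < B pB" using mono pA' pB' by auto
    thus "p \<in> root_range s" using p pA' pB' pA(3) pB(3) by (simp add: root_range_def A_def B_def)
  qed
  thus ?thesis using that[of pA pB] pA' pB' AB pA(3) pB(3) by (simp add: A_def B_def)
qed

lemma kurt_branch_strict_antimono:
  assumes s: "0 < s^2" "s^2 < 4/3"
    and p: "0 < pA" "pA < pB" "pB < 1/3" "root_range s = {pA<..<pB}"
  shows "kurt_branch s pB < kurt_branch s pA" "1 < kurt_branch s pB"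
proof -
  show "kurt_branch s pB < kurt_branch s pA"
  proof (rule DERIV_neg_imp_decreasing_open[OF p(2)])
    fix x assume x: "pA < x" "x < pB"
    hence "x \<in> root_range s" using p by simp
    hence "0 < x" "36 * x^2 * (1 - 2 * x) < s^2" by (auto simp: root_range_def)
    moreover have "36 * x * (2 * x^2 - x) = - (36 * x^2 * (1 - 2 * x))" by algebra
    ultimately have "0 < 2 * x^2 - x + s^2 / (36 * x)" by (simp add: field_simps)
    hence "- (4 / x * (2 * x^2 - x + s^2 / (36 * x))) < 0" using \<open>0 < x\<close> by simp
    thus "\<exists>y. (kurt_branch s has_real_derivative y) (at x) \<and> y < 0"
      using kurt_branch_deriv[of x s] \<open>0 < x\<close> by blast
  next
    show "continuous_on {pA..pB} (kurt_branch s)"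
      unfolding kurt_branch_def using p by (intro continuous_intros) auto
  qed
  have "0 < 4 * pB * (1 - pB)" "0 \<le> s^2 / (9 * pB)" using p s by auto
  thus "1 < kurt_branch s pB" by (simp add: kurt_branch_def)
qed

lemma Q4_factorization:
  assumes "Q4 s a = 0" "Q4 s b = 0" "Q4 s c = 0" "a < b" "b < c"
  shows "Q4 s k = 9 * ((k - a) * (k - b) * (c - k))"
proof -
  define \<alpha> \<beta> \<gamma> where "\<alpha> = 36 - 9 * (a + b + c)" and "\<beta> = 18 * s^2 - 45 + 9 * (a * b + b * c + c * a)"
    and "\<gamma> = 18 - 34 * s^2 - 3 * s ^ 4 - 9 * (a * b * c)"
  have id: "Q4 s k = 9 * ((k - a) * (k - b) * (c - k)) + (\<alpha> * k^2 + \<beta> * k + \<gamma>)" for k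
    unfolding Q4_def \<alpha>_def \<beta>_def \<gamma>_def by algebra
  have "\<alpha> * a^2 + \<beta> * a + \<gamma> = 0" "\<alpha> * b^2 + \<beta> * b + \<gamma> = 0" "\<alpha> * c^2 + \<beta> * c + \<gamma> = 0"
    using id[of a] id[of b] id[of c] assms(1-3) by simp_all
  from quadratic_three_roots_zero[OF this assms(4,5)] show ?thesis using id[of k] by simp
qed

lemma Q4_zeros_eq:
  assumes "Q4 s a = 0" "Q4 s b = 0" "Q4 s c = 0" "a < b" "b < c"
  shows "k1 s = a" "k2 s = b" "k3 s = c"
proof -
  have "{k. Q4 s k = 0} = {a, b, c}"
    using Q4_factorization[OF assms] by auto
  also have "sorted_list_of_set \<dots> = [a, b, c]"
    by (rule sorted_list_of_set_unique[THEN iffD1]) (use assms in auto)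
  finally have "Q4_zeros s = [a, b, c]" unfolding Q4_zeros_def by simp
  thus "k1 s = a" "k2 s = b" "k3 s = c" by (simp_all add: k1_def k2_def k3_def)
qed

text \<open>At the ends of the range two roots of the cubic coincide: the larger two at the left
  end, where $k$ is largest, and the smaller two at the right end. There the discriminant
  vanishes, which identifies $k_3$ and $k_2$. The remaining zero $k_1$ comes from a change of sign
  between $-9$ and $1$.\<close>

lemma zeros_at_range_ends:
  assumes s: "0 < s^2" "s^2 < 4/3"
    and p: "0 < pA" "pA < pB" "pB < 1/3" "root_range s = {pA<..<pB}"
      "9 * pA * (1 - pA)^2 = s^2" "36 * pB\<^sup>2 * (1 - 2 * pB) = s^2"
  shows "k1 s < 1" "k2 s = kurt_branch s pB" "k3 s = kurt_branch s pA"
    "Q4 s (k1 s) = 0" "Q4 s (k2 s) = 0" "Q4 s (k3 s) = 0"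
proof -
  note k = kurt_branch_strict_antimono[OF s p(1-4)]
  have "(1 - pA)^2 = s^2 / (9 * pA)" using p by (simp add: field_simps)
  hence c: "Q4 s (kurt_branch s pA) = 0" using p by (simp add: Q4_kurt_branch)
  have "2 * pB\<^sup>2 - pB = - (s^2 / (36 * pB))"
    using p(1,2) unfolding p(6)[symmetric] by (simp add: field_simps power2_eq_square)
  hence b: "Q4 s (kurt_branch s pB) = 0" using p by (simp add: Q4_kurt_branch)
  have one: "Q4 s 1 < 0"
  proof -
    have "Q4 s 1 = - (3 * (s^2)^2 + 16 * s^2)" by (simp add: Q4_quadratic)
    moreover have "0 < 3 * (s^2)^2 + 16 * s^2" using s by (intro add_pos_pos mult_pos_pos) auto
    ultimately show ?thesis by linarith
  qed
  \<comment> \<open>any point far enough to the left serves; $-9$ makes the estimate easy\<close>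
  have "0 \<le> Q4 s (- 9)"
  proof -
    have "(s^2)^2 \<le> (4/3)^2" using s by (intro power_mono) auto
    moreover have "Q4 s (- 9) = - 3 * (s^2)^2 - 196 * s^2 + 9900" by (simp add: Q4_quadratic)
    ultimately show ?thesis using s(2) by (simp add: power2_eq_square)
  qed
  hence "\<exists>k\<ge>-9. k \<le> 1 \<and> Q4 s k = 0"
    using one by (intro IVT2') (auto simp: Q4_def intro!: continuous_intros)
  then obtain a where a: "a \<le> 1" "Q4 s a = 0" by blast
  have a1: "a < 1" using a one by (auto simp: less_le)
  note z = Q4_zeros_eq[OF a(2) b c less_trans[OF a1 k(2)] k(1)]
  show "k1 s < 1" "k2 s = kurt_branch s pB" "k3 s = kurt_branch s pA"
    "Q4 s (k1 s) = 0" "Q4 s (k2 s) = 0" "Q4 s (k3 s) = 0" using z a a1 b c by simp_all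
qed

lemma nn_integral_substitution_decreasing:
  fixes f g g' :: "real \<Rightarrow> real"
  assumes f: "f \<in> borel_measurable borel"
    and g: "\<And>x. x \<in> {a..b} \<Longrightarrow> (g has_real_derivative - g' x) (at x)"
    and c: "continuous_on {a..b} g'" and nn: "\<And>x. x \<in> {a..b} \<Longrightarrow> 0 \<le> g' x" and ab: "a \<le> b"
    and meas: "(\<lambda>x. f (g x) * g' x) \<in> borel_measurable borel"
  shows "(\<integral>\<^sup>+x. ennreal (f x) * indicator {g b..g a} x \<partial>lborel)
      = (\<integral>\<^sup>+x. ennreal (f (g x) * g' x) * indicator {a..b} x \<partial>lborel)"
proof -
  have "(\<integral>\<^sup>+x. ennreal (f x) * indicator {g (- (- b))..g (- (- a))} x \<partial>lborel)
      = (\<integral>\<^sup>+x. ennreal (f (g (- x)) * g' (- x)) * indicator {- b..- a} x \<partial>lborel)"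
  proof (rule nn_integral_substitution_indicator[OF f, of "- b" "- a" "\<lambda>x. g (- x)" "\<lambda>x. g' (- x)"])
    show "((\<lambda>x. g (- x)) has_real_derivative g' (- x)) (at x)" if "x \<in> {- b..- a}" for x
    proof -
      have "((\<lambda>x. g (- x)) has_real_derivative (- g' (- x)) * (- 1)) (at x)"
        by (rule DERIV_chain2[OF g]) (use that in \<open>auto intro!: derivative_eq_intros\<close>)
      thus ?thesis by simp
    qed
    show "continuous_on {- b..- a} (\<lambda>x. g' (- x))"
      by (rule continuous_on_compose2[OF c]) (auto intro!: continuous_intros)
  qed (use nn ab in auto)
  also have "\<dots> = (\<integral>\<^sup>+x. ennreal (f (g x) * g' x) * indicator {a..b} x \<partial>lborel)"
  proof -
    have ind: "indicator {a..b} (0 + (- 1) * x) = (indicator {- b..- a} x :: ennreal)" for x :: real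
      by (auto split: split_indicator)
    have "(\<integral>\<^sup>+x. ennreal (f (g x) * g' x) * indicator {a..b} x \<partial>lborel)
      = ennreal \<bar>-1\<bar> * (\<integral>\<^sup>+x. ennreal (f (g (0 + (- 1) * x)) * g' (0 + (- 1) * x)) * indicator {a..b} (0 + (- 1) * x) \<partial>lborel)"
      using meas by (intro nn_integral_real_affine) auto
    thus ?thesis unfolding ind by simp
  qed
  finally show ?thesis by simp
qed

lemma positive_region_interval:
  assumes s: "0 < s^2" "s^2 < 4/3"
  shows "k1 s < 1" "1 < k2 s" "k2 s < k3 s" "Q4 s k = 9 * ((k - k1 s) * (k - k2 s) * (k3 s - k))"
    "{k. 1 < k \<and> 0 < Q4 s k} = {k2 s<..<k3 s}"
proof -
  obtain pA pB where p: "0 < pA" "pA < pB" "pB < 1/3" "9 * pA * (1 - pA)^2 = s^2" "36 * pB\<^sup>2 * (1 - 2 * pB) = s^2"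
    "root_range s = {pA<..<pB}"
    using root_range_interval[OF s] by metis
  note z = zeros_at_range_ends[OF s p(1-3,6,4,5)]
  note k = kurt_branch_strict_antimono[OF s p(1-3,6), folded z(2,3)]
  show o: "k1 s < 1" "1 < k2 s" "k2 s < k3 s" using z k by auto
  have f: "Q4 s k = 9 * ((k - k1 s) * (k - k2 s) * (k3 s - k))" for k
    using Q4_factorization[OF z(4-6)] o by simp
  thus "Q4 s k = 9 * ((k - k1 s) * (k - k2 s) * (k3 s - k))" .
  show "{k. 1 < k \<and> 0 < Q4 s k} = {k2 s<..<k3 s}"
  proof -
    have "(0 < 9 * ((k - k1 s) * (k - k2 s) * (k3 s - k))) \<longleftrightarrow> k2 s < k \<and> k < k3 s" if "1 < k" for k
    proof -
      have "0 < k - k1 s" using that o by simp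
      hence "(0 < 9 * ((k - k1 s) * (k - k2 s) * (k3 s - k))) \<longleftrightarrow> 0 < (k - k2 s) * (k3 s - k)"
        by (simp add: mult.assoc zero_less_mult_iff)
      also have "\<dots> \<longleftrightarrow> k2 s < k \<and> k < k3 s" using o by (auto simp: zero_less_mult_iff)
      finally show ?thesis .
    qed
    thus ?thesis unfolding f using o by auto
  qed
qed

text \<open>Here $dk=\frac4p(q-p)(w-p)\,dp$ in absolute value and $\sqrt{Q_4}=12(q-p)(w-p)(w-q)$,
  so the two factors containing $p$ cancel and $1/(3p(w-q))$ remains.\<close>

lemma branch_integral:
  assumes s: "0 < s^2" "s^2 < 4/3" and h[measurable]: "h \<in> borel_measurable borel"
  shows "(\<integral>\<^sup>+p. ennreal (h (kurt_branch s p) / (3 * p * sqrt ((1 - p)^2 - s^2 / (9 * p)))) *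
        indicator (root_range s) p \<partial>lborel)
     = (\<integral>\<^sup>+k. ennreal (h k / sqrt (Q4 s k)) * indicator {k. 1 < k \<and> 0 < Q4 s k} k \<partial>lborel)"
proof -
  obtain pA pB where p: "0 < pA" "pA < pB" "pB < 1/3" "9 * pA * (1 - pA)^2 = s^2" "36 * pB\<^sup>2 * (1 - 2 * pB) = s^2"
    "root_range s = {pA<..<pB}"
    using root_range_interval[OF s] by metis
  note z = zeros_at_range_ends[OF s p(1-3,6,4,5)]
  define d where "d = (\<lambda>p. 4 / p * (2 * p^2 - p + s^2 / (36 * p)))"
  have pos: "2 * x^2 - x + s^2 / (36 * x) > 0" if "x \<in> {pA<..<pB}" for x
  proof -
    have "x \<in> root_range s" using that p(6) by simp
    hence "0 < x" "36 * x^2 * (1 - 2 * x) < s^2" by (auto simp: root_range_def)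
    moreover have "36 * x * (2 * x^2 - x) = - (36 * x^2 * (1 - 2 * x))" by algebra
    ultimately show ?thesis by (simp add: field_simps)
  qed
  have endA: "2 * pA\<^sup>2 - pA + s^2 / (36 * pA) \<ge> 0"
  proof -
    have "2 * pA\<^sup>2 - pA + s^2 / (36 * pA) = (1 - 3 * pA)^2 / 4"
      using p(1) unfolding p(4)[symmetric] by (simp add: field_simps power2_eq_square)
    also have "\<dots> \<ge> 0" by simp
    finally show ?thesis .
  qed
  have endB: "2 * pB\<^sup>2 - pB + s^2 / (36 * pB) = 0"
    using p(1,2) unfolding p(5)[symmetric] by (simp add: field_simps power2_eq_square)
  have dnn: "0 \<le> d x" if "x \<in> {pA..pB}" for x
  proof -
    have "2 * x^2 - x + s^2 / (36 * x) \<ge> 0"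
      using that pos[of x] endA endB by (cases "x = pA \<or> x = pB") auto
    thus ?thesis using that p unfolding d_def by (intro mult_nonneg_nonneg) auto
  qed
  have Qm: "(\<lambda>k. Q4 s k) \<in> borel_measurable borel" unfolding Q4_def by measurable
  have km: "kurt_branch s \<in> borel_measurable borel" unfolding kurt_branch_def by measurable
  note [measurable] = Qm km
  have AE1: "AE k in lborel. k \<noteq> a \<and> k \<noteq> b" for a b :: real
    using AE_lborel_singleton[of a] AE_lborel_singleton[of b] by eventually_elim auto
  have "(\<integral>\<^sup>+k. ennreal (h k / sqrt (Q4 s k)) * indicator {k. 1 < k \<and> 0 < Q4 s k} k \<partial>lborel)
      = (\<integral>\<^sup>+k. ennreal (h k / sqrt (Q4 s k)) * indicator {kurt_branch s pB..kurt_branch s pA} k \<partial>lborel)"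
    unfolding positive_region_interval(5)[OF s] z(2,3)
    by (intro nn_integral_cong_AE eventually_mono[OF AE1[of "kurt_branch s pB" "kurt_branch s pA"]])
       (auto split: split_indicator)
  also have "\<dots> = (\<integral>\<^sup>+p. ennreal (h (kurt_branch s p) / sqrt (Q4 s (kurt_branch s p)) * d p) * indicator {pA..pB} p \<partial>lborel)"
  proof (rule nn_integral_substitution_decreasing)
    show "(kurt_branch s has_real_derivative - d x) (at x)" if "x \<in> {pA..pB}" for x
      unfolding d_def using that p(1) by (intro kurt_branch_deriv) auto
    show "continuous_on {pA..pB} d" unfolding d_def using p(1) by (intro continuous_intros) auto
    show "(\<lambda>x. h (kurt_branch s x) / sqrt (Q4 s (kurt_branch s x)) * d x) \<in> borel_measurable borel"
      unfolding d_def by measurable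
  qed (use dnn p in auto)
  also have "\<dots> = (\<integral>\<^sup>+p. ennreal (h (kurt_branch s p) / (3 * p * sqrt ((1 - p)^2 - s^2 / (9 * p)))) *
        indicator (root_range s) p \<partial>lborel)"
    unfolding p(6)
  proof (intro nn_integral_cong_AE eventually_mono[OF AE1[of pA pB]])
    fix x assume x: "x \<noteq> pA \<and> x \<noteq> pB"
    show "ennreal (h (kurt_branch s x) / sqrt (Q4 s (kurt_branch s x)) * d x) * indicator {pA..pB} x =
       ennreal (h (kurt_branch s x) / (3 * x * sqrt ((1 - x)^2 - s^2 / (9 * x)))) * indicator {pA<..<pB} x"
    proof (cases "x \<in> {pA<..<pB}")
      case True
      define D E where "D = 2 * x^2 - x + s^2 / (36 * x)" and "E = (1 - x)^2 - s^2 / (9 * x)"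
      have D: "0 < D" using pos[OF True] by (simp add: D_def)
      have x0: "0 < x" using True p(1) by auto
      have "sqrt (Q4 s (kurt_branch s x)) = 12 * D * sqrt E"
        using x0 D by (simp add: Q4_kurt_branch D_def[symmetric] E_def[symmetric] real_sqrt_mult)
      moreover have "d x = 4 / x * D" by (simp add: d_def D_def)
      moreover have "z / (12 * D * r) * (4 / x * D) = z / (3 * x * r)" for z r
        using x0 D by (cases "r = 0") (auto simp: field_simps)
      ultimately have "h (kurt_branch s x) / sqrt (Q4 s (kurt_branch s x)) * d x = h (kurt_branch s x) / (3 * x * sqrt E)"
        by (simp only:)
      thus ?thesis using True by (simp add: E_def)
    next
      case False
      hence "x \<notin> {pA..pB}" using x by auto
      thus ?thesis using False by simp
    qed
  qed
  finally show ?thesis by simp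
qed


section \<open>Orthogonal coordinates for four independent Gaussians\<close>

definition gauss :: "real measure" where
  "gauss = density lborel (\<lambda>t. ennreal (std_normal_density t))"

lemma sets_gauss [measurable_cong, simp]: "sets gauss = sets borel"
  and space_gauss [simp]: "space gauss = UNIV"
  by (simp_all add: gauss_def)

interpretation gauss: prob_space gauss
  unfolding gauss_def by (rule prob_space_normal_density) simp

interpretation gauss_pair: pair_sigma_finite gauss gauss ..

lemma nn_integral_gauss:
  assumes "f \<in> borel_measurable borel"
  shows "(\<integral>\<^sup>+x. f x \<partial>gauss) = (\<integral>\<^sup>+x. ennreal (std_normal_density x) * f x \<partial>lborel)"
  unfolding gauss_def using assms by (subst nn_integral_density) auto

text \<open>Joint measurability as a rule for compositions, in the form in which measurability of
  iterated integrals of curried functions is derived.\<close>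

lemma measurable_curry2:
  assumes "case_prod H \<in> borel_measurable (borel \<Otimes>\<^sub>M borel)"
    and "f1 \<in> borel_measurable M" "f2 \<in> borel_measurable M"
  shows "(\<lambda>x. H (f1 x) (f2 x)) \<in> borel_measurable M"
  using measurable_compose[OF measurable_Pair[OF assms(2,3)] assms(1)] by simp

lemma measurable_curry3:
  assumes "(\<lambda>(x, y, z). H x y z) \<in> borel_measurable (borel \<Otimes>\<^sub>M borel \<Otimes>\<^sub>M borel)"
    and "f1 \<in> borel_measurable M" "f2 \<in> borel_measurable M" "f3 \<in> borel_measurable M"
  shows "(\<lambda>x. H (f1 x) (f2 x) (f3 x)) \<in> borel_measurable M"
  using measurable_compose[OF measurable_Pair[OF assms(2) measurable_Pair[OF assms(3,4)]] assms(1)] by simp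

lemma measurable_curry4:
  assumes "(\<lambda>(x, y, z, w). H x y z w) \<in> borel_measurable (borel \<Otimes>\<^sub>M borel \<Otimes>\<^sub>M borel \<Otimes>\<^sub>M borel)"
    and "f1 \<in> borel_measurable M" "f2 \<in> borel_measurable M" "f3 \<in> borel_measurable M" "f4 \<in> borel_measurable M"
  shows "(\<lambda>x. H (f1 x) (f2 x) (f3 x) (f4 x)) \<in> borel_measurable M"
  using measurable_compose[OF measurable_Pair[OF assms(2) measurable_Pair[OF assms(3) measurable_Pair[OF assms(4,5)]]] assms(1)]
  by simp

text \<open>Each step translates or rescales one variable while the other one is fixed.\<close>

lemma lborel_rotation_45:
  fixes G :: "real \<Rightarrow> real \<Rightarrow> ennreal"
  assumes G: "case_prod G \<in> borel_measurable (borel \<Otimes>\<^sub>M borel)"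
  shows "(\<integral>\<^sup>+x. \<integral>\<^sup>+y. G ((x + y) / sqrt 2) ((x - y) / sqrt 2) \<partial>lborel \<partial>lborel)
       = (\<integral>\<^sup>+u. \<integral>\<^sup>+v. G u v \<partial>lborel \<partial>lborel)"
proof -
  note [measurable (raw)] = measurable_curry2[OF G]
  have s2: "sqrt 2 \<noteq> 0" "\<bar>sqrt 2\<bar> = sqrt 2" by auto
  have "(\<integral>\<^sup>+x. \<integral>\<^sup>+y. G ((x + y) / sqrt 2) ((x - y) / sqrt 2) \<partial>lborel \<partial>lborel)
      = (\<integral>\<^sup>+y. \<integral>\<^sup>+x. G ((x + y) / sqrt 2) ((x - y) / sqrt 2) \<partial>lborel \<partial>lborel)"
    by (rule lborel_pair.Fubini') measurable
  also have "\<dots> = (\<integral>\<^sup>+y. ennreal (sqrt 2) * (\<integral>\<^sup>+u. G u (u - sqrt 2 * y) \<partial>lborel) \<partial>lborel)"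
  proof (rule nn_integral_cong)
    fix y :: real
    have e: "(- y + sqrt 2 * u + y) / sqrt 2 = u" "(- y + sqrt 2 * u - y) / sqrt 2 = u - sqrt 2 * y" for u
    proof -
      show "(- y + sqrt 2 * u + y) / sqrt 2 = u" by simp
      have "2 / sqrt 2 = sqrt 2" by (rule real_div_sqrt) simp
      thus "(- y + sqrt 2 * u - y) / sqrt 2 = u - sqrt 2 * y" by (simp add: field_simps)
    qed
    have "(\<integral>\<^sup>+x. G ((x + y) / sqrt 2) ((x - y) / sqrt 2) \<partial>lborel) = ennreal \<bar>sqrt 2\<bar> *
        (\<integral>\<^sup>+u. G ((- y + sqrt 2 * u + y) / sqrt 2) ((- y + sqrt 2 * u - y) / sqrt 2) \<partial>lborel)"
    proof (rule nn_integral_real_affine)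
      show "(\<lambda>x. G ((x + y) / sqrt 2) ((x - y) / sqrt 2)) \<in> borel_measurable borel" by measurable
    qed simp
    thus "(\<integral>\<^sup>+x. G ((x + y) / sqrt 2) ((x - y) / sqrt 2) \<partial>lborel)
        = ennreal (sqrt 2) * (\<integral>\<^sup>+u. G u (u - sqrt 2 * y) \<partial>lborel)"
      unfolding e s2 .
  qed
  also have "\<dots> = ennreal (sqrt 2) * (\<integral>\<^sup>+y. \<integral>\<^sup>+u. G u (u - sqrt 2 * y) \<partial>lborel \<partial>lborel)"
    by (rule nn_integral_cmult) measurable
  also have "(\<integral>\<^sup>+y. \<integral>\<^sup>+u. G u (u - sqrt 2 * y) \<partial>lborel \<partial>lborel)
      = (\<integral>\<^sup>+u. \<integral>\<^sup>+y. G u (u - sqrt 2 * y) \<partial>lborel \<partial>lborel)"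
    by (rule lborel_pair.Fubini') measurable
  also have "ennreal (sqrt 2) * \<dots> = (\<integral>\<^sup>+u. ennreal (sqrt 2) * (\<integral>\<^sup>+y. G u (u - sqrt 2 * y) \<partial>lborel) \<partial>lborel)"
    by (rule nn_integral_cmult[symmetric]) measurable
  also have "\<dots> = (\<integral>\<^sup>+u. \<integral>\<^sup>+v. G u v \<partial>lborel \<partial>lborel)"
  proof (rule nn_integral_cong)
    fix u :: real
    have "(\<integral>\<^sup>+v. G u v \<partial>lborel) = ennreal \<bar>- sqrt 2\<bar> * (\<integral>\<^sup>+y. G u (u + (- sqrt 2) * y) \<partial>lborel)"
    proof (rule nn_integral_real_affine)
      show "G u \<in> borel_measurable borel" by measurable
    qed simp
    thus "ennreal (sqrt 2) * (\<integral>\<^sup>+y. G u (u - sqrt 2 * y) \<partial>lborel) = (\<integral>\<^sup>+v. G u v \<partial>lborel)" by simp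
  qed
  finally show ?thesis .
qed

lemma std_normal_density_rotation:
  "std_normal_density ((x + y) / sqrt 2) * std_normal_density ((x - y) / sqrt 2)
    = std_normal_density x * std_normal_density y"
proof -
  have "((x + y) / sqrt 2)^2 + ((x - y) / sqrt 2)^2 = x^2 + y^2"
    by (simp add: power_divide power2_sum power2_diff field_simps)
  hence "- ((x + y) / sqrt 2)\<^sup>2 / 2 + - ((x - y) / sqrt 2)\<^sup>2 / 2 = - x\<^sup>2 / 2 + - y\<^sup>2 / 2"
    by (simp add: field_simps)
  hence "exp (- ((x + y) / sqrt 2)\<^sup>2 / 2) * exp (- ((x - y) / sqrt 2)\<^sup>2 / 2) = exp (- x\<^sup>2 / 2) * exp (- y\<^sup>2 / 2)"
    by (metis exp_add)
  thus ?thesis by (simp add: std_normal_density_def)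
qed

lemma gauss_rotation_45:
  fixes F :: "real \<Rightarrow> real \<Rightarrow> ennreal"
  assumes F: "case_prod F \<in> borel_measurable (borel \<Otimes>\<^sub>M borel)"
  shows "(\<integral>\<^sup>+x. \<integral>\<^sup>+y. F ((x + y) / sqrt 2) ((x - y) / sqrt 2) \<partial>gauss \<partial>gauss)
       = (\<integral>\<^sup>+u. \<integral>\<^sup>+v. F u v \<partial>gauss \<partial>gauss)"
proof -
  note [measurable (raw)] = measurable_curry2[OF F]
  have expand: "(\<integral>\<^sup>+x. \<integral>\<^sup>+y. H x y \<partial>gauss \<partial>gauss)
      = (\<integral>\<^sup>+x. \<integral>\<^sup>+y. ennreal (std_normal_density x * std_normal_density y) * H x y \<partial>lborel \<partial>lborel)"
    if H: "case_prod H \<in> borel_measurable (borel \<Otimes>\<^sub>M borel)" for H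
  proof -
    note [measurable (raw)] = measurable_curry2[OF H]
    have "(\<integral>\<^sup>+x. \<integral>\<^sup>+y. H x y \<partial>gauss \<partial>gauss)
      = (\<integral>\<^sup>+x. ennreal (std_normal_density x) * (\<integral>\<^sup>+y. H x y \<partial>gauss) \<partial>lborel)"
      by (rule nn_integral_gauss) measurable
    also have "\<dots> = (\<integral>\<^sup>+x. \<integral>\<^sup>+y. ennreal (std_normal_density x * std_normal_density y) * H x y \<partial>lborel \<partial>lborel)"
    proof (rule nn_integral_cong)
      fix x
      have "(\<integral>\<^sup>+y. H x y \<partial>gauss) = (\<integral>\<^sup>+y. ennreal (std_normal_density y) * H x y \<partial>lborel)"
        by (rule nn_integral_gauss) measurable
      thus "ennreal (std_normal_density x) * (\<integral>\<^sup>+y. H x y \<partial>gauss)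
          = (\<integral>\<^sup>+y. ennreal (std_normal_density x * std_normal_density y) * H x y \<partial>lborel)"
        by (simp add: nn_integral_cmult[symmetric] ennreal_mult' mult.assoc)
    qed
    finally show ?thesis .
  qed
  have "(\<integral>\<^sup>+x. \<integral>\<^sup>+y. F ((x + y) / sqrt 2) ((x - y) / sqrt 2) \<partial>gauss \<partial>gauss)
      = (\<integral>\<^sup>+x. \<integral>\<^sup>+y. ennreal (std_normal_density ((x + y) / sqrt 2) * std_normal_density ((x - y) / sqrt 2)) *
          F ((x + y) / sqrt 2) ((x - y) / sqrt 2) \<partial>lborel \<partial>lborel)"
    unfolding std_normal_density_rotation by (rule expand) measurable
  also have "\<dots> = (\<integral>\<^sup>+u. \<integral>\<^sup>+v. ennreal (std_normal_density u * std_normal_density v) * F u v \<partial>lborel \<partial>lborel)"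
    by (rule lborel_rotation_45) measurable
  also have "\<dots> = (\<integral>\<^sup>+u. \<integral>\<^sup>+v. F u v \<partial>gauss \<partial>gauss)" by (rule expand[symmetric]) fact
  finally show ?thesis .
qed

text \<open>The matrix of the substitution is a Kronecker product of two planar rotations by 45
  degrees (up to a reflection), so rotating pairs of coordinates four times suffices.\<close>

lemma gauss_hadamard:
  fixes F :: "real \<Rightarrow> real \<Rightarrow> real \<Rightarrow> real \<Rightarrow> ennreal"
  assumes F: "(\<lambda>(x, y, z, w). F x y z w) \<in> borel_measurable (borel \<Otimes>\<^sub>M borel \<Otimes>\<^sub>M borel \<Otimes>\<^sub>M borel)"
  shows "(\<integral>\<^sup>+x. \<integral>\<^sup>+y. \<integral>\<^sup>+z. \<integral>\<^sup>+w. F x y z w \<partial>gauss \<partial>gauss \<partial>gauss \<partial>gauss)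
      = (\<integral>\<^sup>+d. \<integral>\<^sup>+a. \<integral>\<^sup>+b. \<integral>\<^sup>+c. F ((d + a + b + c) / 2) ((d + a - b - c) / 2)
          ((d - a + b - c) / 2) ((d - a - b + c) / 2) \<partial>gauss \<partial>gauss \<partial>gauss \<partial>gauss)"
proof -
  note [measurable (raw)] = measurable_curry4[OF F]
  have half: "(x / sqrt 2 + y / sqrt 2) / sqrt 2 = (x + y) / 2" "(x / sqrt 2 - y / sqrt 2) / sqrt 2 = (x - y) / 2" for x y :: real
    by (simp_all add: add_divide_distrib diff_divide_distrib)
  have "(\<integral>\<^sup>+x. \<integral>\<^sup>+y. \<integral>\<^sup>+z. \<integral>\<^sup>+w. F x y z w \<partial>gauss \<partial>gauss \<partial>gauss \<partial>gauss)
      = (\<integral>\<^sup>+u. \<integral>\<^sup>+v. \<integral>\<^sup>+z. \<integral>\<^sup>+w. F ((u + v) / sqrt 2) ((u - v) / sqrt 2) z w \<partial>gauss \<partial>gauss \<partial>gauss \<partial>gauss)"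
    by (rule gauss_rotation_45[symmetric]) measurable
  also have "\<dots> = (\<integral>\<^sup>+u. \<integral>\<^sup>+v. \<integral>\<^sup>+u'. \<integral>\<^sup>+v'. F ((u + v) / sqrt 2) ((u - v) / sqrt 2) ((u' + v') / sqrt 2) ((u' - v') / sqrt 2)
      \<partial>gauss \<partial>gauss \<partial>gauss \<partial>gauss)"
    by (intro nn_integral_cong gauss_rotation_45[symmetric]) measurable
  also have "\<dots> = (\<integral>\<^sup>+u. \<integral>\<^sup>+u'. \<integral>\<^sup>+v. \<integral>\<^sup>+v'. F ((u + v) / sqrt 2) ((u - v) / sqrt 2) ((u' + v') / sqrt 2) ((u' - v') / sqrt 2)
      \<partial>gauss \<partial>gauss \<partial>gauss \<partial>gauss)"
    by (intro nn_integral_cong gauss_pair.Fubini') measurable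
  also have "\<dots> = (\<integral>\<^sup>+d. \<integral>\<^sup>+a. \<integral>\<^sup>+v. \<integral>\<^sup>+v'. F (((d + a) / sqrt 2 + v) / sqrt 2) (((d + a) / sqrt 2 - v) / sqrt 2)
      (((d - a) / sqrt 2 + v') / sqrt 2) (((d - a) / sqrt 2 - v') / sqrt 2) \<partial>gauss \<partial>gauss \<partial>gauss \<partial>gauss)"
    by (rule gauss_rotation_45[symmetric]) measurable
  also have "\<dots> = (\<integral>\<^sup>+d. \<integral>\<^sup>+a. \<integral>\<^sup>+b. \<integral>\<^sup>+c. F (((d + a) / sqrt 2 + (b + c) / sqrt 2) / sqrt 2) (((d + a) / sqrt 2 - (b + c) / sqrt 2) / sqrt 2)
      (((d - a) / sqrt 2 + (b - c) / sqrt 2) / sqrt 2) (((d - a) / sqrt 2 - (b - c) / sqrt 2) / sqrt 2) \<partial>gauss \<partial>gauss \<partial>gauss \<partial>gauss)"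
    by (intro nn_integral_cong gauss_rotation_45[symmetric]) measurable
  also have "\<dots> = (\<integral>\<^sup>+d. \<integral>\<^sup>+a. \<integral>\<^sup>+b. \<integral>\<^sup>+c. F ((d + a + b + c) / 2) ((d + a - b - c) / 2)
          ((d - a + b - c) / 2) ((d - a - b + c) / 2) \<partial>gauss \<partial>gauss \<partial>gauss \<partial>gauss)"
    unfolding half by (simp add: algebra_simps)
  finally show ?thesis .
qed

text \<open>Iterated integrals are used for the joint law because every later substitution changes
  one variable while the others are fixed.\<close>

lemma (in prob_space) iid_gauss_joint:
  fixes Z :: "nat \<Rightarrow> 'a \<Rightarrow> real" and F :: "real \<Rightarrow> real \<Rightarrow> real \<Rightarrow> real \<Rightarrow> ennreal"
  assumes indep: "indep_vars (\<lambda>_. borel) Z {1..4}"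
    and distr: "\<And>i. i \<in> {1..4} \<Longrightarrow> distr M borel (Z i) = gauss"
    and F: "(\<lambda>(x, y, z, w). F x y z w) \<in> borel_measurable (borel \<Otimes>\<^sub>M borel \<Otimes>\<^sub>M borel \<Otimes>\<^sub>M borel)"
  shows "(\<integral>\<^sup>+\<omega>. F (Z 1 \<omega>) (Z 2 \<omega>) (Z 3 \<omega>) (Z 4 \<omega>) \<partial>M)
    = (\<integral>\<^sup>+x. \<integral>\<^sup>+y. \<integral>\<^sup>+z. \<integral>\<^sup>+w. F x y z w \<partial>gauss \<partial>gauss \<partial>gauss \<partial>gauss)"
proof -
  note [measurable (raw)] = measurable_curry4[OF F]
  have rv: "\<And>i. i \<in> {1..4} \<Longrightarrow> random_variable borel (Z i)"
    using indep by (auto simp: indep_vars_def)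
  interpret P: product_sigma_finite "\<lambda>_::nat. gauss" ..
  have "distr M (Pi\<^sub>M {1..4} (\<lambda>_. borel)) (\<lambda>\<omega>. \<lambda>i\<in>{1..4}. Z i \<omega>) = Pi\<^sub>M {1..4} (\<lambda>i. distr M borel (Z i))"
    by (rule indep_vars_iff_distr_eq_PiM'[THEN iffD1, OF _ rv indep]) auto
  also have "\<dots> = Pi\<^sub>M {1..4} (\<lambda>_. gauss)" by (intro PiM_cong refl) (simp add: distr)
  finally have joint: "distr M (Pi\<^sub>M {1..4} (\<lambda>_. borel)) (\<lambda>\<omega>. \<lambda>i\<in>{1..4}. Z i \<omega>) = Pi\<^sub>M {1..4} (\<lambda>_. gauss)" .
  have "(\<integral>\<^sup>+\<omega>. F (Z 1 \<omega>) (Z 2 \<omega>) (Z 3 \<omega>) (Z 4 \<omega>) \<partial>M)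
      = (\<integral>\<^sup>+f. F (f 1) (f 2) (f 3) (f 4) \<partial>distr M (Pi\<^sub>M {1..4} (\<lambda>_. borel)) (\<lambda>\<omega>. \<lambda>i\<in>{1..4}. Z i \<omega>))"
  proof (subst nn_integral_distr)
    show "(\<lambda>\<omega>. \<lambda>i\<in>{1..4}. Z i \<omega>) \<in> measurable M (Pi\<^sub>M {1..4} (\<lambda>_. borel))"
      using rv by (intro measurable_restrict) auto
    show "(\<lambda>f. F (f 1) (f 2) (f 3) (f 4)) \<in> borel_measurable
        (distr M (Pi\<^sub>M {1..4} (\<lambda>_. borel)) (\<lambda>\<omega>. \<lambda>i\<in>{1..4}. Z i \<omega>))" by measurable
  qed simp
  also have "\<dots> = (\<integral>\<^sup>+f. F (f 1) (f 2) (f 3) (f 4) \<partial>Pi\<^sub>M {1..4::nat} (\<lambda>_. gauss))" unfolding joint ..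
  also have "{1..4::nat} = insert (1::nat) (insert (2::nat) (insert (3::nat) {4}))" by auto
  also have "(\<integral>\<^sup>+f. F (f 1) (f 2) (f 3) (f 4) \<partial>Pi\<^sub>M (insert (1::nat) (insert (2::nat) (insert (3::nat) {4}))) (\<lambda>_. gauss))
      = (\<integral>\<^sup>+x. \<integral>\<^sup>+f. F x (f 2) (f 3) (f 4) \<partial>Pi\<^sub>M (insert (2::nat) (insert (3::nat) {4})) (\<lambda>_. gauss) \<partial>gauss)"
    by (subst P.product_nn_integral_insert_rev) (simp_all, measurable)
  also have "\<dots> = (\<integral>\<^sup>+x. \<integral>\<^sup>+y. \<integral>\<^sup>+f. F x y (f 3) (f 4) \<partial>Pi\<^sub>M (insert (3::nat) {4}) (\<lambda>_. gauss) \<partial>gauss \<partial>gauss)"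
    by (subst P.product_nn_integral_insert_rev) (simp_all, measurable)
  also have "\<dots> = (\<integral>\<^sup>+x. \<integral>\<^sup>+y. \<integral>\<^sup>+z. \<integral>\<^sup>+f. F x y z (f 4) \<partial>Pi\<^sub>M {4::nat} (\<lambda>_. gauss) \<partial>gauss \<partial>gauss \<partial>gauss)"
    by (subst P.product_nn_integral_insert_rev) (simp_all, measurable)
  also have "\<dots> = (\<integral>\<^sup>+x. \<integral>\<^sup>+y. \<integral>\<^sup>+z. \<integral>\<^sup>+w. F x y z w \<partial>gauss \<partial>gauss \<partial>gauss \<partial>gauss)"
    by (subst P.product_nn_integral_singleton) (simp_all, measurable)
  finally show ?thesis .
qed


section \<open>Squares of Gaussians and the ordered simplex\<close>

lemma nn_integral_even:
  fixes h :: "real \<Rightarrow> ennreal"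
  assumes h[measurable]: "h \<in> borel_measurable borel" and even: "\<And>x. h (- x) = h x"
  shows "(\<integral>\<^sup>+x. h x \<partial>lborel) = 2 * (\<integral>\<^sup>+x. h x * indicator {0<..} x \<partial>lborel)"
proof -
  have "(\<integral>\<^sup>+x. h x \<partial>lborel) = (\<integral>\<^sup>+x. h x * indicator {0<..} x + h x * indicator {..<0} x \<partial>lborel)"
    by (intro nn_integral_cong_AE eventually_mono[OF AE_lborel_singleton[of 0]])
       (auto split: split_indicator)
  also have "\<dots> = (\<integral>\<^sup>+x. h x * indicator {0<..} x \<partial>lborel) + (\<integral>\<^sup>+x. h x * indicator {..<0} x \<partial>lborel)"
    by (rule nn_integral_add) measurable
  also have "(\<integral>\<^sup>+x. h x * indicator {..<0} x \<partial>lborel) = (\<integral>\<^sup>+x. h x * indicator {0<..} x \<partial>lborel)"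
  proof -
    have ind: "h (0 + (- 1) * x) * indicator {..<0} (0 + (- 1) * x) = h x * indicator {0<..} x" for x :: real
      using even[of x] by (auto split: split_indicator)
    have "(\<integral>\<^sup>+x. h x * indicator {..<0} x \<partial>lborel)
        = ennreal \<bar>- 1\<bar> * (\<integral>\<^sup>+x. h (0 + (- 1) * x) * indicator {..<0} (0 + (- 1) * x) \<partial>lborel)"
      by (rule nn_integral_real_affine) simp_all
    thus ?thesis unfolding ind by simp
  qed
  finally show ?thesis by (simp add: mult_2)
qed

text \<open>The substitution rule is applied on $[0,n]$; monotone convergence gives the
  half-line.\<close>

lemma nn_integral_substitution_square:
  fixes f :: "real \<Rightarrow> real"
  assumes f[measurable]: "f \<in> borel_measurable borel"
  shows "(\<integral>\<^sup>+u. ennreal (f u) * indicator {0<..} u \<partial>lborel)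
    = (\<integral>\<^sup>+x. ennreal (f (x^2) * (2 * x)) * indicator {0<..} x \<partial>lborel)"
proof -
  define \<mu> where "\<mu> = density lborel (\<lambda>u. ennreal (f u))"
  define \<nu> where "\<nu> = density lborel (\<lambda>x. ennreal (f (x^2) * (2 * x)))"
  have em: "emeasure \<mu> A = (\<integral>\<^sup>+u. ennreal (f u) * indicator A u \<partial>lborel)"
    "emeasure \<nu> A = (\<integral>\<^sup>+x. ennreal (f (x^2) * (2 * x)) * indicator A x \<partial>lborel)"
    if "A \<in> sets borel" for A using that by (simp_all add: \<mu>_def \<nu>_def emeasure_density)
  have "emeasure \<mu> {0..(real n)\<^sup>2} = emeasure \<nu> {0..real n}" for n
  proof -
    have d: "((\<lambda>x. x^2) has_real_derivative 2 * x) (at x)" for x :: real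
      by (auto intro!: derivative_eq_intros)
    have "continuous_on {0..real n} (\<lambda>x. 2 * x)" by (intro continuous_intros)
    from nn_integral_substitution_indicator[OF f d this] show ?thesis by (simp add: em)
  qed
  hence "(SUP n. emeasure \<mu> {0..(real n)\<^sup>2}) = (SUP n. emeasure \<nu> {0..real n})" by simp
  also have "(SUP n. emeasure \<mu> {0..(real n)\<^sup>2}) = emeasure \<mu> (\<Union>n. {0..(real n)\<^sup>2})"
    by (rule SUP_emeasure_incseq) (auto simp: \<mu>_def incseq_def intro: order_trans power_mono)
  also have "(SUP n. emeasure \<nu> {0..real n}) = emeasure \<nu> (\<Union>n. {0..real n})"
    by (rule SUP_emeasure_incseq) (auto simp: \<nu>_def incseq_def)
  also have "(\<Union>n. {0..real n}) = {0..}"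
    using real_arch_simple by auto
  also have "(\<Union>n. {0..(real n)\<^sup>2}) = {0..}"
  proof -
    have "\<exists>n. x \<le> (real n)^2" for x
    proof -
      obtain n where n: "x \<le> real n" using real_arch_simple by blast
      have "real n \<le> (real n)^2" by (cases "n = 0") (auto simp: self_le_power)
      hence "x \<le> (real n)^2" using n by (rule order_trans[rotated])
      thus ?thesis by blast
    qed
    thus ?thesis by auto
  qed
  finally have "(\<integral>\<^sup>+u. ennreal (f u) * indicator {0..} u \<partial>lborel)
      = (\<integral>\<^sup>+x. ennreal (f (x^2) * (2 * x)) * indicator {0..} x \<partial>lborel)" by (simp add: em)
  moreover have "(\<integral>\<^sup>+x. ennreal (g x) * indicator {0<..} x \<partial>lborel) = (\<integral>\<^sup>+x. ennreal (g x) * indicator {0..} x \<partial>lborel)"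
    for g :: "real \<Rightarrow> real"
    by (intro nn_integral_cong_AE eventually_mono[OF AE_lborel_singleton[of 0]])
       (auto split: split_indicator)
  ultimately show ?thesis by simp
qed

text \<open>The density of the square of a standard Gaussian.\<close>

definition chi_density :: "real \<Rightarrow> real" where
  "chi_density u = (if 0 < u then exp (- u / 2) / sqrt (2 * pi * u) else 0)"

definition chisq :: "real measure" where
  "chisq = density lborel (\<lambda>u. ennreal (chi_density u))"

lemma measurable_chi_density [measurable]: "chi_density \<in> borel_measurable borel"
  unfolding chi_density_def by measurable

lemma chi_density_nonneg: "0 \<le> chi_density u"
  by (simp add: chi_density_def)

lemma sets_chisq [measurable_cong, simp]: "sets chisq = sets borel"
  and space_chisq [simp]: "space chisq = UNIV"
  by (simp_all add: chisq_def)

lemma std_normal_density_even: "std_normal_density (- x) = std_normal_density x"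
  by (simp add: std_normal_density_def)

lemma chi_density_square: "0 < x \<Longrightarrow> chi_density (x^2) * (2 * x) = 2 * std_normal_density x"
  by (simp add: chi_density_def std_normal_density_def real_sqrt_mult)

lemma distr_gauss_square: "distr gauss borel (\<lambda>x. x^2) = chisq"
proof (rule measure_eqI)
  fix A assume "A \<in> sets (distr gauss borel (\<lambda>x. x^2))"
  hence A[measurable]: "A \<in> sets borel" by simp
  have "emeasure (distr gauss borel (\<lambda>x. x^2)) A = (\<integral>\<^sup>+x. indicator A (x^2) \<partial>gauss)"
    by (subst nn_integral_indicator[symmetric], simp, subst nn_integral_distr) measurable
  also have "\<dots> = (\<integral>\<^sup>+x. ennreal (std_normal_density x) * indicator A (x^2) \<partial>lborel)"
    by (rule nn_integral_gauss) measurable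
  also have "\<dots> = 2 * (\<integral>\<^sup>+x. ennreal (std_normal_density x) * indicator A (x^2) * indicator {0<..} x \<partial>lborel)"
    by (rule nn_integral_even) (measurable, simp add: std_normal_density_even)
  also have "\<dots> = (\<integral>\<^sup>+x. 2 * (ennreal (std_normal_density x) * indicator A (x^2) * indicator {0<..} x) \<partial>lborel)"
    by (rule nn_integral_cmult[symmetric]) measurable
  also have "\<dots> = (\<integral>\<^sup>+x. ennreal (chi_density (x^2) * indicator A (x^2) * (2 * x)) * indicator {0<..} x \<partial>lborel)"
  proof (rule nn_integral_cong)
    fix x :: real
    show "2 * (ennreal (std_normal_density x) * indicator A (x^2) * indicator {0<..} x)
        = ennreal (chi_density (x^2) * indicator A (x^2) * (2 * x)) * indicator {0<..} x"
    proof (cases "0 < x")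
      case True
      have "ennreal (2 * std_normal_density x) = 2 * ennreal (std_normal_density x)"
        by (simp add: ennreal_mult')
      thus ?thesis using True by (cases "x^2 \<in> A") (simp_all add: chi_density_square)
    qed simp
  qed
  also have "\<dots> = (\<integral>\<^sup>+u. ennreal (chi_density u * indicator A u) * indicator {0<..} u \<partial>lborel)"
    by (rule nn_integral_substitution_square[symmetric]) measurable
  also have "\<dots> = (\<integral>\<^sup>+u. ennreal (chi_density u) * indicator A u \<partial>lborel)"
    by (intro nn_integral_cong) (auto simp: chi_density_def split: split_indicator)
  also have "\<dots> = emeasure chisq A"
    by (simp add: chisq_def emeasure_density)
  finally show "emeasure (distr gauss borel (\<lambda>x. x^2)) A = emeasure chisq A" .
qed simp

interpretation chisq: prob_space chisq
  unfolding distr_gauss_square[symmetric] by (rule gauss.prob_space_distr) measurable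

interpretation chi_pair: pair_sigma_finite chisq chisq ..

lemma nn_integral_gauss_square:
  assumes "f \<in> borel_measurable borel"
  shows "(\<integral>\<^sup>+x. f (x^2) \<partial>gauss) = (\<integral>\<^sup>+u. f u \<partial>chisq)"
  unfolding distr_gauss_square[symmetric] using assms by (subst nn_integral_distr) auto

lemma nn_integral_chisq:
  assumes "f \<in> borel_measurable borel"
  shows "(\<integral>\<^sup>+x. f x \<partial>chisq) = (\<integral>\<^sup>+x. ennreal (chi_density x) * f x \<partial>lborel)"
  unfolding chisq_def using assms by (subst nn_integral_density) auto

lemma AE_chisq_neq: "AE u in chisq. u \<noteq> v"
  unfolding chisq_def by (subst AE_density) (auto intro: eventually_mono[OF AE_lborel_singleton[of v]])

definition increasing3 :: "real \<Rightarrow> real \<Rightarrow> real \<Rightarrow> ennreal" where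
  "increasing3 u v w = (if u < v \<and> v < w then 1 else 0)"

lemma measurable_increasing3 [measurable (raw)]:
  assumes [measurable]: "f \<in> borel_measurable M" "g \<in> borel_measurable M" "h \<in> borel_measurable M"
  shows "(\<lambda>x. increasing3 (f x) (g x) (h x)) \<in> borel_measurable M"
  unfolding increasing3_def by measurable

text \<open>Ties have probability zero, so the indicators of the six orderings of $u,v,w$ sum to 1
  almost everywhere. Exchanging neighbouring variables, by Fubini, carries any ordering into any
  other.\<close>

lemma exchangeable_ordering:
  fixes H :: "real \<Rightarrow> real \<Rightarrow> real \<Rightarrow> ennreal"
  assumes H: "(\<lambda>(x, y, z). H x y z) \<in> borel_measurable (borel \<Otimes>\<^sub>M borel \<Otimes>\<^sub>M borel)"
    and sym: "\<And>u v w. H u v w = H v u w" "\<And>u v w. H u v w = H u w v"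
  shows "(\<integral>\<^sup>+u. \<integral>\<^sup>+v. \<integral>\<^sup>+w. H u v w \<partial>chisq \<partial>chisq \<partial>chisq)
    = 6 * (\<integral>\<^sup>+u. \<integral>\<^sup>+v. \<integral>\<^sup>+w. H u v w * increasing3 u v w \<partial>chisq \<partial>chisq \<partial>chisq)"
proof -
  note [measurable (raw)] = measurable_curry3[OF H]
  define J where "J A = (\<integral>\<^sup>+u. \<integral>\<^sup>+v. \<integral>\<^sup>+w. H u v w * A u v w \<partial>chisq \<partial>chisq \<partial>chisq)"
    for A :: "real \<Rightarrow> real \<Rightarrow> real \<Rightarrow> ennreal"
  define meas where "meas A \<longleftrightarrow> (\<lambda>(x, y, z). A x y z) \<in> borel_measurable (borel \<Otimes>\<^sub>M borel \<Otimes>\<^sub>M borel)"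
    for A :: "real \<Rightarrow> real \<Rightarrow> real \<Rightarrow> ennreal"
  have swap12: "J (\<lambda>u v w. A v u w) = J A" if "meas A" for A
  proof -
    note [measurable (raw)] = measurable_curry3[OF that[unfolded meas_def]]
    have "J (\<lambda>u v w. A v u w) = (\<integral>\<^sup>+v. \<integral>\<^sup>+u. \<integral>\<^sup>+w. H u v w * A v u w \<partial>chisq \<partial>chisq \<partial>chisq)"
      unfolding J_def by (rule chi_pair.Fubini') measurable
    also have "\<dots> = J A" unfolding J_def by (simp only: sym(1))
    finally show ?thesis .
  qed
  have swap23: "J (\<lambda>u v w. A u w v) = J A" if "meas A" for A
  proof -
    note [measurable (raw)] = measurable_curry3[OF that[unfolded meas_def]]
    have "J (\<lambda>u v w. A u w v) = (\<integral>\<^sup>+u. \<integral>\<^sup>+w. \<integral>\<^sup>+v. H u v w * A u w v \<partial>chisq \<partial>chisq \<partial>chisq)"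
      unfolding J_def by (intro nn_integral_cong chi_pair.Fubini') measurable
    also have "\<dots> = J A" unfolding J_def by (simp only: sym(2))
    finally show ?thesis .
  qed
  have add: "J (\<lambda>u v w. A u v w + B u v w) = J A + J B" if "meas A" "meas B" for A B
  proof -
    note [measurable (raw)] = measurable_curry3[OF that(1)[unfolded meas_def]] measurable_curry3[OF that(2)[unfolded meas_def]]
    have "J (\<lambda>u v w. A u v w + B u v w) = (\<integral>\<^sup>+u. \<integral>\<^sup>+v. (\<integral>\<^sup>+w. H u v w * A u v w \<partial>chisq) +
        (\<integral>\<^sup>+w. H u v w * B u v w \<partial>chisq) \<partial>chisq \<partial>chisq)"
      unfolding J_def distrib_left by (intro nn_integral_cong nn_integral_add) measurable
    also have "\<dots> = (\<integral>\<^sup>+u. (\<integral>\<^sup>+v. \<integral>\<^sup>+w. H u v w * A u v w \<partial>chisq \<partial>chisq) +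
        (\<integral>\<^sup>+v. \<integral>\<^sup>+w. H u v w * B u v w \<partial>chisq \<partial>chisq) \<partial>chisq)"
      by (intro nn_integral_cong nn_integral_add) measurable
    also have "\<dots> = J A + J B" unfolding J_def by (intro nn_integral_add) measurable
    finally show ?thesis .
  qed
  let ?O = increasing3
  have m: "meas (\<lambda>u v w. ?O u v w)" "meas (\<lambda>u v w. ?O u w v)" "meas (\<lambda>u v w. ?O v u w)"
    "meas (\<lambda>u v w. ?O v w u)" "meas (\<lambda>u v w. ?O w u v)" "meas (\<lambda>u v w. ?O w v u)"
    unfolding meas_def by measurable
  have madd: "meas (\<lambda>u v w. A u v w + B u v w)" if "meas A" "meas B" for A B
    using that unfolding meas_def case_prod_beta by (rule borel_measurable_add)
  have perm: "J (\<lambda>u v w. ?O u w v) = J ?O" "J (\<lambda>u v w. ?O v u w) = J ?O"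
    "J (\<lambda>u v w. ?O v w u) = J ?O" "J (\<lambda>u v w. ?O w u v) = J ?O" "J (\<lambda>u v w. ?O w v u) = J ?O"
    using swap23[OF m(1)] swap12[OF m(1)] swap12[OF m(2)] swap23[OF m(3)] swap12[OF m(5)] by simp_all
  let ?S = "\<lambda>u v w. ?O u v w + (?O u w v + (?O v u w + (?O v w u + (?O w u v + ?O w v u))))"
  have "(\<integral>\<^sup>+u. \<integral>\<^sup>+v. \<integral>\<^sup>+w. H u v w \<partial>chisq \<partial>chisq \<partial>chisq)
     = J ?S"
    unfolding J_def
  proof (rule nn_integral_cong, rule nn_integral_cong_AE)
    fix u
    show "AE v in chisq. (\<integral>\<^sup>+w. H u v w \<partial>chisq) = (\<integral>\<^sup>+w. H u v w *
      ?S u v w \<partial>chisq)"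
    proof (rule eventually_mono[OF AE_chisq_neq[of u]])
      fix v assume vu: "v \<noteq> u"
      show "(\<integral>\<^sup>+w. H u v w \<partial>chisq) = (\<integral>\<^sup>+w. H u v w *
        ?S u v w \<partial>chisq)"
      proof (rule nn_integral_cong_AE, rule eventually_mono[OF eventually_conj[OF AE_chisq_neq[of u] AE_chisq_neq[of v]]])
        fix w assume "w \<noteq> u \<and> w \<noteq> v"
        hence "?S u v w = 1"
          using vu by (auto simp: increasing3_def)
        thus "H u v w = H u v w * ?S u v w"
          by simp
      qed
    qed
  qed
  also have "\<dots> = J ?O + (J ?O + (J ?O + (J ?O + (J ?O + J ?O))))"
    by (simp only: add madd m perm)
  also have "\<dots> = 6 * J ?O"
  proof -
    have "(6 :: ennreal) = 1 + (1 + (1 + (1 + (1 + 1))))" by simp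
    thus ?thesis by (simp only: distrib_right mult_1_left)
  qed
  finally show ?thesis unfolding J_def .
qed


section \<open>From the Dirichlet law to skewness\<close>

text \<open>The density of the sum of three independent squares of standard Gaussians.\<close>

definition gamma_density :: "real \<Rightarrow> real" where
  "gamma_density T = (if 0 < T then exp (- T / 2) * sqrt T / sqrt (2 * pi) else 0)"

text \<open>The Dirichlet density with all parameters $1/2$, in the first two coordinates.\<close>

definition dirichlet_density :: "real \<Rightarrow> real \<Rightarrow> real" where
  "dirichlet_density p q = (if 0 < p \<and> 0 < q \<and> p + q < 1 then 1 / (2 * pi * sqrt (p * q * (1 - p - q))) else 0)"

lemma measurable_gamma_density [measurable]: "gamma_density \<in> borel_measurable borel"
  unfolding gamma_density_def by measurable

lemma measurable_dirichlet_density [measurable (raw)]: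
  assumes [measurable]: "f \<in> borel_measurable M" "g \<in> borel_measurable M"
  shows "(\<lambda>x. dirichlet_density (f x) (g x)) \<in> borel_measurable M"
  unfolding dirichlet_density_def by measurable

lemma nn_integral_gamma_density: "(\<integral>\<^sup>+T. ennreal (gamma_density T) \<partial>lborel) = 1"
proof -
  have "(\<integral>\<^sup>+T. ennreal (gamma_density T) \<partial>lborel) = (\<integral>\<^sup>+T. ennreal (gamma_density T) * indicator {0<..} T \<partial>lborel)"
    by (intro nn_integral_cong) (auto simp: gamma_density_def split: split_indicator)
  also have "\<dots> = (\<integral>\<^sup>+x. ennreal (gamma_density (x^2) * (2 * x)) * indicator {0<..} x \<partial>lborel)"
    by (rule nn_integral_substitution_square) measurable
  also have "\<dots> = (\<integral>\<^sup>+x. 2 * (ennreal (std_normal_density x * x^2) * indicator {0<..} x) \<partial>lborel)"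
  proof (rule nn_integral_cong)
    fix x :: real
    show "ennreal (gamma_density (x^2) * (2 * x)) * indicator {0<..} x
        = 2 * (ennreal (std_normal_density x * x^2) * indicator {0<..} x)"
    proof (cases "0 < x")
      case True
      have "gamma_density (x^2) * (2 * x) = 2 * (std_normal_density x * x^2)"
        using True by (simp add: gamma_density_def std_normal_density_def power2_eq_square)
      hence "ennreal (gamma_density (x^2) * (2 * x)) = 2 * ennreal (std_normal_density x * x^2)"
        by (simp only: ennreal_mult'[of 2, simplified])
      thus ?thesis using True by (simp only: mult.assoc)
    qed simp
  qed
  also have "\<dots> = 2 * (\<integral>\<^sup>+x. ennreal (std_normal_density x * x^2) * indicator {0<..} x \<partial>lborel)"
    by (rule nn_integral_cmult) measurable
  also have "\<dots> = (\<integral>\<^sup>+x. ennreal (std_normal_density x * x^2) \<partial>lborel)"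
    by (rule nn_integral_even[symmetric]) (measurable, simp add: std_normal_density_even)
  also have "\<dots> = ennreal 1"
  proof (rule nn_integral_eq_integral[THEN trans])
    have *: "has_bochner_integral lborel (\<lambda>x. std_normal_density x * x^2) 1"
      using std_normal_moment_even[of 1] by (simp add: fact_numeral)
    show "integrable lborel (\<lambda>x. std_normal_density x * x^2)" using * by (rule integrable.intros)
    show "ennreal (\<integral>x. std_normal_density x * x^2 \<partial>lborel) = ennreal 1"
      using * by (simp add: has_bochner_integral_integral_eq)
  qed simp
  finally show ?thesis by simp
qed

lemma chi_density_scaling:
  assumes T: "0 < T" and pqw: "p + q + w = 1"
  shows "T * (T * (chi_density (T * p) * chi_density (T * q) * chi_density (T * w))) = gamma_density T * dirichlet_density p q"
proof (cases "0 < p \<and> 0 < q \<and> 0 < w")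
  case True
  have w: "1 - p - q = w" using pqw by simp
  have "exp (- (T * p) / 2) * exp (- (T * q) / 2) * exp (- (T * w) / 2) = exp (- (T * (p + q + w)) / 2)"
    by (simp add: exp_add[symmetric] algebra_simps add_divide_distrib diff_divide_distrib)
  also have "\<dots> = exp (- T / 2)" by (simp add: pqw)
  finally have e: "exp (- (T * p) / 2) * exp (- (T * q) / 2) * exp (- (T * w) / 2) = exp (- T / 2)" .
  have r: "sqrt (2 * pi * (T * p)) * sqrt (2 * pi * (T * q)) * sqrt (2 * pi * (T * w))
      = T * (2 * pi * sqrt (p * q * w)) * (sqrt (2 * pi) * sqrt T)"
  proof -
    have "sqrt (2 * pi * (T * p)) * sqrt (2 * pi * (T * q)) * sqrt (2 * pi * (T * w))
      = sqrt ((2 * pi * T)^2 * (p * q * w) * (2 * pi * T))"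
      unfolding real_sqrt_mult[symmetric] by (simp add: power2_eq_square mult_ac)
    also have "\<dots> = T * (2 * pi * sqrt (p * q * w)) * (sqrt (2 * pi) * sqrt T)"
      using T by (simp add: real_sqrt_mult mult_ac)
    finally show ?thesis .
  qed
  have "chi_density (T * p) * chi_density (T * q) * chi_density (T * w)
     = (exp (- (T * p) / 2) * exp (- (T * q) / 2) * exp (- (T * w) / 2)) /
       (sqrt (2 * pi * (T * p)) * sqrt (2 * pi * (T * q)) * sqrt (2 * pi * (T * w)))"
    using True T by (simp add: chi_density_def)
  also have "\<dots> = exp (- T / 2) / (T * (2 * pi * sqrt (p * q * w)) * (sqrt (2 * pi) * sqrt T))"
    unfolding e r ..
  finally have "T * (T * (chi_density (T * p) * chi_density (T * q) * chi_density (T * w)))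
     = T * (T * (exp (- T / 2) / (T * (2 * pi * sqrt (p * q * w)) * (sqrt (2 * pi) * sqrt T))))" by (simp only:)
  also have "\<dots> = (T / sqrt T) * exp (- T / 2) / (2 * pi * sqrt (p * q * w) * sqrt (2 * pi))"
    using T by (simp add: field_simps)
  also have "T / sqrt T = sqrt T" using T by (simp add: real_div_sqrt)
  finally show ?thesis
    using True T pqw by (simp add: gamma_density_def dirichlet_density_def w mult_ac)
next
  case False
  hence "\<not> (0 < p \<and> 0 < q \<and> p + q < 1)" using pqw by linarith
  hence "dirichlet_density p q = 0" unfolding dirichlet_density_def by (rule if_not_P)
  moreover have "chi_density (T * p) * chi_density (T * q) * chi_density (T * w) = 0"
    using False T by (auto simp: chi_density_def zero_less_mult_iff)
  ultimately show ?thesis by (simp only: mult_zero_right)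
qed

text \<open>The sum $T=u+v+w$ and the proportions are independent. For fixed $T$ the variables are
  rescaled; the density splits into a factor in $T$ with total mass 1 and the Dirichlet
  density.\<close>

lemma chi_square_dirichlet:
  fixes G :: "real \<Rightarrow> real \<Rightarrow> real \<Rightarrow> ennreal"
  assumes G: "(\<lambda>(x, y, z). G x y z) \<in> borel_measurable (borel \<Otimes>\<^sub>M borel \<Otimes>\<^sub>M borel)"
    and hom: "\<And>T u v w. 0 < T \<Longrightarrow> G (T * u) (T * v) (T * w) = G u v w"
  shows "(\<integral>\<^sup>+u. \<integral>\<^sup>+v. \<integral>\<^sup>+w. G u v w \<partial>chisq \<partial>chisq \<partial>chisq)
    = (\<integral>\<^sup>+p. \<integral>\<^sup>+q. ennreal (dirichlet_density p q) * G p q (1 - p - q) \<partial>lborel \<partial>lborel)"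
proof -
  note [measurable (raw)] = measurable_curry3[OF G]
  let ?c = chi_density
  let ?D = "\<integral>\<^sup>+p. \<integral>\<^sup>+q. ennreal (dirichlet_density p q) * G p q (1 - p - q) \<partial>lborel \<partial>lborel"
  \<comment> \<open>$T$ is the sum of all three variables and replaces the last one\<close>
  define K where "K u v T = ennreal (?c u * ?c v * ?c (T - u - v)) * G u v (T - u - v)" for u v T
  have [measurable (raw)]: "(\<lambda>x. K (f x) (g x) (h x)) \<in> borel_measurable M"
    if [measurable]: "f \<in> borel_measurable M" "g \<in> borel_measurable M" "h \<in> borel_measurable M"
    for f g h and M :: "'z measure"
    unfolding K_def by measurable
  have "(\<integral>\<^sup>+u. \<integral>\<^sup>+v. \<integral>\<^sup>+w. G u v w \<partial>chisq \<partial>chisq \<partial>chisq)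
     = (\<integral>\<^sup>+u. \<integral>\<^sup>+v. \<integral>\<^sup>+w. ennreal (?c w) * G u v w \<partial>lborel \<partial>chisq \<partial>chisq)"
    by (intro nn_integral_cong nn_integral_chisq) measurable
  also have "\<dots> = (\<integral>\<^sup>+u. \<integral>\<^sup>+v. ennreal (?c v) * (\<integral>\<^sup>+w. ennreal (?c w) * G u v w \<partial>lborel) \<partial>lborel \<partial>chisq)"
    by (intro nn_integral_cong nn_integral_chisq) measurable
  also have "\<dots> = (\<integral>\<^sup>+u. ennreal (?c u) * (\<integral>\<^sup>+v. ennreal (?c v) * (\<integral>\<^sup>+w. ennreal (?c w) * G u v w \<partial>lborel) \<partial>lborel) \<partial>lborel)"
    by (intro nn_integral_chisq) measurable
  also have "\<dots> = (\<integral>\<^sup>+u. \<integral>\<^sup>+v. \<integral>\<^sup>+w. ennreal (?c u * ?c v * ?c w) * G u v w \<partial>lborel \<partial>lborel \<partial>lborel)"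
    by (simp add: nn_integral_cmult[symmetric] ennreal_mult' chi_density_nonneg mult.assoc)
  also have "\<dots> = (\<integral>\<^sup>+u. \<integral>\<^sup>+v. \<integral>\<^sup>+T. K u v T \<partial>lborel \<partial>lborel \<partial>lborel)"
  proof (rule nn_integral_cong, rule nn_integral_cong)
    fix u v :: real
    have shift: "- (u + v) + 1 * T = T - u - v" for T :: real by simp
    have "(\<integral>\<^sup>+w. ennreal (?c u * ?c v * ?c w) * G u v w \<partial>lborel)
      = ennreal \<bar>1\<bar> * (\<integral>\<^sup>+T. ennreal (?c u * ?c v * ?c (- (u + v) + 1 * T)) * G u v (- (u + v) + 1 * T) \<partial>lborel)"
      by (rule nn_integral_real_affine) simp_all
    thus "(\<integral>\<^sup>+w. ennreal (?c u * ?c v * ?c w) * G u v w \<partial>lborel) = (\<integral>\<^sup>+T. K u v T \<partial>lborel)"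
      unfolding shift K_def by simp
  qed
  also have "\<dots> = (\<integral>\<^sup>+u. \<integral>\<^sup>+T. \<integral>\<^sup>+v. K u v T \<partial>lborel \<partial>lborel \<partial>lborel)"
    by (intro nn_integral_cong lborel_pair.Fubini') measurable
  also have "\<dots> = (\<integral>\<^sup>+T. \<integral>\<^sup>+u. \<integral>\<^sup>+v. K u v T \<partial>lborel \<partial>lborel \<partial>lborel)"
    by (rule lborel_pair.Fubini') measurable
  also have "\<dots> = (\<integral>\<^sup>+T. ennreal (gamma_density T) *
      ?D \<partial>lborel)"
  proof (rule nn_integral_cong)
    fix T :: real
    show "(\<integral>\<^sup>+u. \<integral>\<^sup>+v. K u v T \<partial>lborel \<partial>lborel) = ennreal (gamma_density T) *
      ?D"
    proof (cases "0 < T")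
      case False
      hence "K u v T = 0" for u v by (auto simp: K_def chi_density_def)
      thus ?thesis using False by (simp add: gamma_density_def)
    next
      case True
      have "(\<integral>\<^sup>+u. \<integral>\<^sup>+v. K u v T \<partial>lborel \<partial>lborel)
        = ennreal \<bar>T\<bar> * (\<integral>\<^sup>+p. \<integral>\<^sup>+v. K (0 + T * p) v T \<partial>lborel \<partial>lborel)"
        by (rule nn_integral_real_affine) (use True in simp_all)
      also have "\<dots> = ennreal T * (\<integral>\<^sup>+p. ennreal T * (\<integral>\<^sup>+q. K (T * p) (T * q) T \<partial>lborel) \<partial>lborel)"
      proof -
        have "(\<integral>\<^sup>+v. K (0 + T * p) v T \<partial>lborel) = ennreal \<bar>T\<bar> * (\<integral>\<^sup>+q. K (0 + T * p) (0 + T * q) T \<partial>lborel)" for p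
          by (rule nn_integral_real_affine) (use True in simp_all)
        thus ?thesis using True by simp
      qed
      also have "\<dots> = (\<integral>\<^sup>+p. \<integral>\<^sup>+q. ennreal T * (ennreal T * K (T * p) (T * q) T) \<partial>lborel \<partial>lborel)"
        by (simp add: nn_integral_cmult[symmetric])
      also have "\<dots> = (\<integral>\<^sup>+p. \<integral>\<^sup>+q. ennreal (gamma_density T) * (ennreal (dirichlet_density p q) * G p q (1 - p - q)) \<partial>lborel \<partial>lborel)"
      proof (rule nn_integral_cong, rule nn_integral_cong)
        fix p q
        have w: "T - T * p - T * q = T * (1 - p - q)" by (simp add: algebra_simps)
        have "ennreal T * (ennreal T * K (T * p) (T * q) T) =
            ennreal (T * (T * (?c (T * p) * ?c (T * q) * ?c (T * (1 - p - q))))) * G p q (1 - p - q)"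
          unfolding K_def w hom[OF True] using True by (simp add: ennreal_mult' mult.assoc)
        also have "\<dots> = ennreal (gamma_density T * dirichlet_density p q) * G p q (1 - p - q)"
          by (subst chi_density_scaling) (use True in auto)
        also have "\<dots> = ennreal (gamma_density T) * (ennreal (dirichlet_density p q) * G p q (1 - p - q))"
          by (subst ennreal_mult') (auto simp: gamma_density_def mult.assoc)
        finally show "ennreal T * (ennreal T * K (T * p) (T * q) T) =
          ennreal (gamma_density T) * (ennreal (dirichlet_density p q) * G p q (1 - p - q))" .
      qed
      also have "\<dots> = ennreal (gamma_density T) *
        ?D"
        by (simp add: nn_integral_cmult)
      finally show ?thesis .
    qed
  qed
  also have "\<dots> = ?D"
    by (subst nn_integral_multc) (simp_all add: nn_integral_gamma_density)
  finally show ?thesis .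
qed

text \<open>For fixed $p$ the skewness $s=6\sqrt{pq(1-p-q)}$ increases while $q$ runs from $p$ to
  $(1-p)/2$, the interval on which $p<q<1-p-q$. Since $q\ge p>0$ there, the square root stays
  differentiable.\<close>

lemma dirichlet_skewness_substitution:
  assumes h[measurable]: "h \<in> borel_measurable borel"
  shows "(\<integral>\<^sup>+q. ennreal (dirichlet_density p q * h (6 * sqrt (p * q * (1 - p - q)))) * increasing3 p q (1 - p - q) \<partial>lborel)
    = (\<integral>\<^sup>+s. ennreal (h s / (6 * pi * p * sqrt ((1 - p)^2 - s^2 / (9 * p)))) *
        (indicator {0<..} s * indicator (root_range s) p) \<partial>lborel)"
proof (cases "0 < p \<and> p < 1/3")
  case False
  have zero: "ennreal (dirichlet_density p q * h (6 * sqrt (p * q * (1 - p - q)))) * increasing3 p q (1 - p - q) = 0" for q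
    using False by (auto simp: dirichlet_density_def increasing3_def)
  have "p \<notin> root_range s" for s using False by (auto simp: root_range_def)
  thus ?thesis unfolding zero by simp
next
  case True
  define b where "b = (1 - p) / 2"
  have pb: "p < b" "b < 1" using True by (auto simp: b_def)
  define m where "m q = p * q * (1 - p - q)" for q
  define g where "g q = 6 * sqrt (m q)" for q
  define g' where "g' q = 3 * p * (1 - p - 2 * q) / sqrt (m q)" for q
  define f where "f s = h s / (6 * pi * p * sqrt ((1 - p)^2 - s^2 / (9 * p)))" for s
  have mpos: "0 < m q" if "q \<in> {p..b}" for q
    using that True pb unfolding m_def by (intro mult_pos_pos) (auto simp: b_def)
  have fm: "f \<in> borel_measurable borel" unfolding f_def by measurable
  have "(\<integral>\<^sup>+s. ennreal (f s) * indicator {g p..g b} s \<partial>lborel) = (\<integral>\<^sup>+q. ennreal (f (g q) * g' q) * indicator {p..b} q \<partial>lborel)"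
  proof (rule nn_integral_substitution_indicator[OF fm])
    show "(g has_real_derivative g' q) (at q)" if "q \<in> {p..b}" for q
    proof -
      have "(m has_real_derivative p * (1 - p - 2 * q)) (at q)"
        unfolding m_def by (auto intro!: derivative_eq_intros simp: algebra_simps)
      from DERIV_cmult[OF DERIV_chain2[OF DERIV_real_sqrt[OF mpos[OF that]] this], of 6]
      have "(g has_real_derivative 6 * (inverse (sqrt (m q)) / 2 * (p * (1 - p - 2 * q)))) (at q)"
        unfolding g_def .
      moreover have "6 * (i / 2 * (p * r)) = 3 * p * r * i" for i r :: real by simp
      ultimately show ?thesis unfolding g'_def divide_inverse[of _ "sqrt (m q)"] by (simp only:)
    qed
    show "continuous_on {p..b} g'"
      unfolding g'_def m_def using mpos[unfolded m_def] by (intro continuous_intros) fastforce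
    show "0 \<le> g' q" if "q \<in> {p..b}" for q
      using that True mpos[OF that] unfolding g'_def by (intro divide_nonneg_nonneg mult_nonneg_nonneg) (auto simp: b_def)
  qed (use pb in simp)
  also have "\<dots> = (\<integral>\<^sup>+q. ennreal (dirichlet_density p q * h (6 * sqrt (p * q * (1 - p - q)))) * increasing3 p q (1 - p - q) \<partial>lborel)"
  proof (rule nn_integral_cong_AE, rule eventually_mono[OF eventually_conj[OF AE_lborel_singleton[of p] AE_lborel_singleton[of b]]])
    fix q assume q: "q \<noteq> p \<and> q \<noteq> b"
    show "ennreal (f (g q) * g' q) * indicator {p..b} q
      = ennreal (dirichlet_density p q * h (6 * sqrt (p * q * (1 - p - q)))) * increasing3 p q (1 - p - q)"
    proof (cases "q \<in> {p..b}")
      case in_range: True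
      have mq: "0 < m q" using mpos[OF in_range] .
      have lt: "p < q" "q < 1 - p - q" "p + q < 1" using in_range q True by (auto simp: b_def)
      have "(g q)^2 = 36 * m q" using mq by (simp add: g_def power_mult_distrib)
      hence "(1 - p)^2 - (g q)^2 / (9 * p) = (1 - p - 2 * q)^2"
        using True by (simp add: m_def field_simps power2_eq_square)
      hence "sqrt ((1 - p)^2 - (g q)^2 / (9 * p)) = 1 - p - 2 * q" using lt by simp
      hence "f (g q) * g' q = h (g q) / (6 * pi * p * (1 - p - 2 * q)) * (3 * p * (1 - p - 2 * q) / sqrt (m q))"
        by (simp add: f_def g'_def)
      also have "\<dots> = h (g q) / (2 * pi * sqrt (m q))"
      proof -
        define D where "D = 1 - p - 2 * q"
        have "D > 0" using lt by (simp add: D_def)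
        thus ?thesis unfolding D_def[symmetric] using True by (simp add: field_simps)
      qed
      also have "\<dots> = dirichlet_density p q * h (6 * sqrt (p * q * (1 - p - q)))"
        using True lt by (simp add: dirichlet_density_def m_def g_def)
      finally show ?thesis using in_range lt by (simp add: increasing3_def)
    next
      case False
      hence "increasing3 p q (1 - p - q) = 0" by (auto simp: increasing3_def b_def)
      thus ?thesis using False by simp
    qed
  qed
  finally have *: "(\<integral>\<^sup>+q. ennreal (dirichlet_density p q * h (6 * sqrt (p * q * (1 - p - q)))) * increasing3 p q (1 - p - q) \<partial>lborel)
      = (\<integral>\<^sup>+s. ennreal (f s) * indicator {g p..g b} s \<partial>lborel)" ..
  have gp: "0 < g p" "(g p)^2 = 36 * p^2 * (1 - 2 * p)" and gb: "0 < g b" "(g b)^2 = 9 * p * (1 - p)^2"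
    using mpos[of p] mpos[of b] pb True
    by (auto simp: g_def power_mult_distrib m_def b_def power2_eq_square field_simps)
  have ivl: "0 < s \<and> p \<in> root_range s \<longleftrightarrow> s \<in> {g p<..<g b}" for s
  proof -
    have "0 < s \<and> p \<in> root_range s \<longleftrightarrow> 0 < s \<and> (g p)^2 < s^2 \<and> s^2 < (g b)^2"
      unfolding root_range_def gp gb using True by auto
    also have "\<dots> \<longleftrightarrow> s \<in> {g p<..<g b}"
      using gp(1) gb(1) by (auto intro: power_strict_mono power2_less_imp_less)
    finally show ?thesis .
  qed
  have ind: "indicator {0<..} s * indicator (root_range s) p = (indicator {g p<..<g b} s :: ennreal)" for s
    using ivl[of s] by (auto simp: indicator_def)
  show ?thesis unfolding * f_def[symmetric] ind
    by (intro nn_integral_cong_AE eventually_mono[OF eventually_conj[OF AE_lborel_singleton[of "g p"] AE_lborel_singleton[of "g b"]]])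
       (auto simp: indicator_def)
qed


section \<open>The probability of the event as an integral over skewness\<close>

text \<open>The definite description that defines the amplitude is proper, as the prescribed value
  of $\sin^2\phi$ lies in $[0,1]$.\<close>

lemma phi_amplitude:
  assumes s: "0 < s^2" "s^2 < 4/3" and y: "k2 s \<le> ylow x s" "ylow x s < k3 s"
  shows "phi x s \<in> {0..pi/2}" "(sin (phi x s))^2
    = (k3 s - k1 s) * (ylow x s - k2 s) / ((k3 s - k2 s) * (ylow x s - k1 s))"
proof -
  note k = positive_region_interval(1-3)[OF s]
  define y where "y = ylow x s"
  define z where "z = (k3 s - k1 s) * (y - k2 s) / ((k3 s - k2 s) * (y - k1 s))"
  have y1: "k2 s \<le> y" "y < k3 s" using assms by (auto simp: y_def)
  have den: "0 < (k3 s - k2 s) * (y - k1 s)" using k y1 by (intro mult_pos_pos) auto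
  have "0 \<le> (k3 s - y) * (k2 s - k1 s)" using k y1 by (intro mult_nonneg_nonneg) auto
  hence "(k3 s - k1 s) * (y - k2 s) \<le> (k3 s - k2 s) * (y - k1 s)" by (simp add: algebra_simps)
  hence z1: "z \<le> 1" using den by (simp add: z_def)
  have z0: "0 \<le> z" unfolding z_def using k y1 den by (intro divide_nonneg_pos mult_nonneg_nonneg) auto
  have "\<exists>!\<phi>. \<phi> \<in> {0..pi/2} \<and> (sin \<phi>)^2 = z"
  proof (rule ex1I)
    have b: "sqrt z \<le> 1" "0 \<le> sqrt z" using z0 z1 by auto
    hence "- 1 \<le> sqrt z" by linarith
    with b show "arcsin (sqrt z) \<in> {0..pi/2} \<and> (sin (arcsin (sqrt z)))^2 = z"
      using arcsin_bounded[of "sqrt z"] arcsin_le_arcsin[of 0 "sqrt z"] z0 by auto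
    fix \<phi> assume \<phi>: "\<phi> \<in> {0..pi/2} \<and> (sin \<phi>)^2 = z"
    hence "0 \<le> sin \<phi>" by (intro sin_ge_zero) auto
    hence "sin \<phi> = sqrt z" using \<phi> by (metis real_sqrt_unique)
    thus "\<phi> = arcsin (sqrt z)" using \<phi> by (simp add: arcsin_sin flip: \<open>sin \<phi> = sqrt z\<close>)
  qed
  from theI'[OF this] show "phi x s \<in> {0..pi/2}" "(sin (phi x s))^2
    = (k3 s - k1 s) * (ylow x s - k2 s) / ((k3 s - k2 s) * (ylow x s - k1 s))"
    unfolding phi_def z_def y_def by auto
qed

text \<open>Up to the factor $3/(2\pi)$, the part of the probability of $\mathrm{JB}_4\le x$ that
  comes from skewness $s$.\<close>

definition JB_slice :: "real \<Rightarrow> real \<Rightarrow> ennreal" where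
  "JB_slice x s = (\<integral>\<^sup>+k. ennreal (of_bool (jb_fun (s, k) \<le> x) / sqrt (Q4 s k)) *
     indicator {k. 1 < k \<and> 0 < Q4 s k} k \<partial>lborel)"

text \<open>Equality $4s^2=6x$ would force $k=3$.\<close>

lemma jb_fun_le_iff:
  assumes "k < 3"
  shows "jb_fun (s, k) \<le> x \<longleftrightarrow> 4 * s^2 < 6 * x \<and> 3 - sqrt (6 * x - 4 * s^2) \<le> k"
proof -
  have "jb_fun (s, k) \<le> x \<longleftrightarrow> (3 - k)^2 \<le> 6 * x - 4 * s^2"
    by (auto simp: jb_fun_def power2_commute[of k 3])
  also have "\<dots> \<longleftrightarrow> 3 - k \<le> sqrt (6 * x - 4 * s^2)"
    using assms sqrt_ge_absD[of "3 - k"] real_le_rsqrt[of "3 - k"] by auto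
  also have "\<dots> \<longleftrightarrow> 0 < 6 * x - 4 * s^2 \<and> 3 - k \<le> sqrt (6 * x - 4 * s^2)"
  proof -
    have "0 < sqrt (6 * x - 4 * s^2)" if "3 - k \<le> sqrt (6 * x - 4 * s^2)" using that assms by linarith
    thus ?thesis by auto
  qed
  finally show ?thesis by auto
qed

lemma JB_slice_eq:
  assumes s: "0 < s^2" "s^2 < 4/3"
  shows "JB_slice x s = (if s \<in> s_domain x then ennreal (2/3 * cdf_integrand x s) else 0)"
    and "s \<in> s_domain x \<Longrightarrow> 0 \<le> cdf_integrand x s"
proof -
  note k = positive_region_interval[OF s]
  let ?cubic = "\<lambda>k. (k - k1 s) * (k - k2 s) * (k3 s - k)"
  have less3: "k < 3" if "k \<in> {k2 s<..<k3 s}" for k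
  proof -
    have "1 < k \<and> 0 < Q4 s k" using that k(5) by blast
    thus ?thesis using SK_region_bounds(1)[of s k] by simp
  qed
  have "s^2 < (2 / sqrt 3)^2" using s by (simp add: power_divide)
  hence abs: "\<bar>s\<bar> < 2 / sqrt 3" using power2_less_imp_less[of "\<bar>s\<bar>" "2 / sqrt 3"] by simp
  have dom: "s \<in> s_domain x \<longleftrightarrow> 4 * s^2 < 6 * x \<and> ylow x s < k3 s"
    using s abs by (auto simp: s_domain_def)
  have slice: "JB_slice x s = (\<integral>\<^sup>+k. ennreal (of_bool (jb_fun (s, k) \<le> x) / sqrt (Q4 s k)) * indicator {k2 s<..<k3 s} k \<partial>lborel)"
    unfolding JB_slice_def k(5) ..
  show "JB_slice x s = (if s \<in> s_domain x then ennreal (2/3 * cdf_integrand x s) else 0)"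
  proof (cases "s \<in> s_domain x")
    case False
    have "\<not> jb_fun (s, k) \<le> x" if "k \<in> {k2 s<..<k3 s}" for k
      using False that less3[OF that] unfolding jb_fun_le_iff[OF less3[OF that]] dom ylow_def by auto
    hence "JB_slice x s = 0" unfolding slice by (intro nn_integral_zero') (auto split: split_indicator)
    thus ?thesis using False by simp
  next
    case True
    hence d: "4 * s^2 < 6 * x" "ylow x s < k3 s" using dom by auto
    have yl: "k2 s \<le> ylow x s" by (simp add: ylow_def)
    have "JB_slice x s = (\<integral>\<^sup>+k. ennreal (1/3) * (ennreal (1 / sqrt (?cubic k)) * indicator {ylow x s..k3 s} k) \<partial>lborel)"
      unfolding slice
    proof (rule nn_integral_cong_AE, rule eventually_mono[OF eventually_conj[OF AE_lborel_singleton[of "k2 s"] AE_lborel_singleton[of "k3 s"]]])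
      fix k' assume ne: "k' \<noteq> k2 s \<and> k' \<noteq> k3 s"
      show "ennreal (of_bool (jb_fun (s, k') \<le> x) / sqrt (Q4 s k')) * indicator {k2 s<..<k3 s} k'
        = ennreal (1/3) * (ennreal (1 / sqrt (?cubic k')) * indicator {ylow x s..k3 s} k')"
      proof (cases "k' \<in> {k2 s<..<k3 s}")
        case in_range: True
        have "jb_fun (s, k') \<le> x \<longleftrightarrow> k' \<in> {ylow x s..k3 s}"
          using jb_fun_le_iff[OF less3[OF in_range], of s x] d in_range by (auto simp: ylow_def)
        moreover have "1 / sqrt (Q4 s k') = 1/3 * (1 / sqrt (?cubic k'))"
          unfolding k(4) by (simp add: real_sqrt_mult)
        ultimately show ?thesis using in_range
          by (simp add: ennreal_mult'[symmetric] del: real_sqrt_mult)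
      next
        case False
        hence "k' \<notin> {ylow x s..k3 s}" using ne yl by auto
        thus ?thesis using False by simp
      qed
    qed
    also have "\<dots> = ennreal (1/3) * (\<integral>\<^sup>+k. ennreal (1 / sqrt (?cubic k)) * indicator {ylow x s..k3 s} k \<partial>lborel)"
      by (rule nn_integral_cmult) measurable
    also have "\<dots> = ennreal (1/3) * ennreal (2 / sqrt (k3 s - k1 s) * (ellK (modulus s) - ellF (phi x s) (modulus s)))"
      by (subst elliptic_integral_cubic(1)[OF _ k(3) yl d(2) phi_amplitude[OF s yl d(2)] modulus_def]) (use k in auto)
    also have "\<dots> = ennreal (2/3 * cdf_integrand x s)"
      by (simp add: cdf_integrand_def ennreal_mult'[symmetric])
    finally show ?thesis using True by simp
  qed
  show "0 \<le> cdf_integrand x s" if "s \<in> s_domain x"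
  proof -
    have d: "ylow x s < k3 s" using dom that by auto
    have yl: "k2 s \<le> ylow x s" by (simp add: ylow_def)
    have "ellF (phi x s) (modulus s) \<le> ellK (modulus s)"
      by (rule elliptic_integral_cubic(2)[OF _ k(3) yl d phi_amplitude[OF s yl d] modulus_def]) (use k in auto)
    thus ?thesis using k by (simp add: cdf_integrand_def)
  qed
qed

text \<open>This yields measurability of the integrand in the formula for the distribution
  function, without any study of how the zeros $k_1,k_2,k_3$ depend on $s$.\<close>

lemma measurable_JB_slice [measurable]: "JB_slice x \<in> borel_measurable borel"
proof -
  have "(\<lambda>s. \<integral>\<^sup>+k. (if 1 < k \<and> 0 < Q4 s k \<and> jb_fun (s, k) \<le> x then ennreal (1 / sqrt (Q4 s k)) else 0) \<partial>lborel) \<in> borel_measurable borel"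
    unfolding Q4_def jb_fun_def case_prod_beta by measurable
  also have "(\<lambda>s. \<integral>\<^sup>+k. (if 1 < k \<and> 0 < Q4 s k \<and> jb_fun (s, k) \<le> x then ennreal (1 / sqrt (Q4 s k)) else 0) \<partial>lborel) = JB_slice x"
    unfolding JB_slice_def by (intro ext nn_integral_cong) (auto split: split_indicator)
  finally show ?thesis .
qed

lemma JB_slice_minus: "JB_slice x (- s) = JB_slice x s"
  by (simp add: JB_slice_def jb_fun_def)

lemma JB_slice_outside: "4/3 \<le> s^2 \<Longrightarrow> JB_slice x s = 0"
proof -
  assume s: "4/3 \<le> s^2"
  have "\<not> (1 < k \<and> 0 < Q4 s k)" for k
  proof
    assume k: "1 < k \<and> 0 < Q4 s k"
    note b = SK_region_bounds[of s k]
    have "k = 7/3" "3 * s^2 = 4" using b(1,2) k s by auto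
    hence "7 - 3 * k = 0" "3 * s^2 - (9 * k - 17) = 0" by simp_all
    hence "3 * Q4 s k = 0" unfolding Q4_complete_square by (simp only:) simp
    thus False using k by simp
  qed
  thus ?thesis unfolding JB_slice_def by simp
qed

lemma root_range_outside: "4/3 \<le> s^2 \<Longrightarrow> root_range s = {}"
proof (rule ccontr)
  assume s: "4/3 \<le> s^2" and "root_range s \<noteq> {}"
  then obtain p where "0 < p" "p < 1/3" "s^2 < 9 * p * (1 - p)^2" by (auto simp: root_range_def)
  moreover from this have "9 * p * (1 - p)^2 < 9 * (1/3) * (1 - 1/3)^2" by (intro range_bounds_strict_mono) auto
  ultimately show False using s by (simp add: power2_eq_square)
qed

text \<open>The indicator of $\mathrm{JB}_4\le x$ in terms of the squares $u=a^2$, $v=b^2$,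
  $w=c^2$.\<close>

definition JB_event :: "real \<Rightarrow> real \<Rightarrow> real \<Rightarrow> real \<Rightarrow> ennreal" where
  "JB_event x u v w = (if 24 * (u * v * w) / (u + v + w) ^ 3 +
     1/6 * (4 * (u * v + v * w + w * u) / (u + v + w)^2 - 2)^2 \<le> x then 1 else 0)"

lemma measurable_JB_event: "(\<lambda>(u, v, w). JB_event x u v w) \<in> borel_measurable (borel \<Otimes>\<^sub>M borel \<Otimes>\<^sub>M borel)"
  unfolding JB_event_def by measurable

lemma JB_event_scale:
  assumes "0 < T"
  shows "JB_event x (T * u) (T * v) (T * w) = JB_event x u v w"
proof -
  have "T * u + T * v + T * w = T * (u + v + w)"
    "T * u * (T * v) + T * v * (T * w) + T * w * (T * u) = T^2 * (u * v + v * w + w * u)"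
    "T * u * (T * v) * (T * w) = T ^ 3 * (u * v * w)"
    by (simp_all add: algebra_simps power2_eq_square power3_eq_cube)
  moreover have "24 * (T ^ 3 * z) / (T * y) ^ 3 = 24 * z / y ^ 3" "4 * (T^2 * z) / (T * y)^2 = 4 * z / y^2" for y z
    using assms by (simp_all add: power_mult_distrib)
  ultimately show ?thesis unfolding JB_event_def by (simp only:)
qed

lemma JB_event_sym: "JB_event x u v w = JB_event x v u w" "JB_event x u v w = JB_event x u w v"
  by (simp_all add: JB_event_def algebra_simps)

text \<open>On the simplex $u+v+w=1$, and with the first variable as smallest root, the event
  reads $\mathrm{JB}_4\le x$ with skewness $6\sqrt{uvw}$ and with the kurtosis that belongs to
  this root. The factor is $6\cdot\frac1{2\pi}$ for the orderings and the Dirichlet density,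
  halved because the integral over positive $s$ is half of the integral over all $s$.\<close>

lemma chi_square_JB_event:
  "(\<integral>\<^sup>+u. \<integral>\<^sup>+v. \<integral>\<^sup>+w. JB_event x u v w \<partial>chisq \<partial>chisq \<partial>chisq)
    = ennreal (3 / (2 * pi)) * (\<integral>\<^sup>+s. JB_slice x s \<partial>lborel)"
proof -
  note [measurable (raw)] = measurable_curry3[OF measurable_JB_event[of x]]
  define h where "h p s = (of_bool (jb_fun (s, kurt_branch s p) \<le> x) :: real)" for p s
  have [measurable (raw)]: "(\<lambda>z. h (f z) (g z)) \<in> borel_measurable M"
    if [measurable]: "f \<in> borel_measurable M" "g \<in> borel_measurable M" for f g and M :: "'z measure"
    unfolding h_def jb_fun_def kurt_branch_def case_prod_beta by measurable
  have [measurable (raw)]: "(\<lambda>z. indicator (root_range (f z)) (g z) :: ennreal) \<in> borel_measurable M"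
    if [measurable]: "f \<in> borel_measurable M" "g \<in> borel_measurable M" for f g and M :: "'z measure"
    unfolding root_range_def indicator_def mem_Collect_eq by measurable
  define W where "W p s = ennreal (h p s / (6 * pi * p * sqrt ((1 - p)^2 - s^2 / (9 * p)))) *
        (indicator {0<..} s * indicator (root_range s) p)" for p s
  have [measurable (raw)]: "(\<lambda>z. W (f z) (g z)) \<in> borel_measurable M"
    if [measurable]: "f \<in> borel_measurable M" "g \<in> borel_measurable M" for f g and M :: "'z measure"
    unfolding W_def by measurable
  have "(\<integral>\<^sup>+u. \<integral>\<^sup>+v. \<integral>\<^sup>+w. JB_event x u v w \<partial>chisq \<partial>chisq \<partial>chisq)
    = 6 * (\<integral>\<^sup>+u. \<integral>\<^sup>+v. \<integral>\<^sup>+w. JB_event x u v w * increasing3 u v w \<partial>chisq \<partial>chisq \<partial>chisq)"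
    by (rule exchangeable_ordering[OF measurable_JB_event JB_event_sym])
  also have "(\<integral>\<^sup>+u. \<integral>\<^sup>+v. \<integral>\<^sup>+w. JB_event x u v w * increasing3 u v w \<partial>chisq \<partial>chisq \<partial>chisq)
    = (\<integral>\<^sup>+p. \<integral>\<^sup>+q. ennreal (dirichlet_density p q) * (JB_event x p q (1 - p - q) * increasing3 p q (1 - p - q)) \<partial>lborel \<partial>lborel)"
  proof (rule chi_square_dirichlet)
    show "(\<lambda>(u, v, w). JB_event x u v w * increasing3 u v w) \<in> borel_measurable (borel \<Otimes>\<^sub>M borel \<Otimes>\<^sub>M borel)"
      by measurable
    show "JB_event x (T * u) (T * v) (T * w) * increasing3 (T * u) (T * v) (T * w) = JB_event x u v w * increasing3 u v w"
      if "0 < T" for T u v w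
      using that by (simp add: JB_event_scale increasing3_def)
  qed
  also have "\<dots> = (\<integral>\<^sup>+p. \<integral>\<^sup>+q. ennreal (dirichlet_density p q * h p (6 * sqrt (p * q * (1 - p - q)))) * increasing3 p q (1 - p - q) \<partial>lborel \<partial>lborel)"
  proof (rule nn_integral_cong, rule nn_integral_cong)
    fix p q
    show "ennreal (dirichlet_density p q) * (JB_event x p q (1 - p - q) * increasing3 p q (1 - p - q))
      = ennreal (dirichlet_density p q * h p (6 * sqrt (p * q * (1 - p - q)))) * increasing3 p q (1 - p - q)"
    proof (cases "0 < p \<and> 0 < q \<and> p + q < 1")
      case True
      define m where "m = p * q * (1 - p - q)"
      have m: "0 \<le> m" using True by (simp add: m_def)
      have s2: "(6 * sqrt m)^2 = 36 * m" using m by (simp add: power_mult_distrib)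
      have "kurt_branch (6 * sqrt m) p - 3 = 4 * (p * q + q * (1 - p - q) + (1 - p - q) * p) - 2"
        unfolding kurt_branch_def s2 using True by (simp add: m_def field_simps)
      hence "jb_fun (6 * sqrt m, kurt_branch (6 * sqrt m) p)
        = 24 * m + 1/6 * (4 * (p * q + q * (1 - p - q) + (1 - p - q) * p) - 2)^2"
        by (simp only: jb_fun_def prod.case s2)
      hence "JB_event x p q (1 - p - q) = ennreal (h p (6 * sqrt m))"
        by (simp add: JB_event_def h_def m_def)
      thus ?thesis using True unfolding m_def[symmetric]
        by (subst ennreal_mult') (auto simp: dirichlet_density_def mult.assoc h_def)
    next
      case False
      hence "dirichlet_density p q = 0" unfolding dirichlet_density_def by (rule if_not_P)
      thus ?thesis by simp
    qed
  qed
  also have "\<dots> = (\<integral>\<^sup>+p. \<integral>\<^sup>+s. W p s \<partial>lborel \<partial>lborel)"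
    unfolding W_def by (intro nn_integral_cong dirichlet_skewness_substitution) measurable
  also have "\<dots> = (\<integral>\<^sup>+s. \<integral>\<^sup>+p. W p s \<partial>lborel \<partial>lborel)"
    by (rule lborel_pair.Fubini') measurable
  also have "\<dots> = (\<integral>\<^sup>+s. ennreal (1 / (2 * pi)) * (JB_slice x s * indicator {0<..} s) \<partial>lborel)"
  proof (rule nn_integral_cong)
    fix s :: real
    show "(\<integral>\<^sup>+p. W p s \<partial>lborel) = ennreal (1 / (2 * pi)) * (JB_slice x s * indicator {0<..} s)"
    proof (cases "0 < s \<and> s^2 < 4/3")
      case True
      hence s: "0 < s^2" "s^2 < 4/3" by auto
      have hm: "(\<lambda>k. of_bool (jb_fun (s, k) \<le> x) :: real) \<in> borel_measurable borel"
        unfolding jb_fun_def case_prod_beta by measurable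
      have "(\<integral>\<^sup>+p. W p s \<partial>lborel) = (\<integral>\<^sup>+p. ennreal (1 / (2 * pi)) *
          (ennreal (of_bool (jb_fun (s, kurt_branch s p) \<le> x) / (3 * p * sqrt ((1 - p)^2 - s^2 / (9 * p)))) *
          indicator (root_range s) p) \<partial>lborel)"
      proof (rule nn_integral_cong)
        fix p
        define r where "r = sqrt ((1 - p)^2 - s^2 / (9 * p))"
        define Y where "Y = of_bool (jb_fun (s, kurt_branch s p) \<le> x) / (3 * p * r)"
        have "h p s / (6 * pi * p * r) = 1 / (2 * pi) * Y" by (simp add: h_def Y_def)
        hence "ennreal (h p s / (6 * pi * p * r)) = ennreal (1 / (2 * pi)) * ennreal Y"
          by (simp only:) (rule ennreal_mult', simp)
        moreover have "indicator {0<..} s = (1 :: ennreal)" using True by simp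
        ultimately have "W p s = ennreal (1 / (2 * pi)) * (ennreal Y * indicator (root_range s) p)"
          unfolding W_def r_def[symmetric] by (simp only: mult.assoc mult_1_left)
        thus "W p s = ennreal (1 / (2 * pi)) *
          (ennreal (of_bool (jb_fun (s, kurt_branch s p) \<le> x) / (3 * p * sqrt ((1 - p)^2 - s^2 / (9 * p)))) *
          indicator (root_range s) p)" unfolding Y_def r_def .
      qed
      also have "\<dots> = ennreal (1 / (2 * pi)) * JB_slice x s"
        unfolding JB_slice_def branch_integral[OF s hm, symmetric]
      proof (rule nn_integral_cmult)
        note [measurable] = hm
        show "(\<lambda>p. ennreal (of_bool (jb_fun (s, kurt_branch s p) \<le> x) / (3 * p * sqrt ((1 - p)^2 - s^2 / (9 * p)))) *
          indicator (root_range s) p) \<in> borel_measurable lborel"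
          unfolding kurt_branch_def by measurable
      qed
      finally show ?thesis using True by simp
    next
      case False
      hence "s \<le> 0 \<or> 4/3 \<le> s^2" by auto
      thus ?thesis using root_range_outside[of s] JB_slice_outside[of s x]
        by (auto simp: W_def)
    qed
  qed
  also have "\<dots> = ennreal (1 / (2 * pi)) * (\<integral>\<^sup>+s. JB_slice x s * indicator {0<..} s \<partial>lborel)"
    by (rule nn_integral_cmult) measurable
  also have "6 * (ennreal (1 / (2 * pi)) * (\<integral>\<^sup>+s. JB_slice x s * indicator {0<..} s \<partial>lborel))
     = ennreal (3 / (2 * pi)) * (2 * (\<integral>\<^sup>+s. JB_slice x s * indicator {0<..} s \<partial>lborel))"
  proof -
    have "6 * ennreal (1 / (2 * pi)) = ennreal (6 * (1 / (2 * pi)))" by (subst ennreal_mult') simp_all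
    moreover have "ennreal (3 / (2 * pi)) * 2 = ennreal (3 / (2 * pi) * 2)" by (subst ennreal_mult') simp_all
    ultimately show ?thesis by (simp add: mult.assoc[symmetric])
  qed
  also have "2 * (\<integral>\<^sup>+s. JB_slice x s * indicator {0<..} s \<partial>lborel) = (\<integral>\<^sup>+s. JB_slice x s \<partial>lborel)"
    by (rule nn_integral_even[symmetric]) (measurable, rule JB_slice_minus)
  finally show ?thesis .
qed


section \<open>The law of skewness and kurtosis\<close>

definition moment4 :: "nat \<Rightarrow> real \<Rightarrow> real \<Rightarrow> real \<Rightarrow> real \<Rightarrow> real" where
  "moment4 r x y z w = (let m = (x + y + z + w) / 4
     in ((x - m) ^ r + (y - m) ^ r + (z - m) ^ r + (w - m) ^ r) / 4)"

definition SK4 :: "real \<Rightarrow> real \<Rightarrow> real \<Rightarrow> real \<Rightarrow> real \<times> real" where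
  "SK4 x y z w = (moment4 3 x y z w / moment4 2 x y z w powr (3/2), moment4 4 x y z w / (moment4 2 x y z w)^2)"

lemma skew_kurt_eq_SK4:
  "(skew4 X \<omega>, kurt4 X \<omega>) = SK4 (X 1 \<omega>) (X 2 \<omega>) (X 3 \<omega>) (X 4 \<omega>)"
proof -
  have I: "{1..4} = {1, 2, 3, 4 :: nat}" by auto
  have "central_moment4 X r \<omega> = moment4 r (X 1 \<omega>) (X 2 \<omega>) (X 3 \<omega>) (X 4 \<omega>)" for r
    unfolding central_moment4_def moment4_def sample_mean4_def I Let_def by (simp add: add.assoc)
  thus ?thesis by (simp add: skew4_def kurt4_def SK4_def)
qed

lemma moment4_affine: "moment4 r (\<mu> + \<sigma> * x) (\<mu> + \<sigma> * y) (\<mu> + \<sigma> * z) (\<mu> + \<sigma> * w) = \<sigma> ^ r * moment4 r x y z w"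
proof -
  have "(\<mu> + \<sigma> * x + (\<mu> + \<sigma> * y) + (\<mu> + \<sigma> * z) + (\<mu> + \<sigma> * w)) / 4 = \<mu> + \<sigma> * ((x + y + z + w) / 4)"
    by (simp add: field_simps)
  moreover have "(\<mu> + \<sigma> * t) - (\<mu> + \<sigma> * m) = \<sigma> * (t - m)" for t m by (simp add: algebra_simps)
  ultimately show ?thesis unfolding moment4_def Let_def by (simp only: power_mult_distrib) (simp add: algebra_simps)
qed

lemma powr_three_halves:
  assumes "0 \<le> (x :: real)"
  shows "x powr (3/2) = sqrt x ^ 3"
proof (cases "x = 0")
  case False
  hence "0 < x" using assms by simp
  have "x powr (3/2) = (x powr (1/2)) powr 3" by (simp add: powr_powr)
  also have "\<dots> = sqrt x powr 3" using assms by (simp only: powr_half_sqrt)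
  also have "\<dots> = sqrt x ^ 3" using \<open>0 < x\<close> by (intro powr_numeral) simp
  finally show ?thesis .
qed simp

lemma SK4_affine:
  assumes "0 < \<sigma>"
  shows "SK4 (\<mu> + \<sigma> * x) (\<mu> + \<sigma> * y) (\<mu> + \<sigma> * z) (\<mu> + \<sigma> * w) = SK4 x y z w"
proof -
  have m0: "0 \<le> moment4 2 x y z w" by (simp add: moment4_def Let_def)
  have "(\<sigma>\<^sup>2 * moment4 2 x y z w) powr (3/2) = sqrt (\<sigma>\<^sup>2 * moment4 2 x y z w) ^ 3"
    using m0 by (intro powr_three_halves) simp
  also have "\<dots> = \<sigma> ^ 3 * moment4 2 x y z w powr (3/2)"
    using assms m0 by (simp add: real_sqrt_mult power_mult_distrib powr_three_halves)
  finally have "(\<sigma>\<^sup>2 * moment4 2 x y z w) powr (3/2) = \<sigma> ^ 3 * moment4 2 x y z w powr (3/2)" .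
  thus ?thesis using assms unfolding SK4_def moment4_affine by (simp add: power_mult_distrib)
qed

definition direction_SK :: "real \<Rightarrow> real \<Rightarrow> real \<Rightarrow> real \<times> real" where
  "direction_SK a b c = (6 * (a * b * c) / (sqrt (a^2 + b^2 + c^2)) ^ 3,
     1 + 4 * (a^2 * b^2 + b^2 * c^2 + c^2 * a^2) / (a^2 + b^2 + c^2)^2)"

text \<open>If $a\ne0$, the second moment is positive, so that no quotient below is a division by
  zero.\<close>

lemma SK4_hadamard:
  assumes "a \<noteq> 0"
  shows "SK4 ((d + a + b + c) / 2) ((d + a - b - c) / 2) ((d - a + b - c) / 2) ((d - a - b + c) / 2) = direction_SK a b c"
proof -
  define R where "R = a^2 + b^2 + c^2"
  define e where "e = a^2 * b^2 + b^2 * c^2 + c^2 * a^2"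
  have R: "0 < R" using assms by (simp add: R_def add_pos_nonneg)
  have mean: "((d + a + b + c) / 2 + (d + a - b - c) / 2 + (d - a + b - c) / 2 + (d - a - b + c) / 2) / 4 = d / 2"
    by (simp add: field_simps)
  have dev: "(d + a + b + c) / 2 - d / 2 = (a + b + c) / 2" "(d + a - b - c) / 2 - d / 2 = (a - b - c) / 2"
    "(d - a + b - c) / 2 - d / 2 = (- a + b - c) / 2" "(d - a - b + c) / 2 - d / 2 = (- a - b + c) / 2"
    by (simp_all add: field_simps)
  let ?m = "\<lambda>r. moment4 r ((d + a + b + c) / 2) ((d + a - b - c) / 2) ((d - a + b - c) / 2) ((d - a - b + c) / 2)"
  have m: "?m r = (((a + b + c) / 2) ^ r + ((a - b - c) / 2) ^ r + ((- a + b - c) / 2) ^ r + ((- a - b + c) / 2) ^ r) / 4" for r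
    unfolding moment4_def Let_def mean dev ..
  have m2: "?m 2 = R / 4" unfolding m R_def by (simp add: power2_eq_square field_simps)
  have m3: "?m 3 = 3 * (a * b * c) / 4" unfolding m by (simp add: power3_eq_cube field_simps)
  have m4: "?m 4 = (R^2 + 4 * e) / 16" unfolding m R_def e_def
    by (simp add: power4_eq_xxxx power2_eq_square field_simps)
  have "(R / 4) powr (3/2) = (sqrt (R / 4)) ^ 3"
    using R by (intro powr_three_halves) simp
  also have "\<dots> = (sqrt R) ^ 3 / 8"
    by (simp add: real_sqrt_divide power_divide)
  finally have p: "(R / 4) powr (3/2) = (sqrt R) ^ 3 / 8" .
  have "3 * (a * b * c) / 4 / ((sqrt R) ^ 3 / 8) = 6 * (a * b * c) / (sqrt R) ^ 3" by simp
  moreover have "(R^2 + 4 * e) / 16 / (R / 4)^2 = 1 + 4 * e / R^2" using R by (simp add: field_simps)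
  ultimately show ?thesis unfolding SK4_def m2 m3 m4 p direction_SK_def R_def[symmetric] e_def[symmetric] by simp
qed

lemma measurable_direction_SK [measurable (raw)]:
  assumes [measurable]: "f \<in> borel_measurable M" "g \<in> borel_measurable M" "h \<in> borel_measurable M"
  shows "(\<lambda>x. direction_SK (f x) (g x) (h x)) \<in> borel_measurable M"
  unfolding direction_SK_def by measurable

lemma measurable_SK4 [measurable (raw)]:
  assumes [measurable]: "f \<in> borel_measurable M" "g \<in> borel_measurable M" "h \<in> borel_measurable M" "k \<in> borel_measurable M"
  shows "(\<lambda>x. SK4 (f x) (g x) (h x) (k x)) \<in> borel_measurable M"
  unfolding SK4_def moment4_def Let_def by measurable

lemma AE_gauss_neq: "AE x in gauss. x \<noteq> v"
  unfolding gauss_def by (subst AE_density) (auto intro: eventually_mono[OF AE_lborel_singleton[of v]])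

lemma law_of_SK:
  fixes M :: "'a measure" and X :: "nat \<Rightarrow> 'a \<Rightarrow> real" and \<mu> \<sigma> :: real and F :: "real \<times> real \<Rightarrow> ennreal"
  assumes M: "prob_space M" and \<sigma>: "\<sigma> > 0"
    and indep: "prob_space.indep_vars M (\<lambda>_. borel) X {1..4}"
    and dist: "\<And>i. i \<in> {1..4} \<Longrightarrow> distributed M lborel (X i) (\<lambda>t. ennreal (normal_density \<mu> \<sigma> t))"
    and F[measurable]: "F \<in> borel_measurable borel"
  shows "(\<integral>\<^sup>+\<omega>. F (skew4 X \<omega>, kurt4 X \<omega>) \<partial>M) = (\<integral>\<^sup>+a. \<integral>\<^sup>+b. \<integral>\<^sup>+c. F (direction_SK a b c) \<partial>gauss \<partial>gauss \<partial>gauss)"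
proof -
  interpret prob_space M by fact
  define Z where "Z i \<omega> = (X i \<omega> - \<mu>) / \<sigma>" for i \<omega>
  have indepZ: "indep_vars (\<lambda>_. borel) Z {1..4}"
    unfolding Z_def by (rule indep_vars_compose2[OF indep]) measurable
  have distrZ: "distr M borel (Z i) = gauss" if "i \<in> {1..4}" for i
  proof -
    have "distributed M lborel (Z i) (\<lambda>t. ennreal (std_normal_density t))"
      using dist[OF that] normal_standard_normal_convert[OF \<sigma>] unfolding Z_def by blast
    hence "distr M lborel (Z i) = gauss" unfolding gauss_def by (rule distributed_distr_eq_density)
    moreover have "distr M lborel (Z i) = distr M borel (Z i)" by (rule distr_cong) auto
    ultimately show ?thesis by simp
  qed
  have "(\<integral>\<^sup>+\<omega>. F (skew4 X \<omega>, kurt4 X \<omega>) \<partial>M) = (\<integral>\<^sup>+\<omega>. F (SK4 (Z 1 \<omega>) (Z 2 \<omega>) (Z 3 \<omega>) (Z 4 \<omega>)) \<partial>M)"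
  proof (rule nn_integral_cong)
    fix \<omega>
    have "X i \<omega> = \<mu> + \<sigma> * Z i \<omega>" for i using \<sigma> by (simp add: Z_def)
    thus "F (skew4 X \<omega>, kurt4 X \<omega>) = F (SK4 (Z 1 \<omega>) (Z 2 \<omega>) (Z 3 \<omega>) (Z 4 \<omega>))"
      unfolding skew_kurt_eq_SK4 by (simp only: SK4_affine[OF \<sigma>])
  qed
  also have "\<dots> = (\<integral>\<^sup>+x. \<integral>\<^sup>+y. \<integral>\<^sup>+z. \<integral>\<^sup>+w. F (SK4 x y z w) \<partial>gauss \<partial>gauss \<partial>gauss \<partial>gauss)"
    by (rule iid_gauss_joint[OF indepZ distrZ]) measurable
  also have "\<dots> = (\<integral>\<^sup>+d. \<integral>\<^sup>+a. \<integral>\<^sup>+b. \<integral>\<^sup>+c. F (SK4 ((d + a + b + c) / 2) ((d + a - b - c) / 2)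
          ((d - a + b - c) / 2) ((d - a - b + c) / 2)) \<partial>gauss \<partial>gauss \<partial>gauss \<partial>gauss)"
    by (rule gauss_hadamard) measurable
  also have "\<dots> = (\<integral>\<^sup>+d. \<integral>\<^sup>+a. \<integral>\<^sup>+b. \<integral>\<^sup>+c. F (direction_SK a b c) \<partial>gauss \<partial>gauss \<partial>gauss \<partial>gauss)"
    by (intro nn_integral_cong nn_integral_cong_AE eventually_mono[OF AE_gauss_neq[of 0]]) (simp add: SK4_hadamard)
  also have "\<dots> = (\<integral>\<^sup>+a. \<integral>\<^sup>+b. \<integral>\<^sup>+c. F (direction_SK a b c) \<partial>gauss \<partial>gauss \<partial>gauss)"
    using gauss.emeasure_space_1 by simp
  finally show ?thesis .
qed

lemma direction_SK_region:
  assumes "a \<noteq> 0"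
  shows "direction_SK a b c \<in> SK_region"
proof -
  define R where "R = a^2 + b^2 + c^2"
  define r where "r = sqrt R"
  have R: "0 < R" using assms by (simp add: R_def add_pos_nonneg)
  hence r: "0 < r" "r^2 = R" by (auto simp: r_def)
  have "(a / r)^2 + (b / r)^2 + (c / r)^2 = 1"
    using R by (simp add: power_divide r(2) R_def add_divide_distrib[symmetric])
  from sphere_point_SK_region[OF this]
  have "(6 * (a / r * (b / r) * (c / r)), 1 + 4 * ((a / r)^2 * (b / r)^2 + (b / r)^2 * (c / r)^2 + (c / r)^2 * (a / r)^2)) \<in> SK_region" .
  moreover have "6 * (a / r * (b / r) * (c / r)) = 6 * (a * b * c) / r ^ 3"
    by (simp add: power3_eq_cube)
  moreover have "1 + 4 * ((a / r)^2 * (b / r)^2 + (b / r)^2 * (c / r)^2 + (c / r)^2 * (a / r)^2)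
    = 1 + 4 * (a^2 * b^2 + b^2 * c^2 + c^2 * a^2) / R^2"
    unfolding power_divide r(2) using R by (simp add: power2_eq_square[of R] add_divide_distrib[symmetric])
  ultimately show ?thesis unfolding direction_SK_def R_def[symmetric] r_def[symmetric] by (simp only:)
qed

lemma gauss_open_pos:
  assumes "open A" "x \<in> A"
  shows "0 < emeasure gauss A"
proof (rule ccontr)
  assume "\<not> 0 < emeasure gauss A"
  hence z: "emeasure gauss A = 0" by simp
  have [measurable]: "A \<in> sets borel" using assms by simp
  have "(\<integral>\<^sup>+t. ennreal (std_normal_density t) * indicator A t \<partial>lborel) = 0"
    using z unfolding gauss_def by (simp add: emeasure_density)
  hence "AE t in lborel. ennreal (std_normal_density t) * indicator A t = 0"
    by (subst (asm) nn_integral_0_iff_AE) measurable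
  hence ae: "AE t in lborel. t \<notin> A"
  proof eventually_elim
    case (elim t)
    have "0 < std_normal_density t" by (simp add: normal_density_pos)
    thus ?case using elim by (auto split: split_indicator_asm)
  qed
  obtain e where e: "0 < e" "ball x e \<subseteq> A" using assms by (rule openE) 
  have "emeasure lborel {x - e<..<x + e} = 0"
  proof -
    have "AE t in lborel. t \<notin> {x - e<..<x + e}"
      using ae e by (auto elim!: eventually_mono simp: ball_eq_greaterThanLessThan)
    hence "{x - e<..<x + e} \<in> null_sets lborel" by (subst AE_iff_null_sets) simp_all
    thus ?thesis by (rule null_setsD1)
  qed
  thus False using e by simp
qed

text \<open>A point of the region comes from a point of the sphere, and by continuity a whole box
  around that point is mapped into the open set.\<close>

lemma open_set_meeting_region_positive:
  assumes U: "open U" "p \<in> U" "p \<in> SK_region"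
  shows "0 < (\<integral>\<^sup>+a. \<integral>\<^sup>+b. \<integral>\<^sup>+c. indicator U (direction_SK a b c) \<partial>gauss \<partial>gauss \<partial>gauss)"
proof -
  obtain s k where sk: "p = (s, k)" by (cases p)
  obtain a b c where abc: "a^2 + b^2 + c^2 = 1" "s = 6 * (a * b * c)"
    "k = 1 + 4 * (a^2 * b^2 + b^2 * c^2 + c^2 * a^2)"
    using SK_region_sphere_point U(3) sk by metis
  define f where "f = (\<lambda>(a, b, c). direction_SK a b c)"
  define D where "D = {(a, b, c). 0 < a^2 + b^2 + (c::real)^2}"
  have oD: "open D" unfolding D_def case_prod_beta by (intro open_Collect_less continuous_intros)
  have "continuous_on D f"
    unfolding f_def direction_SK_def case_prod_beta
    by (intro continuous_intros) (auto simp: D_def)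
  hence "open (D \<inter> f -` U)" using oD U(1) by (simp add: continuous_on_open_vimage Int_commute)
  moreover have "(a, b, c) \<in> D \<inter> f -` U"
    using abc U(2) sk by (simp add: D_def f_def direction_SK_def)
  ultimately obtain A B where AB: "open A" "open B" "(a, b, c) \<in> A \<times> B" "A \<times> B \<subseteq> D \<inter> f -` U"
    by (rule open_prod_elim)
  obtain B' C where BC: "open B'" "open C" "(b, c) \<in> B' \<times> C" "B' \<times> C \<subseteq> B"
    using open_prod_elim[OF AB(2), of "(b, c)"] AB(3) by auto
  have [measurable]: "A \<in> sets borel" "B' \<in> sets borel" "C \<in> sets borel" using AB BC by auto
  have "0 < emeasure gauss A * (emeasure gauss B' * emeasure gauss C)"
    using gauss_open_pos[OF AB(1), of a] gauss_open_pos[OF BC(1), of b] gauss_open_pos[OF BC(2), of c] AB(3) BC(3)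
    by (auto simp: ennreal_zero_less_mult_iff)
  also have "\<dots> = (\<integral>\<^sup>+a. \<integral>\<^sup>+b. \<integral>\<^sup>+c. indicator A a * (indicator B' b * indicator C c) \<partial>gauss \<partial>gauss \<partial>gauss)"
    by (simp add: nn_integral_cmult nn_integral_multc)
  also have "\<dots> \<le> (\<integral>\<^sup>+a. \<integral>\<^sup>+b. \<integral>\<^sup>+c. indicator U (direction_SK a b c) \<partial>gauss \<partial>gauss \<partial>gauss)"
  proof (intro nn_integral_mono)
    fix a b c
    have "direction_SK a b c \<in> U" if "a \<in> A" "b \<in> B'" "c \<in> C"
    proof -
      have "(a, b, c) \<in> f -` U" using that AB(4) BC(4) by blast
      thus ?thesis by (simp add: f_def)
    qed
    thus "indicator A a * (indicator B' b * indicator C c) \<le> (indicator U (direction_SK a b c) :: ennreal)"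
      by (auto split: split_indicator)
  qed
  finally show ?thesis .
qed


section \<open>Supports\<close>

lemma topological_support_eqI:
  assumes "closed T" and "emeasure N (- T) = 0"
    and "\<And>U x. open U \<Longrightarrow> x \<in> U \<Longrightarrow> x \<in> T \<Longrightarrow> 0 < emeasure N U"
  shows "topological_support N = T"
proof (intro equalityI subsetI)
  fix x assume "x \<in> topological_support N"
  thus "x \<in> T" using assms(1,2) unfolding topological_support_def by (force simp: open_Compl)
qed (use assms(3) in \<open>auto simp: topological_support_def\<close>)

text \<open>Along the upper edge from $(0,2)$ to a cusp the statistic takes both extreme values,
  hence all values in between.\<close>

lemma jb_fun_image_region: "jb_fun ` SK_region = {1/6..26/27}"
proof
  show "jb_fun ` SK_region \<subseteq> {1/6..26/27}" using jb_fun_region_bounds by auto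
  show "{1/6..26/27} \<subseteq> jb_fun ` SK_region"
  proof
    fix x :: real assume x: "x \<in> {1/6..26/27}"
    have "\<exists>r\<ge>0. r \<le> 1 \<and> jb_fun (boundary_curve r) = x"
    proof (rule IVT')
      show "jb_fun (boundary_curve 0) \<le> x" "x \<le> jb_fun (boundary_curve 1)"
        using x by (simp_all add: boundary_curve_special jb_fun_vertices)
      have "continuous_on UNIV jb_fun" unfolding jb_fun_def case_prod_beta by (intro continuous_intros)
      thus "continuous_on {0..1} (\<lambda>r. jb_fun (boundary_curve r))"
        by (rule continuous_on_compose2[OF _ continuous_on_boundary_curve]) auto
    qed simp
    then obtain r where r: "0 \<le> r" "r \<le> 1" "jb_fun (boundary_curve r) = x" by blast
    have "1 < sqrt 3" by simp
    hence "- sqrt 3 \<le> r" "r \<le> sqrt 3" using r by linarith+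
    hence "r \<in> {- sqrt 3..sqrt 3}" by simp
    hence "boundary_curve r \<in> {(s, k). Q4 s k = 0 \<and> 1 \<le> k}" unfolding image_boundary_curve[symmetric] by (rule imageI)
    hence "boundary_curve r \<in> SK_region" by (auto simp: SK_region_def)
    thus "x \<in> jb_fun ` SK_region" using r by blast
  qed
qed

lemma gauss_JB_event:
  "(\<integral>\<^sup>+a. \<integral>\<^sup>+b. \<integral>\<^sup>+c. indicator {p. jb_fun p \<le> x} (direction_SK a b c) \<partial>gauss \<partial>gauss \<partial>gauss)
    = ennreal (3 / (2 * pi)) * (\<integral>\<^sup>+s. JB_slice x s \<partial>lborel)"
proof -
  note [measurable (raw)] = measurable_curry3[OF measurable_JB_event[of x]]
  have ev: "indicator {p. jb_fun p \<le> x} (direction_SK a b c) = JB_event x (a^2) (b^2) (c^2)" for a b c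
  proof -
    define R where "R = a^2 + b^2 + c^2"
    have "0 \<le> R" by (simp add: R_def)
    hence "((sqrt R) ^ 3)^2 = R ^ 3" by (metis power_commutes power_mult real_sqrt_pow2 mult.commute)
    hence "(6 * (a * b * c) / (sqrt R) ^ 3)^2 = 36 * (a^2 * b^2 * c^2) / R ^ 3"
      by (simp add: power_divide power_mult_distrib)
    moreover have "2/3 * (36 * z / R ^ 3) = 24 * z / R ^ 3" "1 + t - 3 = t - 2" for z t :: real by simp_all
    ultimately have "jb_fun (direction_SK a b c) = 24 * (a^2 * b^2 * c^2) / R ^ 3
        + 1/6 * (4 * (a^2 * b^2 + b^2 * c^2 + c^2 * a^2) / R^2 - 2)^2"
      unfolding jb_fun_def direction_SK_def R_def[symmetric] prod.case by (simp only:)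
    thus ?thesis unfolding JB_event_def R_def by simp
  qed
  have "(\<integral>\<^sup>+a. \<integral>\<^sup>+b. \<integral>\<^sup>+c. indicator {p. jb_fun p \<le> x} (direction_SK a b c) \<partial>gauss \<partial>gauss \<partial>gauss)
    = (\<integral>\<^sup>+a. \<integral>\<^sup>+b. \<integral>\<^sup>+w. JB_event x (a^2) (b^2) w \<partial>chisq \<partial>gauss \<partial>gauss)"
    unfolding ev by (intro nn_integral_cong nn_integral_gauss_square) measurable
  also have "\<dots> = (\<integral>\<^sup>+a. \<integral>\<^sup>+v. \<integral>\<^sup>+w. JB_event x (a^2) v w \<partial>chisq \<partial>chisq \<partial>gauss)"
    by (intro nn_integral_cong nn_integral_gauss_square) measurable
  also have "\<dots> = (\<integral>\<^sup>+u. \<integral>\<^sup>+v. \<integral>\<^sup>+w. JB_event x u v w \<partial>chisq \<partial>chisq \<partial>chisq)"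
    by (intro nn_integral_gauss_square) measurable
  also have "\<dots> = ennreal (3 / (2 * pi)) * (\<integral>\<^sup>+s. JB_slice x s \<partial>lborel)" by (rule chi_square_JB_event)
  finally show ?thesis .
qed


section \<open>The distribution function and the theorem\<close>

lemma s_domain_square_bounds: "s \<in> s_domain x \<Longrightarrow> 0 < s^2 \<and> s^2 < 4/3"
proof -
  assume "s \<in> s_domain x"
  hence s: "0 < \<bar>s\<bar>" "\<bar>s\<bar> < 2 / sqrt 3" by (auto simp: s_domain_def)
  have "\<bar>s\<bar>\<^sup>2 < (2 / sqrt 3)^2" using s by (intro power_strict_mono) auto
  thus ?thesis using s by (simp add: power_divide)
qed

text \<open>For $s\ne0$ the integrand, extended by $0$, is $\frac32$ times the slice.\<close>

lemma cdf_integrand_integral: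
  assumes fin: "(\<integral>\<^sup>+s. JB_slice x s \<partial>lborel) < \<infinity>"
  shows "set_integrable lborel (s_domain x) (cdf_integrand x)"
    and "(LINT s:s_domain x|lborel. cdf_integrand x s) = enn2real (ennreal (3/2) * (\<integral>\<^sup>+s. JB_slice x s \<partial>lborel))"
proof -
  define u where "u s = indicator (s_domain x) s *\<^sub>R cdf_integrand x s" for s
  have in_D: "u s = enn2real (ennreal (3/2) * JB_slice x s)" "ennreal (u s) = ennreal (3/2) * JB_slice x s" "0 \<le> u s"
    if "0 < s^2" "s^2 < 4/3" for s
  proof -
    have "ennreal (3/2) * ennreal (2/3 * cdf_integrand x s) = ennreal (cdf_integrand x s)"
      by (subst ennreal_mult'[symmetric]) simp_all
    thus "u s = enn2real (ennreal (3/2) * JB_slice x s)" "ennreal (u s) = ennreal (3/2) * JB_slice x s" "0 \<le> u s"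
      using JB_slice_eq[OF that, of x] by (cases "s \<in> s_domain x"; simp add: u_def)+
  qed
  have "u = (\<lambda>s. indicator {s. 0 < s^2 \<and> s^2 < 4/3} s * enn2real (ennreal (3/2) * JB_slice x s))"
  proof
    fix s
    show "u s = indicator {s. 0 < s^2 \<and> s^2 < 4/3} s * enn2real (ennreal (3/2) * JB_slice x s)"
    proof (cases "0 < s^2 \<and> s^2 < 4/3")
      case True
      thus ?thesis using in_D(1)[of s] by simp
    next
      case False
      hence "s \<notin> s_domain x" using s_domain_square_bounds[of s x] by blast
      thus ?thesis using False by (simp add: u_def)
    qed
  qed
  moreover have "(\<lambda>s. indicator {s::real. 0 < s^2 \<and> s^2 < 4/3} s * enn2real (ennreal (3/2) * JB_slice x s)) \<in> borel_measurable borel"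
    by measurable
  ultimately have um[measurable]: "u \<in> borel_measurable borel" by simp
  have u0: "0 \<le> u s" for s
    using in_D(3)[of s] s_domain_square_bounds[of s x] by (cases "s \<in> s_domain x") (auto simp: u_def)
  have "(\<integral>\<^sup>+s. ennreal (u s) \<partial>lborel) = (\<integral>\<^sup>+s. ennreal (3/2) * JB_slice x s \<partial>lborel)"
  proof (rule nn_integral_cong_AE, rule eventually_mono[OF AE_lborel_singleton[of 0]])
    fix s :: real assume "s \<noteq> 0"
    show "ennreal (u s) = ennreal (3/2) * JB_slice x s"
    proof (cases "s^2 < 4/3")
      case True
      thus ?thesis using in_D(2)[of s] \<open>s \<noteq> 0\<close> by simp
    next
      case False
      hence "s \<notin> s_domain x" using s_domain_square_bounds[of s x] by blast
      thus ?thesis using False JB_slice_outside[of s x] by (simp add: u_def)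
    qed
  qed
  also have "\<dots> = ennreal (3/2) * (\<integral>\<^sup>+s. JB_slice x s \<partial>lborel)" by (rule nn_integral_cmult) measurable
  finally have int: "(\<integral>\<^sup>+s. ennreal (u s) \<partial>lborel) = ennreal (3/2) * (\<integral>\<^sup>+s. JB_slice x s \<partial>lborel)" .
  have "integrable lborel u"
    using fin u0 by (intro integrableI_nonneg) (auto simp: int ennreal_mult_less_top)
  thus "set_integrable lborel (s_domain x) (cdf_integrand x)"
    unfolding set_integrable_def u_def .
  have "(LINT s|lborel. u s) = enn2real (\<integral>\<^sup>+s. ennreal (u s) \<partial>lborel)"
    using u0 by (intro integral_eq_nn_integral) auto
  hence "(LINT s|lborel. u s) = enn2real (ennreal (3/2) * (\<integral>\<^sup>+s. JB_slice x s \<partial>lborel))"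
    unfolding int .
  thus "(LINT s:s_domain x|lborel. cdf_integrand x s) = enn2real (ennreal (3/2) * (\<integral>\<^sup>+s. JB_slice x s \<partial>lborel))"
    unfolding set_lebesgue_integral_def u_def .
qed

theorem proposition4:
  fixes M :: "'a measure" and X :: "nat \<Rightarrow> 'a \<Rightarrow> real" and \<mu> \<sigma> :: real
  assumes "prob_space M" and "\<sigma> > 0"
    and "prob_space.indep_vars M (\<lambda>_. borel) X {1..4}"
    and "\<And>i. i \<in> {1..4} \<Longrightarrow> distributed M lborel (X i) (\<lambda>t. ennreal (normal_density \<mu> \<sigma> t))"
  shows "topological_support (distr M borel (JB4 X)) = {1/6..26/27}
    \<and> jb_fun ` critical_points (SK_boundary M X) = {1/6, x_star, 2/3, 26/27}
    \<and> {p \<in> critical_points (SK_boundary M X). jb_fun p = 1/6} = {(0, 2)}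
    \<and> {p \<in> critical_points (SK_boundary M X). jb_fun p = x_star} = {p \<in> \<Union>(lower_edges (SK_boundary M X)). snd p = k_star}
    \<and> (\<forall>E \<in> lower_edges (SK_boundary M X). \<exists>p \<in> E. snd p = k_star \<and> tangency_at p)
    \<and> {p \<in> critical_points (SK_boundary M X). jb_fun p = 2/3} = {(0, 1)}
    \<and> {p \<in> critical_points (SK_boundary M X). jb_fun p = 26/27} = {(2 / sqrt 3, 7/3), (- 2 / sqrt 3, 7/3)}
    \<and> \<bar>x_star - 0.47309\<bar> \<le> 0.000005
    \<and> (\<forall>x\<ge>0. set_integrable lborel (s_domain x) (cdf_integrand x)
          \<and> cdf (distr M borel (JB4 X)) x
              = 1 / pi * (LINT s:s_domain x|lborel. cdf_integrand x s))"
proof -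
  interpret prob_space M by fact
  define SK where "SK \<omega> = (skew4 X \<omega>, kurt4 X \<omega>)" for \<omega>
  define \<nu> where "\<nu> = distr M borel SK"
  have X: "X i \<in> borel_measurable M" if "i \<in> {1..4}" for i
    using distributed_measurable[OF assms(4)[OF that]] by simp
  have X1234: "X 1 \<in> borel_measurable M" "X 2 \<in> borel_measurable M" "X 3 \<in> borel_measurable M" "X 4 \<in> borel_measurable M"
    by (rule X; simp)+
  have SKm[measurable]: "SK \<in> borel_measurable M"
    unfolding SK_def skew_kurt_eq_SK4 by (rule measurable_SK4[OF X1234])
  have jbc: "continuous_on UNIV jb_fun" unfolding jb_fun_def case_prod_beta by (intro continuous_intros)
  have jbm[measurable]: "jb_fun \<in> borel_measurable borel"
    by (rule borel_measurable_continuous_onI[OF jbc])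
  have \<nu>: "emeasure \<nu> U = (\<integral>\<^sup>+a. \<integral>\<^sup>+b. \<integral>\<^sup>+c. indicator U (direction_SK a b c) \<partial>gauss \<partial>gauss \<partial>gauss)"
    if [measurable]: "U \<in> sets borel" for U
  proof -
    have "emeasure \<nu> U = (\<integral>\<^sup>+p. indicator U p \<partial>\<nu>)" by (simp add: \<nu>_def)
    also have "\<dots> = (\<integral>\<^sup>+\<omega>. indicator U (SK \<omega>) \<partial>M)"
      unfolding \<nu>_def by (rule nn_integral_distr) measurable
    also have "\<dots> = (\<integral>\<^sup>+a. \<integral>\<^sup>+b. \<integral>\<^sup>+c. indicator U (direction_SK a b c) \<partial>gauss \<partial>gauss \<partial>gauss)"
      unfolding SK_def by (rule law_of_SK[OF assms]) measurable
    finally show ?thesis .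
  qed
  have null: "emeasure \<nu> (- SK_region) = 0"
  proof -
    have "emeasure \<nu> (- SK_region) = (\<integral>\<^sup>+a. 0 \<partial>gauss)"
      unfolding \<nu>[OF borel_open[OF open_Compl[OF closed_SK_region]]]
      by (intro nn_integral_cong_AE eventually_mono[OF AE_gauss_neq[of 0]]) (simp add: direction_SK_region)
    thus ?thesis by simp
  qed
  have pos: "0 < emeasure \<nu> U" if "open U" "p \<in> U" "p \<in> SK_region" for U p
    using open_set_meeting_region_positive[OF that] \<nu>[of U] that(1) by simp
  have "topological_support \<nu> = SK_region"
    by (rule topological_support_eqI[OF closed_SK_region null pos])
  moreover have "SK = (\<lambda>\<omega>. (skew4 X \<omega>, kurt4 X \<omega>))" by (simp add: SK_def fun_eq_iff)
  ultimately have boundary: "SK_boundary M X = frontier SK_region"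
    by (simp only: SK_boundary_def \<nu>_def)
  have JB: "JB4 X = (\<lambda>\<omega>. jb_fun (SK \<omega>))" by (simp add: fun_eq_iff JB4_def SK_def)
  have JBd: "distr M borel (JB4 X) = distr \<nu> borel jb_fun"
    unfolding JB \<nu>_def by (subst distr_distr) (auto simp: comp_def)
  have JBe: "emeasure (distr M borel (JB4 X)) V = emeasure \<nu> (jb_fun -` V)" if "V \<in> sets borel" for V
    unfolding JBd using that by (subst emeasure_distr) (auto simp: \<nu>_def)
  have supp: "topological_support (distr M borel (JB4 X)) = {1/6..26/27}"
  proof (rule topological_support_eqI)
    show "emeasure (distr M borel (JB4 X)) (- {1/6..26/27}) = 0"
    proof -
      have "jb_fun -` (- {1/6..26/27}) \<subseteq> - SK_region"
        using jb_fun_image_region by blast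
      moreover have "- SK_region \<in> sets \<nu>" using closed_SK_region by (simp add: \<nu>_def borel_closed borel_open open_Compl)
      ultimately have "emeasure \<nu> (jb_fun -` (- {1/6..26/27})) \<le> emeasure \<nu> (- SK_region)"
        by (rule emeasure_mono)
      thus ?thesis using null by (simp add: JBe)
    qed
    fix V x assume V: "open V" "x \<in> V" "x \<in> {1/6..26/27::real}"
    have "x \<in> jb_fun ` SK_region" unfolding jb_fun_image_region by (rule V(3))
    then obtain p where p: "p \<in> SK_region" "jb_fun p = x" by blast
    have "open (jb_fun -` V)" using jbc V(1) by (simp add: continuous_on_open_vimage)
    hence "0 < emeasure \<nu> (jb_fun -` V)" using pos[of "jb_fun -` V" p] p V(2) by simp
    thus "0 < emeasure (distr M borel (JB4 X)) V" using JBe[of V] V(1) by simp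
  qed simp
  have cdf: "set_integrable lborel (s_domain x) (cdf_integrand x)
      \<and> cdf (distr M borel (JB4 X)) x = 1 / pi * (LINT s:s_domain x|lborel. cdf_integrand x s)" for x
  proof -
    define I where "I = (\<integral>\<^sup>+s. JB_slice x s \<partial>lborel)"
    interpret D: prob_space "distr M borel (JB4 X)" unfolding JB by (rule prob_space_distr) measurable
    have vim: "jb_fun -` {..x} = {p. jb_fun p \<le> x}" by auto
    have set: "{p. jb_fun p \<le> x} \<in> sets borel"
      using measurable_sets[OF jbm, of "{..x}"] by (simp add: vim)
    have e: "emeasure (distr M borel (JB4 X)) {..x} = ennreal (3 / (2 * pi)) * I"
      using gauss_JB_event[of x] by (simp add: JBe vim \<nu>[OF set] I_def)
    have "ennreal (3 / (2 * pi)) * I < \<infinity>"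
      using D.emeasure_finite[of "{..x}"] unfolding e by (simp add: less_top)
    hence fin: "I < \<infinity>" by (auto simp: ennreal_mult_less_top)
    have "cdf (distr M borel (JB4 X)) x = enn2real (ennreal (3 / (2 * pi)) * I)"
      by (simp add: cdf_def measure_def e)
    also have "\<dots> = 1 / pi * enn2real (ennreal (3/2) * I)"
      by (simp add: enn2real_mult)
    finally show ?thesis
      using cdf_integrand_integral[of x] fin unfolding I_def by simp
  qed
  show ?thesis
    unfolding boundary lower_edges_k_star
    by (intro conjI ballI allI impI supp critical_values x_star_bounds tangency_on_lower_edges
      cdf[THEN conjunct1] cdf[THEN conjunct2])
qed

end
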